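(* For each composition $\mu\in\mathcal{C}_n$, the algebra $bTL_n^\mu=\mathbb{E}_{\mathbf{I}}\,bTL_n(q)$ (where $\mathbf{I}$ is the linear set partition with $\|\mathbf{I}\|=\mu$) is cellular with cellular basis given by the images of $\{\mathbf{m}^{\boldsymbol\lambda}_{\mathfrak{s}\mathfrak{t}}\mid \mathfrak{s},\mathfrak{t}\in T(\boldsymbol\lambda),\ \boldsymbol\lambda\in\mathcal{M}\mathrm{Par}_n^{\leq 2},\ \operatorname{comp}(\boldsymbol\lambda)=\mu\}$. Consequently $bTL_n(q)$ is cellular with cellular basis given by the images of $\{\mathbf{m}^{\boldsymbol\lambda}_{\mathfrak{s}\mathfrak{t}}\mid \boldsymbol\lambda\in\mathcal{M}\mathrm{Par}_n^{\leq 2},\ \mathfrak{s},\mathfrak{t}\in T(\boldsymbol\lambda)\}$.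
   Context: $\mathbb{S}=\mathbb{C}[q,q^{-1}]$. $bH_n(q)$ is the $\mathbb{S}$--algebra with generators $e_1,\dots,e_{n-1}$, $z_1,\dots,z_{n-1}$ and relations: $e_i^2=e_i$, $e_ie_j=e_je_i$; $z_iz_jz_i=z_jz_iz_j$ if $|i-j|=1$, $z_iz_j=z_jz_i$ if $|i-j|>1$; $e_iz_i=z_i$; $e_iz_j=z_je_i$; $z_i^2=e_i+(q-q^{-1})z_i$. $bTL_n(q)$ is its quotient by the two-sided ideal generated by $e_ie_j(1+qz_i+qz_j+q^2z_iz_j+q^2z_jz_i+q^3z_iz_jz_i)$, $|i-j|=1$. Linear set partitions of $[n]$ have interval blocks; $\|\mathbf{I}\|$ is the composition of block sizes; $\mathbf{I}\preceq\mathbf{J}$ iff each block of $\mathbf{J}$ is a union of blocks of $\mathbf{I}$; $\operatorname{E}_\mathbf{J}=\prod e_i$ over $i$ with $i,i+1$ in one block of $\mathbf{J}$; $\mathbb{E}_\mathbf{I}=\sum_{\mathbf{J}\succeq\mathbf{I}}(-1)^{|\mathbf{I}|-|\mathbf{J}|}\operatorname{E}_\mathbf{J}$ ($|\cdot|$ = number of blocks). $*$ is the anti-automorphism fixing all $e_i,z_i$; $z_w=z_{i_1}\cdots z_{i_r}$ for a reduced expression $w=s_{i_1}\cdots s_{i_r}$, $\ell(w)=r$. A multipartition $\boldsymbol\lambda=(\lambda^{(1)},\dots,\lambda^{(k)})$ of $n$ has nonempty partition components; $\operatorname{comp}(\boldsymbol\lambda)=(|\lambda^{(1)}|,\dots,|\lambda^{(k)}|)$;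 $\mathcal{M}\mathrm{Par}_n^{\leq2}$ is the set of those whose every component has Young diagram with at most two columns. $\mathbf{I}_{\boldsymbol\lambda}$ is the linear set partition with $\|\mathbf{I}_{\boldsymbol\lambda}\|=\operatorname{comp}(\boldsymbol\lambda)$. $\mathfrak{t}^{\boldsymbol\lambda}$ is the multitableau with $1,\dots,n$ entered in order along rows of successive components; $\mathfrak{S}_{\boldsymbol\lambda}$ its row stabilizer; $d(\mathfrak{s})$ the permutation with $\mathfrak{t}^{\boldsymbol\lambda}d(\mathfrak{s})=\mathfrak{s}$. $T(\boldsymbol\lambda)$ is the set of standard $\boldsymbol\lambda$-multitableaux (rows and columns increasing in each component) of the initial kind (the $i$th component contains exactly the entries of the $i$th component of $\mathfrak{t}^{\boldsymbol\lambda}$). $\mathbf{m}^{\boldsymbol\lambda}_{\mathfrak{s}\mathfrak{t}}=z_{d(\mathfrak{s})}^*\,\mathbb{E}_{\mathbf{I}_{\boldsymbol\lambda}}\big(\sum_{w\in\mathfrak{S}_{\boldsymbol\lambda}}q^{\ell(w)}z_w\big)z_{d(\mathfrak{t})}$. *)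

theory Defs
  imports Complex_Main "HOL-Library.Poly_Mapping" "HOL-Library.Disjoint_Sets"
begin

text \<open>Laurent polynomials C[q,q^-1] are realised as the group algebra of (int,+) over C,
  i.e. finitely supported functions int to complex with convolution product;
  q is the basis element at exponent 1.\<close>

type_synonym laurent = "int \<Rightarrow>\<^sub>0 complex"

definition qL :: laurent where "qL = Poly_Mapping.single 1 1"
definition qinv :: laurent where "qinv = Poly_Mapping.single (-1) 1"

datatype gen = E nat | Z nat

text \<open>Elements of the free associative S-algebra: finitely supported S-valued
  functions on words in the generators.\<close>
type_synonym bfree = "gen list \<Rightarrow>\<^sub>0 laurent"

definition mulF :: "bfree \<Rightarrow> bfree \<Rightarrow> bfree" where
  "mulF x y = (\<Sum>u\<in>Poly_Mapping.keys x. \<Sum>v\<in>Poly_Mapping.keys y.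
      Poly_Mapping.single (u @ v) (Poly_Mapping.lookup x u * Poly_Mapping.lookup y v))"

definition oneF :: bfree where "oneF = Poly_Mapping.single [] 1"

definition smultF :: "laurent \<Rightarrow> bfree \<Rightarrow> bfree" where
  "smultF r x = mulF (Poly_Mapping.single [] r) x"

definition prodF :: "bfree list \<Rightarrow> bfree" where
  "prodF xs = foldr mulF xs oneF"

definition eF :: "nat \<Rightarrow> bfree" where "eF i = Poly_Mapping.single [E i] 1"
definition zF :: "nat \<Rightarrow> bfree" where "zF i = Poly_Mapping.single [Z i] 1"

definition starF :: "bfree \<Rightarrow> bfree" where
  "starF x = (\<Sum>u\<in>Poly_Mapping.keys x. Poly_Mapping.single (rev u) (Poly_Mapping.lookup x u))"

definition two_sided_ideal :: "bfree set \<Rightarrow> bool" where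
  "two_sided_ideal J \<longleftrightarrow> 0 \<in> J \<and> (\<forall>x\<in>J. \<forall>y\<in>J. x + y \<in> J) \<and>
     (\<forall>x\<in>J. \<forall>a. mulF a x \<in> J \<and> mulF x a \<in> J)"

definition ideal_gen :: "bfree set \<Rightarrow> bfree set" where
  "ideal_gen R = \<Inter>{J. R \<subseteq> J \<and> two_sided_ideal J}"

text \<open>Generators e_i, z_i with i outside 1..n-1 are killed, so the quotient of the free
  algebra on all e_i, z_i by these relations is the algebra presented on
  e_1..e_{n-1}, z_1..z_{n-1}.\<close>

definition bH_rels :: "nat \<Rightarrow> bfree set" where
  "bH_rels n =
     {mulF (eF i) (eF i) - eF i | i. i \<in> {1..<n}}
   \<union> {mulF (eF i) (eF j) - mulF (eF j) (eF i) | i j. i \<in> {1..<n} \<and> j \<in> {1..<n}}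
   \<union> {mulF (zF i) (mulF (zF j) (zF i)) - mulF (zF j) (mulF (zF i) (zF j)) | i j.
        i \<in> {1..<n} \<and> j \<in> {1..<n} \<and> (i = j + 1 \<or> j = i + 1)}
   \<union> {mulF (zF i) (zF j) - mulF (zF j) (zF i) | i j.
        i \<in> {1..<n} \<and> j \<in> {1..<n} \<and> (i > j + 1 \<or> j > i + 1)}
   \<union> {mulF (eF i) (zF i) - zF i | i. i \<in> {1..<n}}
   \<union> {mulF (eF i) (zF j) - mulF (zF j) (eF i) | i j. i \<in> {1..<n} \<and> j \<in> {1..<n}}
   \<union> {mulF (zF i) (zF i) - eF i - smultF (qL - qinv) (zF i) | i. i \<in> {1..<n}}
   \<union> {eF i | i. i \<notin> {1..<n}} \<union> {zF i | i. i \<notin> {1..<n}}"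

definition TL_rels :: "nat \<Rightarrow> bfree set" where
  "TL_rels n =
     {mulF (eF i) (mulF (eF j)
        (oneF + smultF qL (zF i) + smultF qL (zF j)
         + smultF (qL ^ 2) (mulF (zF i) (zF j)) + smultF (qL ^ 2) (mulF (zF j) (zF i))
         + smultF (qL ^ 3) (mulF (zF i) (mulF (zF j) (zF i))))) | i j.
        i \<in> {1..<n} \<and> j \<in> {1..<n} \<and> (i = j + 1 \<or> j = i + 1)}"

text \<open>bH_n(q) = free algebra / bH_ideal n ;  bTL_n(q) = free algebra / bTL_ideal n.\<close>
definition bH_ideal :: "nat \<Rightarrow> bfree set" where "bH_ideal n = ideal_gen (bH_rels n)"
definition bTL_ideal :: "nat \<Rightarrow> bfree set" where
  "bTL_ideal n = ideal_gen (bH_rels n \<union> TL_rels n)"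

text \<open>Everything is expressed on representatives in the free algebra modulo the ideal J,
  i.e. in A = F/J.  The algebra considered is the corner B = e A e for an idempotent e
  (e = 1 gives A itself); its unit is e.  star is an anti-involution of B,
  and c l s t (l in Lam, s,t in T l) are representatives of the cellular basis.\<close>

definition anti_involution_mod :: "bfree set \<Rightarrow> bfree \<Rightarrow> (bfree \<Rightarrow> bfree) \<Rightarrow> bool" where
  "anti_involution_mod J e star \<longleftrightarrow>
     (\<forall>x\<in>J. star x \<in> J) \<and>
     (\<forall>x y. star (x + y) - (star x + star y) \<in> J) \<and>
     (\<forall>r x. star (smultF r x) - smultF r (star x) \<in> J) \<and>
     (\<forall>x y. star (mulF x y) - mulF (star y) (star x) \<in> J) \<and>
     (\<forall>x. star (star x) - x \<in> J) \<and>
     star e - e \<in> J"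

definition cellular_wrt ::
  "bfree set \<Rightarrow> bfree \<Rightarrow> (bfree \<Rightarrow> bfree) \<Rightarrow> 'l set \<Rightarrow> ('l \<Rightarrow> 't set)
     \<Rightarrow> ('l \<Rightarrow> 't \<Rightarrow> 't \<Rightarrow> bfree) \<Rightarrow> bool" where
  "cellular_wrt J e star Lam T c \<longleftrightarrow>
    (let K = {(l, s, t). l \<in> Lam \<and> s \<in> T l \<and> t \<in> T l};
         comb = (\<lambda>(r :: 'l \<times> 't \<times> 't \<Rightarrow> laurent) K'.
                    \<Sum>(l, s, t)\<in>K'. smultF (r (l, s, t)) (c l s t))
     in finite Lam \<and> (\<forall>l\<in>Lam. finite (T l)) \<and>
        anti_involution_mod J e star \<and>
        \<comment> \<open>the basis elements lie in B\<close>
        (\<forall>(l, s, t)\<in>K. mulF e (mulF (c l s t) e) - c l s t \<in> J) \<and>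
        \<comment> \<open>they span B over S\<close>
        (\<forall>x. \<exists>r. mulF e (mulF x e) - comb r K \<in> J) \<and>
        \<comment> \<open>they are S-linearly independent in A\<close>
        (\<forall>r. comb r K \<in> J \<longrightarrow> (\<forall>k\<in>K. r k = 0)) \<and>
        \<comment> \<open>(C2)\<close>
        (\<forall>(l, s, t)\<in>K. star (c l s t) - c l t s \<in> J) \<and>
        \<comment> \<open>(C3) for some partial order on Lam\<close>
        (\<exists>lt :: 'l \<Rightarrow> 'l \<Rightarrow> bool.
           (\<forall>l\<in>Lam. \<not> lt l l) \<and>
           (\<forall>a\<in>Lam. \<forall>b\<in>Lam. \<forall>d\<in>Lam. lt a b \<longrightarrow> lt b d \<longrightarrow> lt a d) \<and>
           (\<forall>l\<in>Lam. \<forall>a. \<forall>s\<in>T l. \<exists>r :: 't \<Rightarrow> laurent. \<forall>t\<in>T l. \<exists>r'.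
              mulF (mulF e (mulF a e)) (c l s t)
                - (\<Sum>s'\<in>T l. smultF (r s') (c l s' t))
                - comb r' {(l', u, v)\<in>K. lt l' l} \<in> J)))"

definition compositions :: "nat \<Rightarrow> nat list set" where
  "compositions n = {mu. (\<forall>x\<in>set mu. 0 < x) \<and> sum_list mu = n}"

definition linear_set_partitions :: "nat \<Rightarrow> nat set set set" where
  "linear_set_partitions n =
     {P. partition_on {1..n} P \<and> (\<forall>B\<in>P. \<exists>a b. B = {a..b})}"

definition lsp_of_comp :: "nat list \<Rightarrow> nat set set" where
  "lsp_of_comp mu =
     {{sum_list (take k mu) + 1 .. sum_list (take (Suc k) mu)} | k. k < length mu}"

definition lsp_le :: "nat set set \<Rightarrow> nat set set \<Rightarrow> bool" where
  "lsp_le I J \<longleftrightarrow> (\<forall>B\<in>J. \<exists>C\<subseteq>I. B = \<Union>C)"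

definition E_J :: "nat \<Rightarrow> nat set set \<Rightarrow> bfree" where
  "E_J n J = prodF [eF i. i \<leftarrow> [1..<n], \<exists>B\<in>J. i \<in> B \<and> Suc i \<in> B]"

definition EE :: "nat \<Rightarrow> nat set set \<Rightarrow> bfree" where
  "EE n I = (\<Sum>J\<in>{J\<in>linear_set_partitions n. lsp_le I J}.
               smultF ((- 1) ^ (card I - card J)) (E_J n J))"

definition multipartitions :: "nat \<Rightarrow> nat list list set" where
  "multipartitions n =
     {lam. (\<forall>p\<in>set lam. p \<noteq> [] \<and> sorted_wrt (\<ge>) p \<and> (\<forall>x\<in>set p. 0 < x))
           \<and> sum_list (map sum_list lam) = n}"

definition MPar2 :: "nat \<Rightarrow> nat list list set" where
  "MPar2 n = {lam \<in> multipartitions n. \<forall>p\<in>set lam. \<forall>x\<in>set p. x \<le> 2}"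

definition comp_of :: "nat list list \<Rightarrow> nat list" where
  "comp_of lam = map sum_list lam"

text \<open>Nodes (component k, row r, column c), all 0-indexed.\<close>
definition nodes :: "nat list list \<Rightarrow> (nat \<times> nat \<times> nat) set" where
  "nodes lam = {(k, r, c). k < length lam \<and> r < length (lam ! k) \<and> c < lam ! k ! r}"

definition comp_nodes :: "nat list list \<Rightarrow> nat \<Rightarrow> (nat \<times> nat \<times> nat) set" where
  "comp_nodes lam k = {x \<in> nodes lam. fst x = k}"

text \<open>Multitableaux are maps from nodes to entries (value 0 off the diagram).\<close>
definition t_lam :: "nat list list \<Rightarrow> nat \<times> nat \<times> nat \<Rightarrow> nat" where
  "t_lam lam x = (case x of (k, r, c) \<Rightarrow>
     if (k, r, c) \<in> nodes lam
     then sum_list (take k (comp_of lam)) + sum_list (take r (lam ! k)) + c + 1 else 0)"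

definition standard_tab :: "nat list list \<Rightarrow> (nat \<times> nat \<times> nat \<Rightarrow> nat) \<Rightarrow> bool" where
  "standard_tab lam t \<longleftrightarrow>
     bij_betw t (nodes lam) {1..sum_list (comp_of lam)} \<and>
     (\<forall>x. x \<notin> nodes lam \<longrightarrow> t x = 0) \<and>
     (\<forall>k r c. (k, r, Suc c) \<in> nodes lam \<longrightarrow> t (k, r, c) < t (k, r, Suc c)) \<and>
     (\<forall>k r c. (k, Suc r, c) \<in> nodes lam \<longrightarrow> t (k, r, c) < t (k, Suc r, c))"

definition T_init :: "nat list list \<Rightarrow> (nat \<times> nat \<times> nat \<Rightarrow> nat) set" where
  "T_init lam = {t. standard_tab lam t \<and>
     (\<forall>k < length lam. t ` comp_nodes lam k = t_lam lam ` comp_nodes lam k)}"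

definition adj_swap :: "nat \<Rightarrow> nat \<Rightarrow> nat" where
  "adj_swap i x = (if x = i then Suc i else if x = Suc i then i else x)"

text \<open>Permutations act on the right (as in Murphy/Mathas): the word [i1,...,ir] stands for
  s_{i1} s_{i2} ... s_{ir}, i.e. the function s_{ir} o ... o s_{i1}.\<close>
definition perm_of_word :: "nat list \<Rightarrow> nat \<Rightarrow> nat" where
  "perm_of_word ws = foldl (\<lambda>f i. adj_swap i \<circ> f) id ws"

definition is_word_for :: "nat \<Rightarrow> (nat \<Rightarrow> nat) \<Rightarrow> nat list \<Rightarrow> bool" where
  "is_word_for n w ws \<longleftrightarrow> set ws \<subseteq> {1..<n} \<and> perm_of_word ws = w"

definition reduced_word :: "nat \<Rightarrow> (nat \<Rightarrow> nat) \<Rightarrow> nat list" where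
  "reduced_word n w = (SOME ws. is_word_for n w ws \<and>
      (\<forall>ws'. is_word_for n w ws' \<longrightarrow> length ws \<le> length ws'))"

definition perm_length :: "nat \<Rightarrow> (nat \<Rightarrow> nat) \<Rightarrow> nat" where
  "perm_length n w = length (reduced_word n w)"

definition z_perm :: "nat \<Rightarrow> (nat \<Rightarrow> nat) \<Rightarrow> bfree" where
  "z_perm n w = prodF (map zF (reduced_word n w))"

text \<open>d(s): the permutation with t^lam d(s) = s.\<close>
definition d_perm :: "nat list list \<Rightarrow> (nat \<times> nat \<times> nat \<Rightarrow> nat) \<Rightarrow> nat \<Rightarrow> nat" where
  "d_perm lam s i = (if i \<in> t_lam lam ` nodes lam
                     then s (the_inv_into (nodes lam) (t_lam lam) i) else i)"

definition row_stab :: "nat list list \<Rightarrow> (nat \<Rightarrow> nat) set" where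
  "row_stab lam = {w. bij_betw w {1..sum_list (comp_of lam)} {1..sum_list (comp_of lam)} \<and>
      (\<forall>i. i \<notin> {1..sum_list (comp_of lam)} \<longrightarrow> w i = i) \<and>
      (\<forall>k r c. (k, r, c) \<in> nodes lam \<longrightarrow>
         (\<exists>c'. (k, r, c') \<in> nodes lam \<and> w (t_lam lam (k, r, c)) = t_lam lam (k, r, c')))}"

definition m_elt :: "nat \<Rightarrow> nat list list \<Rightarrow> (nat \<times> nat \<times> nat \<Rightarrow> nat)
                      \<Rightarrow> (nat \<times> nat \<times> nat \<Rightarrow> nat) \<Rightarrow> bfree" where
  "m_elt n lam s t =
     mulF (starF (z_perm n (d_perm lam s)))
       (mulF (EE n (lsp_of_comp (comp_of lam)))
         (mulF (\<Sum>w\<in>row_stab lam. smultF (qL ^ perm_length n w) (z_perm n w))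
               (z_perm n (d_perm lam t))))"

end

theory Submission
  imports Defs "HOL-Combinatorics.Permutations"
begin

text \<open>
  The idempotents \<open>Eidem\<close> attached to the compositions \<open>\<mu>\<close> of \<open>n\<close> are central and orthogonal with
  sum 1. In the corner of \<open>\<mu>\<close> the generator \<open>e\<^sub>i\<close> becomes 1 or 0, according to whether \<open>i\<close> and
  \<open>i + 1\<close> lie in the same block, so the corner is a tensor product of Temperley--Lieb algebras
  generated by \<open>U\<^sub>i = z\<^sub>i + q\<^sup>-\<^sup>1\<close>, and up to a power of \<open>q\<close> the row symmetrizer of a two-column shape
  is the product of the \<open>U\<^sub>j\<close> over the first entries \<open>j\<close> of its rows of length two.

  Spanning. A reduced word of \<open>d(t)\<close> moves entries of the second column to the right, one step at a
  time. By induction along such words, the products \<open>X\<^sub>\<lambda> U\<^sub>w\<close> span a right ideal modulo the ideal of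
  the shapes with more rows of length two; they depend only on the tableau reached by \<open>w\<close>, and they
  agree with \<open>X\<^sub>\<lambda> z\<^sub>w\<close> up to shorter words. This gives the multiplication rule of a cellular algebra
  and, by downward induction on the number of rows of length two, that the Murphy elements span.

  Independence. The algebra acts on functions on 0/1-words. On the words with as many ones in each
  block as \<open>\<lambda>\<close> has rows of length two, every Murphy element of shape \<open>\<lambda>\<close> acts as the rank one matrix
  \<open>G\<^sub>s G\<^sub>t\<^sup>T\<close>, where \<open>G\<^sub>t\<close> has as leading word the indicator of the second column of \<open>t\<close>, and the other
  shapes with at least as many rows of length two act by 0.
\<close>

section \<open>The free algebra as a ring\<close>

text \<open>All arguments use representatives in the free algebra modulo several ideals: the
  defining ideal, the annihilator of one idempotent, and the cell ideals above it. Modulo the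
  annihilator the idempotent is congruent to 1, so a corner can be handled as a Temperley--Lieb
  algebra with unit 1. The obstacle to spanning is that a Murphy element depends on an arbitrarily
  chosen reduced word. Let a 0/1 word record the second column of t. Every descent i of
  \<open>d(t)\<close> shows the pattern 01 at i, i + 1, and two such patterns never overlap, so
  products along different reduced words are compared by commutations alone. A step at a pattern
  other than 10 is absorbed by \<open>U_i^2 = (q + q^-1) U_i\<close> or
  \<open>U_i U_j U_i = U_i\<close>, or is commuted down to the initial tableau, where 00 produces a
  further row of length two. The cell order only counts rows of length two in all components
  together; shapes with equal totals are separated in the action by their counts in the single
  blocks. The leading coefficients there are 1, so the independence argument never divides in
  S.\<close>

text \<open>Lists are turned into a monoid under concatenation, so that the convolution product of
  \<open>Poly_Mapping\<close> makes \<open>bfree\<close> a ring.\<close>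

instantiation list :: (type) monoid_add
begin

definition zero_list :: "'a list" where "zero_list = []"

definition plus_list :: "'a list \<Rightarrow> 'a list \<Rightarrow> 'a list" where "plus_list = (@)"

instance by standard (simp_all add: zero_list_def plus_list_def)

end

lemma poly_mapping_sum_single:
  "x = (\<Sum>u\<in>Poly_Mapping.keys x. Poly_Mapping.single u (Poly_Mapping.lookup x u))"
  by (rule poly_mapping_eqI)
    (auto simp: lookup_sum lookup_single when_def in_keys_iff sum.delta')

lemma bfree_induct [case_names single add]:
  fixes x :: "'a \<Rightarrow>\<^sub>0 'b::comm_monoid_add"
  assumes s: "\<And>u r. P (Poly_Mapping.single u r)" and a: "\<And>x y. P x \<Longrightarrow> P y \<Longrightarrow> P (x + y)"
  shows "P x"
proof -
  have "P (\<Sum>u\<in>A. Poly_Mapping.single u (Poly_Mapping.lookup x u))" if "finite A" for A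
    using that
  proof (induction A)
    case empty
    show ?case using s[of undefined 0] by simp
  next
    case (insert u A)
    then show ?case using s a by simp
  qed
  from this[of "Poly_Mapping.keys x"] show ?thesis
    using poly_mapping_sum_single[of x] by simp
qed

lemma mulF_eq: "mulF x y = x * y"
proof -
  have "x * y = (\<Sum>u\<in>Poly_Mapping.keys x. Poly_Mapping.single u (Poly_Mapping.lookup x u)) *
      (\<Sum>v\<in>Poly_Mapping.keys y. Poly_Mapping.single v (Poly_Mapping.lookup y v))"
    using poly_mapping_sum_single[of x] poly_mapping_sum_single[of y] by simp
  also have "\<dots> = mulF x y"
    by (simp add: mulF_def sum_product mult_single plus_list_def)
  finally show ?thesis ..
qed

lemma oneF_eq: "oneF = 1"
  by (simp add: oneF_def flip: single_one zero_list_def)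

text \<open>Scalars are kept inside the ring as central elements: S-linear algebra becomes ring
  algebra, and rewriting only has to move the factors \<open>C r\<close> to the front.\<close>

definition C :: "laurent \<Rightarrow> bfree" where "C r = Poly_Mapping.single [] r"

lemma smultF_eq: "smultF r x = C r * x"
  by (simp add: smultF_def C_def mulF_eq)

lemma prodF_eq: "prodF xs = prod_list xs"
  by (induction xs) (simp_all add: prodF_def mulF_eq oneF_eq)

lemma C_mult_single: "C r * Poly_Mapping.single u s = Poly_Mapping.single u (r * s)"
  by (simp add: C_def mult_single plus_list_def)

lemma single_mult_C: "Poly_Mapping.single u s * C r = Poly_Mapping.single u (r * s)"
  by (simp add: C_def mult_single plus_list_def mult.commute)

lemma C_commute: "x * C r = C r * x"
  by (induction x rule: bfree_induct) (simp_all add: C_mult_single single_mult_C algebra_simps)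

lemma C_left_commute: "x * (C r * y) = C r * (x * y)"
  by (metis C_commute mult.assoc)

lemma C_0 [simp]: "C 0 = 0"
  by (simp add: C_def)

lemma C_1 [simp]: "C 1 = 1"
  by (simp add: C_def flip: single_one zero_list_def)

lemma C_mult: "C (r * s) = C r * C s"
  by (simp add: C_def mult_single plus_list_def)

lemma C_add: "C (r + s) = C r + C s"
  by (simp add: C_def single_add)

lemma C_uminus: "C (- r) = - C r"
  by (simp add: C_def single_uminus)

lemma C_diff: "C (r - s) = C r - C s"
  by (simp add: C_def single_diff)

lemma qL_qinv [simp]: "qL * qinv = 1" "qinv * qL = 1"
  by (simp_all add: qL_def qinv_def mult_single)

definition genF :: "gen \<Rightarrow> bfree" where "genF g = Poly_Mapping.single [g] 1"

lemma eF_genF: "eF i = genF (E i)" and zF_genF: "zF i = genF (Z i)"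
  by (simp_all add: eF_def zF_def genF_def)

lemma single_eq_prod: "Poly_Mapping.single u r = C r * prod_list (map genF u)"
proof -
  have "prod_list (map genF u) = Poly_Mapping.single u 1"
  proof (induction u)
    case Nil
    show ?case using C_1 by (simp add: C_def)
  qed (simp add: genF_def mult_single plus_list_def)
  then show ?thesis by (simp add: C_mult_single)
qed

lemma bfree_gen_induct [case_names C gen add mult]:
  assumes "\<And>r. P (C r)" "\<And>g. P (genF g)" "\<And>x y. P x \<Longrightarrow> P y \<Longrightarrow> P (x + y)"
    "\<And>x y. P x \<Longrightarrow> P y \<Longrightarrow> P (x * y)"
  shows "P x"
proof -
  have "P (prod_list (map genF u))" for u
    by (induction u) (use assms(1)[of 1] assms(2,4) in auto)
  then show ?thesis
    by (induction x rule: bfree_induct) (simp_all add: assms single_eq_prod)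
qed

section \<open>The anti-involution of the free algebra\<close>

lemma starF_superset:
  assumes "finite A" "Poly_Mapping.keys x \<subseteq> A"
  shows "starF x = (\<Sum>u\<in>A. Poly_Mapping.single (rev u) (Poly_Mapping.lookup x u))"
  unfolding starF_def using assms
  by (intro sum.mono_neutral_left) (auto simp: in_keys_iff)

lemma starF_single: "starF (Poly_Mapping.single u r) = Poly_Mapping.single (rev u) r"
  by (subst starF_superset[of "{u}"]) auto

lemma starF_add: "starF (x + y) = starF x + starF y"
proof -
  let ?A = "Poly_Mapping.keys x \<union> Poly_Mapping.keys y"
  have k: "Poly_Mapping.keys (x + y) \<subseteq> ?A" by (rule Poly_Mapping.keys_add)
  show ?thesis
    using k by (simp add: starF_superset[of ?A] lookup_add single_add sum.distrib)
qed

lemma starF_0 [simp]: "starF 0 = 0"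
  by (simp add: starF_def)

lemma starF_uminus: "starF (- x) = - starF x"
  by (metis add.right_inverse minus_unique starF_0 starF_add)

lemma starF_diff: "starF (x - y) = starF x - starF y"
  by (metis diff_conv_add_uminus starF_add starF_uminus)

lemma starF_sum: "starF (sum f A) = (\<Sum>a\<in>A. starF (f a))"
  by (induction A rule: infinite_finite_induct) (simp_all add: starF_add)

lemma starF_mult: "starF (x * y) = starF y * starF x"
proof (induction x rule: bfree_induct)
  case (single u r)
  show ?case
    by (induction y rule: bfree_induct)
      (simp_all add: mult_single starF_single plus_list_def starF_add algebra_simps)
qed (simp add: starF_add algebra_simps)

lemma starF_C [simp]: "starF (C r) = C r"
  by (simp add: C_def starF_single)

lemma starF_1 [simp]: "starF 1 = 1"
  using starF_C[of 1] by simp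

lemma starF_genF [simp]: "starF (genF g) = genF g"
  by (simp add: genF_def starF_single)

lemma starF_gens [simp]: "starF (eF i) = eF i" "starF (zF i) = zF i"
  by (simp_all add: eF_genF zF_genF)

lemma starF_starF [simp]: "starF (starF x) = x"
  by (induction x rule: bfree_induct) (simp_all add: starF_single starF_add)

lemma starF_prod_list: "starF (prod_list xs) = prod_list (rev (map starF xs))"
  by (induction xs) (simp_all add: starF_mult)

section \<open>Two-sided ideals and congruence modulo an ideal\<close>

lemma two_sided_ideal_iff:
  "two_sided_ideal J \<longleftrightarrow> 0 \<in> J \<and> (\<forall>x\<in>J. \<forall>y\<in>J. x + y \<in> J) \<and>
     (\<forall>x\<in>J. \<forall>a. a * x \<in> J \<and> x * a \<in> J)"
  by (simp add: two_sided_ideal_def mulF_eq)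

lemma ideal_gen_tsi: "two_sided_ideal (ideal_gen R)"
  by (auto simp: ideal_gen_def two_sided_ideal_iff)

lemma ideal_gen_base: "R \<subseteq> ideal_gen R"
  by (auto simp: ideal_gen_def)

lemma ideal_gen_least: "R \<subseteq> J \<Longrightarrow> two_sided_ideal J \<Longrightarrow> ideal_gen R \<subseteq> J"
  by (auto simp: ideal_gen_def)

locale tsideal =
  fixes J :: "bfree set"
  assumes tsi: "two_sided_ideal J"
begin

lemma I0 [simp]: "0 \<in> J" and Iadd: "x \<in> J \<Longrightarrow> y \<in> J \<Longrightarrow> x + y \<in> J"
  and Imult_left: "x \<in> J \<Longrightarrow> a * x \<in> J" and Imult_right: "x \<in> J \<Longrightarrow> x * a \<in> J"
  using tsi by (auto simp: two_sided_ideal_iff)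

lemma Iuminus: "x \<in> J \<Longrightarrow> - x \<in> J"
  using Imult_left[of x "- 1"] by simp

lemma Idiff: "x \<in> J \<Longrightarrow> y \<in> J \<Longrightarrow> x - y \<in> J"
  using Iadd[of x "- y"] Iuminus by simp

lemma Isum: "(\<And>a. a \<in> A \<Longrightarrow> f a \<in> J) \<Longrightarrow> sum f A \<in> J"
  by (induction A rule: infinite_finite_induct) (auto intro: Iadd)

text \<open>Congruence of representatives takes the place of a quotient type, because several ideals
  are in play at once and congruences are carried from one ideal to a larger one.\<close>

definition cg (infix "\<approx>" 50) where "x \<approx> y \<longleftrightarrow> x - y \<in> J"

lemma cg_refl [simp, intro]: "x \<approx> x"
  by (simp add: cg_def)

lemma cg_sym: "x \<approx> y \<Longrightarrow> y \<approx> x"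
  unfolding cg_def using Iuminus[of "x - y"] by simp

lemma cg_trans [trans]: "x \<approx> y \<Longrightarrow> y \<approx> z \<Longrightarrow> x \<approx> z"
  unfolding cg_def using Iadd[of "x - y" "y - z"] by simp

lemma cg_add: "x \<approx> y \<Longrightarrow> x' \<approx> y' \<Longrightarrow> x + x' \<approx> y + y'"
  unfolding cg_def using Iadd[of "x - y" "x' - y'"] by (simp add: algebra_simps)

lemma cg_diff: "x \<approx> y \<Longrightarrow> x' \<approx> y' \<Longrightarrow> x - x' \<approx> y - y'"
  unfolding cg_def using Idiff[of "x - y" "x' - y'"] by (simp add: algebra_simps)

lemma cg_mult: "x \<approx> y \<Longrightarrow> x' \<approx> y' \<Longrightarrow> x * x' \<approx> y * y'"
  unfolding cg_def
  using Iadd[of "(x - y) * x'" "y * (x' - y')"] Imult_left[of "x' - y'" y] Imult_right[of "x - y" x']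
  by (simp add: algebra_simps)

lemma cg_left: "x \<approx> y \<Longrightarrow> a * x \<approx> a * y" and cg_right: "x \<approx> y \<Longrightarrow> x * a \<approx> y * a"
  by (simp_all add: cg_mult)

lemma cg_sum: "(\<And>a. a \<in> A \<Longrightarrow> f a \<approx> g a) \<Longrightarrow> sum f A \<approx> sum g A"
  by (induction A rule: infinite_finite_induct) (auto intro: cg_add)

lemma cg_0: "x \<approx> 0 \<longleftrightarrow> x \<in> J"
  by (simp add: cg_def)

lemma cg_mem: "x \<approx> y \<Longrightarrow> y \<in> J \<Longrightarrow> x \<in> J"
  unfolding cg_def using Iadd[of "x - y" y] by simp

text \<open>The elements commuting with \<open>c\<close> modulo \<open>J\<close> contain the scalars
  and are closed under sums and products, so it suffices to test the generators.\<close>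

lemma tsi_commutant:
  assumes "\<And>g. c * genF g \<approx> genF g * c"
  shows "c * x \<approx> x * c"
proof (induction x rule: bfree_gen_induct)
  case (C r)
  show ?case by (simp add: C_commute)
next
  case (gen g)
  show ?case by (rule assms)
next
  case (add x y)
  then show ?case by (simp add: algebra_simps cg_add)
next
  case (mult x y)
  have "c * (x * y) \<approx> (x * c) * y" using mult(1) cg_right by (simp add: mult.assoc[symmetric])
  also have "\<dots> \<approx> x * (y * c)" using cg_left[OF mult(2)] by (simp add: mult.assoc)
  finally show ?case by (simp add: mult.assoc)
qed

lemma prod_list_comm:
  assumes "\<And>i. i \<in> set ws \<Longrightarrow> h i * a \<approx> a * h i"
  shows "prod_list (map h ws) * a \<approx> a * prod_list (map h ws)"
  using assms
proof (induction ws)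
  case (Cons i ws)
  have "prod_list (map h (i # ws)) * a = h i * (prod_list (map h ws) * a)" by (simp add: mult.assoc)
  also have "\<dots> \<approx> h i * (a * prod_list (map h ws))" using Cons by (intro cg_left) simp
  also have "\<dots> = h i * a * prod_list (map h ws)" by (simp add: mult.assoc)
  also have "\<dots> \<approx> a * h i * prod_list (map h ws)" using Cons.prems by (intro cg_right) simp
  finally show ?case by (simp add: mult.assoc)
qed simp

lemma prod_list_rev_comm:
  assumes "\<And>i j. i \<in> set ws \<Longrightarrow> j \<in> set ws \<Longrightarrow> h i * h j \<approx> h j * h i"
  shows "prod_list (map h (rev ws)) \<approx> prod_list (map h ws)"
  using assms
proof (induction ws)
  case (Cons i ws)
  have "prod_list (map h (rev (i # ws))) = prod_list (map h (rev ws)) * h i" by simp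
  also have "\<dots> \<approx> h i * prod_list (map h (rev ws))" using Cons.prems by (intro prod_list_comm) simp
  also have "\<dots> \<approx> h i * prod_list (map h ws)" using Cons by (intro cg_left) simp
  finally show ?case by simp
qed simp

text \<open>Brings a chosen factor to the right end of a product, where it can meet the next factor
  and be absorbed.\<close>

lemma prod_list_pull_out:
  assumes "distinct ws" "j \<in> set ws" "\<And>i. i \<in> set ws \<Longrightarrow> i \<noteq> j \<Longrightarrow> h i * h j \<approx> h j * h i"
  shows "prod_list (map h ws) \<approx> prod_list (map h (remove1 j ws)) * h j"
proof -
  obtain us vs where ws: "ws = us @ j # vs" using assms(2) split_list by metis
  have "prod_list (map h vs) * h j \<approx> h j * prod_list (map h vs)"
    using assms by (intro prod_list_comm) (auto simp: ws)
  from cg_left[OF cg_sym[OF this], of "prod_list (map h us)"]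
  have "prod_list (map h us) * (h j * prod_list (map h vs)) \<approx> prod_list (map h us) * (prod_list (map h vs) * h j)" .
  moreover have "remove1 j ws = us @ vs" using assms(1) by (simp add: ws remove1_append)
  ultimately show ?thesis by (simp add: ws mult.assoc)
qed

end

section \<open>Straightening in a Temperley--Lieb algebra\<close>

interpretation bf: module "\<lambda>r x. C r * x"
  by standard (simp_all add: C_add C_mult algebra_simps)

declare bf.scale_scale [simp del]

lemma span_mult_right:
  assumes "x \<in> bf.span B" "\<And>b. b \<in> B \<Longrightarrow> b * a \<in> bf.span B'"
  shows "x * a \<in> bf.span B'"
  using assms(1)
proof (induction rule: bf.span_induct_alt)
  case base
  show ?case by (simp add: bf.span_zero)
next
  case (step c x y)
  then show ?case
    using assms(2) by (simp add: algebra_simps bf.span_add bf.span_scale)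
qed

lemma span_subsetI: "(\<And>b. b \<in> B \<Longrightarrow> b \<in> bf.span B') \<Longrightarrow> x \<in> bf.span B \<Longrightarrow> x \<in> bf.span B'"
  using bf.span_minimal[of B "bf.span B'"] bf.subspace_span by blast

abbreviation apart :: "nat \<Rightarrow> nat \<Rightarrow> bool" where "apart i j \<equiv> i > j + 1 \<or> j > i + 1"

definition ZZ :: "nat list \<Rightarrow> bfree" where "ZZ ws = prod_list (map zF ws)"

definition UF :: "nat \<Rightarrow> bfree" where "UF i = zF i + C qinv"

definition UU :: "nat list \<Rightarrow> bfree" where "UU ws = prod_list (map UF ws)"

lemmas C_zF = C_commute[of "zF i" for i] C_left_commute[of "zF i" for i]

lemma UU_simps [simp]: "UU [] = 1" "UU (i # ws) = UF i * UU ws" "UU (us @ ws) = UU us * UU ws"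
  by (simp_all add: UU_def)

lemma ZZ_simps [simp]: "ZZ [] = 1" "ZZ (i # ws) = zF i * ZZ ws" "ZZ (us @ ws) = ZZ us * ZZ ws"
  by (simp_all add: ZZ_def)

lemma starF_UF [simp]: "starF (UF i) = UF i"
  by (simp add: UF_def starF_add)

lemma starF_UU: "starF (UU ws) = UU (rev ws)"
  by (simp add: UU_def starF_prod_list rev_map comp_def)

locale TL_corner = tsideal +
  fixes N :: "nat set"
  assumes e_in: "i \<in> N \<Longrightarrow> eF i \<approx> 1"
    and e_out: "i \<notin> N \<Longrightarrow> eF i \<in> J"
    and z_out: "i \<notin> N \<Longrightarrow> zF i \<in> J"
    and z_sq: "i \<in> N \<Longrightarrow> zF i * zF i \<approx> 1 + C (qL - qinv) * zF i"
    and z_comm: "apart i j \<Longrightarrow> zF i * zF j \<approx> zF j * zF i"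
    and TL: "\<lbrakk>i \<in> N; j \<in> N; i = Suc j \<or> j = Suc i\<rbrakk> \<Longrightarrow>
      1 + C qL * zF i + C qL * zF j + C (qL ^ 2) * (zF i * zF j) + C (qL ^ 2) * (zF j * zF i)
        + C (qL ^ 3) * (zF i * (zF j * zF i)) \<in> J"
    and star_J: "x \<in> J \<Longrightarrow> starF x \<in> J"
begin

text \<open>For i in \<open>N\<close> the quadratic relation reads (z - q)(z + q^-1) = 0, so z acts
  on \<open>UF i\<close> as q; adding q^-1 gives the loop value q + q^-1 of the Temperley--Lieb
  algebra.\<close>

lemma U_sq: "i \<in> N \<Longrightarrow> UF i * UF i \<approx> C (qL + qinv) * UF i"
proof -
  assume i: "i \<in> N"
  have "UF i * UF i - C (qL + qinv) * UF i
      = zF i * zF i - (1 + C (qL - qinv) * zF i) + (1 - C qL * C qinv)"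
    by (simp add: UF_def C_add C_diff C_zF algebra_simps)
  then show ?thesis using z_sq[OF i]
    by (simp add: cg_def flip: C_mult)
qed

lemma U_comm: "apart i j \<Longrightarrow> UF i * UF j \<approx> UF j * UF i"
proof -
  assume "apart i j"
  moreover have "UF i * UF j - UF j * UF i = zF i * zF j - zF j * zF i"
    by (simp add: UF_def C_zF algebra_simps)
  ultimately show ?thesis using z_comm unfolding cg_def by metis
qed

text \<open>The relator is q^3 times \<open>UF i * UF j * UF i - UF i\<close>, up to a multiple of
  the quadratic relation for \<open>zF i\<close>.\<close>

lemma U_TL:
  assumes "i \<in> N" "j \<in> N" "i = Suc j \<or> j = Suc i"
  shows "UF i * UF j * UF i \<approx> UF i"
proof -
  let ?t = "1 + C qL * zF i + C qL * zF j + C (qL ^ 2) * (zF i * zF j) + C (qL ^ 2) * (zF j * zF i)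
        + C (qL ^ 3) * (zF i * (zF j * zF i))"
  let ?p = "C qinv" and ?q = "C qL"
  have pq: "?p * ?q = 1" by (simp flip: C_mult)
  have qp: "?q * ?p = 1" by (simp flip: C_mult)
  have qp2: "?q * (?p * x) = x" for x
    using qp by (metis mult.assoc mult_1)
  have pq2: "?p * (?q * x) = x" for x
    using pq by (metis mult.assoc mult_1)
  have "UF i * UF j * UF i - UF i = ?p ^ 3 * ?t + ?p * (zF i * zF i - (1 + C (qL - qinv) * zF i))"
    by (simp add: UF_def C_diff C_mult algebra_simps power2_eq_square power3_eq_cube pq2 pq qp2 qp
        C_zF)
  moreover have "?p ^ 3 * ?t \<in> J" using TL[OF assms] by (rule Imult_left)
  moreover have "?p * (zF i * zF i - (1 + C (qL - qinv) * zF i)) \<in> J"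
    using z_sq[OF assms(1)] unfolding cg_def by (rule Imult_left)
  ultimately show ?thesis unfolding cg_def
    by (simp only: Iadd)
qed

text \<open>Modulo \<open>J\<close> each z_i is \<open>UF i\<close> minus q^-1 or 0, and each e_i is
  1 or 0. Hence closure under the \<open>UF i\<close> is enough to make a submodule containing
  \<open>J\<close> a right ideal.\<close>

lemma mult_gen_closed:
  assumes C: "\<And>x r. x \<in> M \<Longrightarrow> C r * x \<in> M" and add: "\<And>x y. x \<in> M \<Longrightarrow> y \<in> M \<Longrightarrow> x + y \<in> M"
    and J: "J \<subseteq> M" and U: "\<And>x i. x \<in> M \<Longrightarrow> i \<in> N \<Longrightarrow> x * UF i \<in> M"
    and x: "x \<in> M"
  shows "x * a \<in> M"
proof -
  have cgM: "y \<in> M" if "y \<approx> z" "z \<in> M" for y z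
    using add[of "y - z" z] that J unfolding cg_def by auto
  have z: "y * zF i \<in> M" if "y \<in> M" for y i
  proof (cases "i \<in> N")
    case True
    have "y * zF i = y * UF i + C (- qinv) * y"
      by (simp add: UF_def algebra_simps C_uminus C_commute[of y])
    then show ?thesis using U[OF that True] C[OF that] add by metis
  next
    case False
    then show ?thesis using z_out Imult_left J by blast
  qed
  have e: "y * eF i \<in> M" if "y \<in> M" for y i
  proof (cases "i \<in> N")
    case True
    then show ?thesis using cgM[OF cg_left[OF e_in[OF True], of y]] that by simp
  next
    case False
    then show ?thesis using e_out Imult_left J by blast
  qed
  have "\<forall>x\<in>M. x * a \<in> M"
  proof (induction a rule: bfree_gen_induct)
    case (C r)
    show ?case using assms(1) by (simp add: C_commute)
  next
    case (gen g)
    show ?case using z e by (cases g) (auto simp: eF_genF zF_genF)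
  next
    case (add a b)
    then show ?case using assms(2) by (simp add: distrib_left)
  next
    case (mult a b)
    then show ?case by (simp flip: mult.assoc)
  qed
  then show ?thesis using x by blast
qed

lemma UU_comm_list: "(\<And>i. i \<in> set ws \<Longrightarrow> apart i j) \<Longrightarrow> UU ws * UF j \<approx> UF j * UU ws"
  unfolding UU_def using U_comm by (intro prod_list_comm) blast

lemma UU_pull_out:
  "\<lbrakk>distinct ws; j \<in> set ws; \<And>i. i \<in> set ws \<Longrightarrow> i \<noteq> j \<Longrightarrow> apart i j\<rbrakk>
    \<Longrightarrow> UU ws \<approx> UU (remove1 j ws) * UF j"
  unfolding UU_def using U_comm by (intro prod_list_pull_out) blast+

end

text \<open>\<open>T\<close> is the set of tableaux of one shape, \<open>cw t i\<close> says that \<open>i\<close> stands in the second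
  column of \<open>t\<close>, and \<open>P\<close> holds the first entries of the rows of length two of the initial
  tableau. \<open>I\<close> is the ideal coming from the shapes with more rows of length two.\<close>

locale TL_cell = TL_corner +
  fixes I :: "bfree set" and P :: "nat set" and T :: "'t set" and \<tau> :: 't
    and cw :: "'t \<Rightarrow> nat \<Rightarrow> bool" and sw :: "nat \<Rightarrow> 't \<Rightarrow> 't" and rw :: "'t \<Rightarrow> nat list"
  assumes tsi_I: "two_sided_ideal I" and J_I: "J \<subseteq> I"
    and P: "finite P" "P \<subseteq> N" "\<And>j. j \<in> P \<Longrightarrow> Suc j \<notin> P"
    and cw0: "cw \<tau> i \<longleftrightarrow> (\<exists>j\<in>P. i = Suc j)"
    and \<tau>: "\<tau> \<in> T"
    and cw_sw: "\<lbrakk>t \<in> T; i \<in> N\<rbrakk> \<Longrightarrow> cw (sw i t) k = cw t (adj_swap i k)"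
    and up: "\<lbrakk>t \<in> T; i \<in> N; cw t i; \<not> cw t (Suc i)\<rbrakk> \<Longrightarrow> sw i t \<in> T"
    and diamond: "\<lbrakk>t \<in> T; i \<in> N; j \<in> N; apart i j; sw i t \<in> T; sw j t \<in> T\<rbrakk> \<Longrightarrow> sw i (sw j t) \<in> T"
    and sw_sw: "t \<in> T \<Longrightarrow> i \<in> N \<Longrightarrow> sw i (sw i t) = t"
    and sw_comm: "apart i j \<Longrightarrow> sw i (sw j t) = sw j (sw i t)"
begin

inductive path :: "nat list \<Rightarrow> 't \<Rightarrow> bool" where
  Nil: "path [] \<tau>"
| snoc: "path ws t \<Longrightarrow> i \<in> N \<Longrightarrow> cw t i \<Longrightarrow> \<not> cw t (Suc i) \<Longrightarrow> path (ws @ [i]) (sw i t)"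

lemma path_T: "path ws t \<Longrightarrow> t \<in> T"
  by (induction rule: path.induct) (auto simp: \<tau> up)

definition XP :: bfree where "XP = UU (sorted_list_of_set P)"

definition Y :: "nat list \<Rightarrow> bfree" where "Y ws = XP * UU ws"

text \<open>Filtration by word length on top of the ideal \<open>I\<close>. It expresses that a step
  which is not upward does not lengthen a word, and it collects the shorter words by which z_w and
  U_w differ.\<close>

definition H :: "nat \<Rightarrow> bfree set" where
  "H m = bf.span (I \<union> {Y vs | vs t. path vs t \<and> length vs < m})"

text \<open>One fixed word per tableau, in the generators z: the span that has to be a right ideal
  for the cellular multiplication rule.\<close>

definition V :: "bfree set" where "V = bf.span (I \<union> {XP * ZZ (rw t) | t. t \<in> T})"

lemma P_apart:
  assumes "i \<in> P" "j \<in> P" "i \<noteq> j"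
  shows "apart i j"
proof -
  have "j \<noteq> Suc i" "i \<noteq> Suc j" using P(3) assms by blast+
  then show ?thesis using assms(3) by linarith
qed

lemma XP_pull:
  assumes j: "j \<in> P"
  shows "XP \<approx> UU (sorted_list_of_set (P - {j})) * UF j"
proof -
  have "UU (sorted_list_of_set P) \<approx> UU (remove1 j (sorted_list_of_set P)) * UF j"
    by (rule UU_pull_out) (use P(1) P_apart[OF _ j] j in simp_all)
  then show ?thesis using P(1) by (simp add: XP_def sorted_list_of_set_remove)
qed

lemma I_H: "x \<in> I \<Longrightarrow> x \<in> H m"
  by (auto simp: H_def intro: bf.span_base)

lemma Y_H: "path vs t \<Longrightarrow> length vs < m \<Longrightarrow> Y vs \<in> H m"
  by (auto simp: H_def intro: bf.span_base)

lemma H_mono: "m \<le> m' \<Longrightarrow> x \<in> H m \<Longrightarrow> x \<in> H m'"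
  unfolding H_def
  by (rule subsetD[OF bf.span_mono, of "I \<union> {Y vs | vs t. path vs t \<and> length vs < m}"]) fastforce+

lemma H_add: "x \<in> H m \<Longrightarrow> y \<in> H m \<Longrightarrow> x + y \<in> H m"
  and H_C: "x \<in> H m \<Longrightarrow> C r * x \<in> H m"
  by (simp_all add: H_def bf.span_add bf.span_scale)

lemma H_diff: "x \<in> H m \<Longrightarrow> y \<in> H m \<Longrightarrow> x - y \<in> H m"
  by (simp add: H_def bf.span_diff)

lemma H_cg: "x \<approx> y \<Longrightarrow> y \<in> H m \<Longrightarrow> x \<in> H m"
  using H_add[of "x - y" m y] I_H J_I by (auto simp: cg_def)

text \<open>Where t shows the pattern 01 at j, j + 1, the product already ends in U_j: j is the last
  letter, or the last letter is apart from j and commutes past U_j, or the word is empty and j is in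
  \<open>P\<close>.\<close>

lemma path_01:
  assumes "path ws t" "j \<in> N" "\<not> cw t j" "cw t (Suc j)"
  shows "\<exists>y. Y ws \<approx> y * UF j"
  using assms
proof (induction arbitrary: j rule: path.induct)
  case Nil
  then have "j \<in> P" using cw0 by auto
  then show ?case using XP_pull by (auto simp: Y_def)
next
  case (snoc ws t i)
  note tT = path_T[OF snoc.hyps(1)]
  show ?case
  proof (cases "i = j")
    case True
    have "Y (ws @ [i]) = Y ws * UF j" by (simp add: Y_def True mult.assoc)
    then show ?thesis by (metis cg_refl)
  next
    case False
    \<comment> \<open>The step at i leaves the pattern 01 at i, i + 1, and two occurrences of 01
      cannot overlap in one letter.\<close>
    have "j \<noteq> Suc i" "i \<noteq> Suc j"
      using snoc.prems(2,3) snoc.hyps(3,4) cw_sw[OF tT snoc.hyps(2)]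
      by (auto simp: adj_swap_def split: if_splits)
    with False have ap: "apart i j" by linarith
    have "\<not> cw t j" "cw t (Suc j)"
      using snoc.prems(2,3) ap cw_sw[OF tT snoc.hyps(2)] by (auto simp: adj_swap_def split: if_splits)
    then obtain y where y: "Y ws \<approx> y * UF j" using snoc.IH snoc.prems(1) by blast
    have "Y (ws @ [i]) = Y ws * UF i" by (simp add: Y_def mult.assoc)
    also have "\<dots> \<approx> y * UF j * UF i" using y by (rule cg_right)
    also have "\<dots> = y * (UF j * UF i)" by (simp add: mult.assoc)
    also have "\<dots> \<approx> y * (UF i * UF j)" using ap by (intro cg_left U_comm) auto
    also have "\<dots> = y * UF i * UF j" by (simp add: mult.assoc)
    finally show ?thesis by blast
  qed
qed

lemma path_mult_01:
  assumes "path ws t" "i \<in> N" "j \<in> N" "i = Suc j \<or> j = Suc i" "\<not> cw t j" "cw t (Suc j)"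
  shows "Y ws * UF i * UF j \<approx> Y ws"
proof -
  obtain y where y: "Y ws \<approx> y * UF j" using path_01 assms by blast
  have "Y ws * UF i * UF j \<approx> y * UF j * UF i * UF j"
    using y by (intro cg_right)
  also have "\<dots> = y * (UF j * UF i * UF j)" by (simp add: mult.assoc)
  also have "\<dots> \<approx> y * UF j" using U_TL assms(2-4) by (intro cg_left) auto
  also have "\<dots> \<approx> Y ws" using y by (rule cg_sym)
  finally show ?thesis .
qed

lemma H_mult:
  assumes "\<And>vs t. path vs t \<Longrightarrow> length vs < m \<Longrightarrow> Y vs * UF j \<in> H (Suc m)" "x \<in> H m"
  shows "x * UF j \<in> H (Suc m)"
  using assms(2) unfolding H_def
proof (rule span_mult_right)
  interpret I: tsideal I by unfold_locales (rule tsi_I)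
  fix b assume "b \<in> I \<union> {Y vs |vs t. path vs t \<and> length vs < m}"
  then have "b * UF j \<in> H (Suc m)"
    using assms(1) I.Imult_right I_H by auto
  then show "b * UF j \<in> bf.span (I \<union> {Y vs |vs t. path vs t \<and> length vs < Suc m})"
    by (simp add: H_def)
qed

text \<open>The one input from the shapes with more rows of length two: at the empty word, a pattern
  00 leaves no shorter word to fall back on, so the product has to lie in \<open>I\<close>
  already.\<close>

context
  assumes base00: "\<And>j. \<lbrakk>j \<in> N; \<not> cw \<tau> j; \<not> cw \<tau> (Suc j)\<rbrakk> \<Longrightarrow> XP * UF j \<in> I"
begin

text \<open>The induction is on the last letter \<open>i\<close> of the word: if \<open>i\<close> and \<open>j\<close> are neighbours and the step
  at \<open>j\<close> is not upward, then the shorter word already ends in \<open>U\<^sub>j\<close> up to commutations, and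
  \<open>U\<^sub>j U\<^sub>i U\<^sub>j = U\<^sub>j\<close> removes two letters.\<close>

lemma Y_mult:
  assumes "path ws t" "j \<in> N"
  shows "Y ws * UF j \<in> H (Suc (Suc (length ws)))"
    and "\<not> (cw t j \<and> \<not> cw t (Suc j)) \<Longrightarrow> Y ws * UF j \<in> H (Suc (length ws))"
proof -
  have "path ws t \<Longrightarrow> j \<in> N \<Longrightarrow> Y ws * UF j \<in> H (Suc (Suc (length ws))) \<and>
     (\<not> (cw t j \<and> \<not> cw t (Suc j)) \<longrightarrow> Y ws * UF j \<in> H (Suc (length ws)))" for ws t j
  proof (induction "length ws" arbitrary: ws t j rule: less_induct)
    case less
    have "\<not> (cw t j \<and> \<not> cw t (Suc j)) \<longrightarrow> Y ws * UF j \<in> H (Suc (length ws))"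
      using less.prems(1)
    proof (cases rule: path.cases)
      case Nil
      show ?thesis
      proof (intro impI)
        assume no: "\<not> (cw t j \<and> \<not> cw t (Suc j))"
        \<comment> \<open>\<open>P\<close> contains no two consecutive numbers, so the pattern 11
          does not occur in the initial tableau; 00 is settled by \<open>base00\<close> and 01 by
          \<open>U_sq\<close>.\<close>
        have "\<not> (cw \<tau> j \<and> cw \<tau> (Suc j))" using P(3) by (auto simp: cw0)
        with no Nil consider "\<not> cw \<tau> j" "\<not> cw \<tau> (Suc j)" | "\<not> cw \<tau> j" "cw \<tau> (Suc j)" by blast
        then show "Y ws * UF j \<in> H (Suc (length ws))"
        proof cases
          case 1
          then have "XP * UF j \<in> I" using base00 less.prems(2) by blast
          then show ?thesis using I_H by (simp add: Y_def Nil)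
        next
          case 2
          then have "j \<in> P" by (auto simp: cw0)
          let ?y = "UU (sorted_list_of_set (P - {j}))"
          have "XP * UF j \<approx> ?y * UF j * UF j" using XP_pull[OF \<open>j \<in> P\<close>] by (rule cg_right)
          also have "\<dots> = ?y * (UF j * UF j)" by (simp add: mult.assoc)
          also have "\<dots> \<approx> ?y * (C (qL + qinv) * UF j)" using U_sq less.prems by (intro cg_left)
          also have "\<dots> = C (qL + qinv) * (?y * UF j)" by (rule C_left_commute)
          also have "\<dots> \<approx> C (qL + qinv) * XP" using XP_pull[OF \<open>j \<in> P\<close>] cg_left cg_sym by blast
          finally have "Y ws * UF j \<approx> C (qL + qinv) * Y ws" by (simp add: Nil Y_def)
          then show ?thesis using H_cg H_C Y_H[OF less.prems(1)] by blast
        qed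
      qed
    next
      case (snoc ws' t' i)
      note tT = path_T[OF snoc(3)]
      have Yws: "Y ws = Y ws' * UF i" by (simp add: Y_def snoc mult.assoc)
      have cwt: "cw t k = cw t' (adj_swap i k)" for k
        using cw_sw[OF tT snoc(4)] snoc(2) by simp
      show ?thesis
      proof (intro impI)
        assume no: "\<not> (cw t j \<and> \<not> cw t (Suc j))"
        consider "i = j" | "apart i j" | "i = Suc j" | "j = Suc i" by linarith
        then show "Y ws * UF j \<in> H (Suc (length ws))"
        proof cases
          case 1
          have "Y ws * UF j = Y ws' * (UF i * UF i)" by (simp add: Yws 1 mult.assoc)
          also have "\<dots> \<approx> Y ws' * (C (qL + qinv) * UF i)" using U_sq snoc(4) by (intro cg_left)
          also have "\<dots> = C (qL + qinv) * Y ws" by (simp add: Yws C_left_commute)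
          finally show ?thesis using H_cg H_C Y_H[OF less.prems(1)] by blast
        next
          case 2
          have "Y ws * UF j = Y ws' * (UF i * UF j)" by (simp add: Yws mult.assoc)
          also have "\<dots> \<approx> Y ws' * (UF j * UF i)" using 2 by (intro cg_left U_comm)
          also have "\<dots> = Y ws' * UF j * UF i" by (simp add: mult.assoc)
          finally have cg: "Y ws * UF j \<approx> Y ws' * UF j * UF i" .
          have no': "\<not> (cw t' j \<and> \<not> cw t' (Suc j))"
            using no 2 by (auto simp: cwt adj_swap_def split: if_splits)
          \<comment> \<open>The induction hypothesis is used twice: \<open>UF j\<close> does not
            lengthen \<open>ws'\<close>, and \<open>UF i\<close> lengthens each of the resulting
            words by at most one letter.\<close>
          have "Y ws' * UF j \<in> H (Suc (length ws'))"
            using less.hyps[of ws' t' j] no' snoc(1,3) less.prems(2) by simp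
          then have "Y ws' * UF j * UF i \<in> H (Suc (Suc (length ws')))"
          proof (rule H_mult[rotated])
            fix vs t'' assume "path vs t''" "length vs < Suc (length ws')"
            then have "Y vs * UF i \<in> H (Suc (Suc (length vs)))"
              and "Suc (Suc (length vs)) \<le> Suc (Suc (length ws'))"
              using less.hyps[of vs t'' i] snoc(1,4) by simp_all
            then show "Y vs * UF i \<in> H (Suc (Suc (length ws')))" by (rule H_mono[rotated])
          qed
          then show ?thesis using cg H_cg snoc(1) by simp
        next
          case 3
          \<comment> \<open>The step at i = j + 1 has put a first-column entry on j + 1. As the
            pattern at j is not 10, j stands in the first column too, and did so before the
            step.\<close>
          have "\<not> cw t' j" "cw t' (Suc j)"
            using no snoc(5,6) 3 by (auto simp: cwt adj_swap_def split: if_splits)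
          then have "Y ws * UF j \<approx> Y ws'"
            using path_mult_01[OF snoc(3,4) less.prems(2)] 3 by (simp add: Yws)
          then show ?thesis using H_cg Y_H[OF snoc(3)] snoc(1) by simp
        next
          case 4
          \<comment> \<open>Here j = i + 1 carries a second-column entry after the step, so j + 1
            carries one as well; otherwise the pattern at j would be 10.\<close>
          have "\<not> cw t' j" "cw t' (Suc j)"
            using no snoc(5,6) 4 by (auto simp: cwt adj_swap_def split: if_splits)
          then have "Y ws * UF j \<approx> Y ws'"
            using path_mult_01[OF snoc(3,4) less.prems(2)] 4 by (simp add: Yws)
          then show ?thesis using H_cg Y_H[OF snoc(3)] snoc(1) by simp
        qed
      qed
    qed
    moreover have "Y ws * UF j \<in> H (Suc (Suc (length ws)))" if "cw t j \<and> \<not> cw t (Suc j)"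
    proof -
      have "path (ws @ [j]) (sw j t)" using that less.prems by (auto intro: path.snoc)
      from Y_H[OF this] show ?thesis by (simp add: Y_def mult.assoc)
    qed
    moreover have "Y ws * UF j \<in> H (Suc (Suc (length ws)))" if "Y ws * UF j \<in> H (Suc (length ws))"
      by (rule H_mono[OF _ that]) simp
    ultimately show ?case by blast
  qed
  then show "Y ws * UF j \<in> H (Suc (Suc (length ws)))"
    and "\<not> (cw t j \<and> \<not> cw t (Suc j)) \<Longrightarrow> Y ws * UF j \<in> H (Suc (length ws))"
    using assms by auto
qed

lemma H_mult_UF:
  assumes "x \<in> H m" "j \<in> N"
  shows "x * UF j \<in> H (Suc m)"
  using _ assms(1)
proof (rule H_mult)
  fix vs t assume "path vs t" "length vs < m"
  then show "Y vs * UF j \<in> H (Suc m)"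
    using assms(2) by (intro H_mono[OF _ Y_mult(1)]) auto
qed

text \<open>Each letter contributes z_i = U_i - q^-1: choosing the scalar shortens the word, and
  multiplying the earlier discrepancy by \<open>UF i\<close> raises its level by only one.\<close>

lemma path_ZZ: "path ws t \<Longrightarrow> XP * ZZ ws - Y ws \<in> H (length ws)"
proof (induction rule: path.induct)
  case Nil
  show ?case using I_H tsi_I by (auto simp: Y_def two_sided_ideal_iff)
next
  case (snoc ws t i)
  let ?d = "XP * ZZ ws - Y ws" and ?l = "Suc (length ws)"
  have "XP * ZZ (ws @ [i]) - Y (ws @ [i]) = ?d * UF i - C qinv * ?d - C qinv * Y ws"
    by (simp add: Y_def UF_def algebra_simps C_commute[of "ZZ _"] C_commute[of "UU _"] C_left_commute[of XP])
  moreover have "?d * UF i \<in> H ?l" using snoc.IH snoc.hyps(2) by (rule H_mult_UF)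
  moreover have "C qinv * ?d \<in> H ?l" using H_mono[OF _ H_C[OF snoc.IH], of ?l] by simp
  moreover have "C qinv * Y ws \<in> H ?l" using H_C[OF Y_H[OF snoc.hyps(1), of ?l]] by simp
  ultimately show ?case by (simp add: H_diff)
qed

context
  assumes rw: "t \<in> T \<Longrightarrow> path (rw t) t"
begin

text \<open>Every upward step raises the sum of the second-column entries by one, so all paths to
  one tableau have the same length.\<close>

lemma path_length: "path ws t \<Longrightarrow> (\<Sum>i | cw t i. i) = (\<Sum>i | cw \<tau> i. i) + length ws \<and> finite {i. cw t i}"
proof (induction rule: path.induct)
  case Nil
  have "{i. cw \<tau> i} = Suc ` P" using cw0 by auto
  then show ?case using P(1) by simp
next
  case (snoc ws t i)
  let ?A = "{i. cw t i} - {i}"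
  have eq: "{k. cw (sw i t) k} = insert (Suc i) ?A"
    using snoc cw_sw[OF path_T[OF snoc(1)] snoc(2)] by (auto simp: adj_swap_def)
  have "(\<Sum>k | cw (sw i t) k. k) = Suc i + \<Sum>?A"
    unfolding eq using snoc by (subst sum.insert) auto
  moreover have "(\<Sum>k | cw t k. k) = i + \<Sum>?A"
    using snoc by (intro sum.remove) auto
  ultimately show ?case using snoc eq by simp
qed

text \<open>Diamond argument. If the last letters i and j differ, t shows 01 at both places, so i
  and j are apart and both steps can be undone. A path to the common lower tableau extends by j and
  by i to the two predecessors of t, and the two continuations differ by commuting
  \<open>UF i\<close> with \<open>UF j\<close>.\<close>

lemma path_indep: "path ws t \<Longrightarrow> path vs t \<Longrightarrow> Y ws \<approx> Y vs"
proof (induction "length ws" arbitrary: ws vs t rule: less_induct)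
  case less
  have len: "length vs = length ws"
    using path_length[OF less.prems(1)] path_length[OF less.prems(2)] by simp
  show ?case
    using less.prems(1)
  proof (cases rule: path.cases)
    case Nil
    then show ?thesis using len by simp
  next
    case (snoc ws' t1 i)
    note ws = snoc
    show ?thesis
      using less.prems(2)
    proof (cases rule: path.cases)
      case Nil
      then show ?thesis using len snoc by simp
    next
      case (snoc vs' t2 j)
      note vs = snoc
      have Yws: "Y ws = Y ws' * UF i" and Yvs: "Y vs = Y vs' * UF j"
        by (simp_all add: Y_def ws vs mult.assoc)
      note T1 = path_T[OF ws(3)] and T2 = path_T[OF vs(3)] and T0 = path_T[OF less.prems(1)]
      have t1: "sw i t = t1" and t2: "sw j t = t2"
        using sw_sw[OF T1 ws(4)] ws(2) sw_sw[OF T2 vs(4)] vs(2) by simp_all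
      show ?thesis
      proof (cases "i = j")
        case True
        then have "Y ws' \<approx> Y vs'"
          using less.hyps[of ws' t1 vs'] ws vs t1 t2 by simp
        then show ?thesis unfolding Yws Yvs True by (rule cg_right)
      next
        case False
        have cwt: "cw t k = cw t1 (adj_swap i k)" "cw t k = cw t2 (adj_swap j k)" for k
          using ws(2) vs(2) cw_sw[OF T1 ws(4)] cw_sw[OF T2 vs(4)] by simp_all
        have "\<not> cw t i" "cw t (Suc i)" "\<not> cw t j" "cw t (Suc j)"
          using cwt(1)[of i] cwt(1)[of "Suc i"] cwt(2)[of j] cwt(2)[of "Suc j"] ws(5,6) vs(5,6)
          by (simp_all add: adj_swap_def)
        then have "j \<noteq> Suc i" "i \<noteq> Suc j" by auto
        with False have ap: "apart i j" by linarith
        let ?s = "sw i (sw j t)"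
        have S: "?s \<in> T" using diamond[OF T0 ws(4) vs(4) ap] T1 T2 t1 t2 by simp
        have s1: "?s = sw j t1" using sw_comm[OF ap] t1 by simp
        have s2: "?s = sw i t2" using t2 by simp
        obtain us where us: "path us ?s" using rw[OF S] by blast
        have c: "cw ?s k = cw t1 (adj_swap j k)" "cw ?s k = cw t2 (adj_swap i k)" for k
          using s1 s2 cw_sw[OF T1 vs(4)] cw_sw[OF T2 ws(4)] by simp_all
        have "path (us @ [j]) (sw j ?s)"
          using us vs(4) ws(5,6) c(2) vs(2) ap vs(5,6) \<open>\<not> cw t j\<close> \<open>cw t (Suc j)\<close>
          by (intro path.snoc) (auto simp: adj_swap_def)
        then have p1: "path (us @ [j]) t1" using s1 sw_sw[OF T1 vs(4)] by simp
        have "path (us @ [i]) (sw i ?s)"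
          using us ws(4) c(1) ap ws(5,6)
          by (intro path.snoc) (auto simp: adj_swap_def)
        then have p2: "path (us @ [i]) t2" using s2 sw_sw[OF T2 ws(4)] by simp
        have "Y ws' \<approx> Y (us @ [j])" using less.hyps[OF _ ws(3) p1] ws by simp
        then have "Y ws \<approx> Y (us @ [j]) * UF i" unfolding Yws by (rule cg_right)
        also have "\<dots> = Y us * (UF j * UF i)" by (simp add: Y_def mult.assoc)
        also have "\<dots> \<approx> Y us * (UF i * UF j)" using ap by (intro cg_left U_comm) auto
        also have "\<dots> = Y (us @ [i]) * UF j" by (simp add: Y_def mult.assoc)
        also have "\<dots> \<approx> Y vs" unfolding Yvs
        proof (rule cg_right)
          show "Y (us @ [i]) \<approx> Y vs'" using less.hyps[OF _ vs(3) p2] vs ws len cg_sym by simp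
        qed
        finally show ?thesis .
      qed
    qed
  qed
qed

text \<open>Unitriangularity: \<open>path_indep\<close> replaces \<open>ws\<close> by
  \<open>rw t\<close>, and passing from U to z costs only products along shorter words, which are in
  \<open>V\<close> by induction.\<close>

lemma Y_V: "path ws t \<Longrightarrow> Y ws \<in> V"
proof (induction "length ws" arbitrary: ws t rule: less_induct)
  case less
  have t: "t \<in> T" and p: "path (rw t) t" using path_T[OF less.prems] rw by auto
  have len: "length (rw t) = length ws"
    using path_length[OF less.prems] path_length[OF p] by simp
  have "XP * ZZ (rw t) - Y (rw t) \<in> H (length ws)" using path_ZZ[OF p] len by simp
  then have "XP * ZZ (rw t) - Y (rw t) \<in> V"
    unfolding H_def V_def
  proof (rule span_subsetI[rotated])
    fix b assume "b \<in> I \<union> {Y vs |vs t. path vs t \<and> length vs < length ws}"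
    then show "b \<in> bf.span (I \<union> {XP * ZZ (rw t) |t. t \<in> T})"
      using less.hyps by (auto simp: V_def intro: bf.span_base)
  qed
  moreover have "XP * ZZ (rw t) \<in> V" using t by (auto simp: V_def intro: bf.span_base)
  moreover have "Y ws - Y (rw t) \<in> V"
    using path_indep[OF less.prems p] J_I by (auto simp: cg_def V_def intro: bf.span_base)
  ultimately show ?case
    unfolding V_def using bf.span_add[OF _ bf.span_diff] by fastforce
qed

theorem V_mult: "x \<in> V \<Longrightarrow> x * a \<in> V"
proof (rule mult_gen_closed)
  interpret I: tsideal I by unfold_locales (rule tsi_I)
  fix x i assume x: "x \<in> V" and i: "i \<in> N"
  have HV: "y \<in> V" if "y \<in> H m" for y m
    using that unfolding H_def V_def
  proof (rule span_subsetI[rotated])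
    fix b assume "b \<in> I \<union> {Y vs |vs t. path vs t \<and> length vs < m}"
    then show "b \<in> bf.span (I \<union> {XP * ZZ (rw t) |t. t \<in> T})"
      using Y_V by (auto simp: V_def intro: bf.span_base)
  qed
  show "x * UF i \<in> V"
    using x unfolding V_def
  proof (rule span_mult_right)
    fix b assume "b \<in> I \<union> {XP * ZZ (rw t) |t. t \<in> T}"
    then consider "b \<in> I" | t where "t \<in> T" "b = XP * ZZ (rw t)" by blast
    then have "b * UF i \<in> V"
    proof cases
      case 1
      then show ?thesis using I.Imult_right by (auto simp: V_def intro: bf.span_base)
    next
      case 2
      have "(XP * ZZ (rw t) - Y (rw t)) + Y (rw t) \<in> H (Suc (length (rw t)))"
        using path_ZZ[OF rw[OF 2(1)]] Y_H[OF rw[OF 2(1)]]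
          H_mono[of "length (rw t)" "Suc (length (rw t))"] by (intro H_add) auto
      from HV[OF H_mult_UF[OF this i]] show ?thesis by (simp add: 2(2))
    qed
    then show "b * UF i \<in> bf.span (I \<union> {XP * ZZ (rw t) |t. t \<in> T})" by (simp add: V_def)
  qed
next
  show "J \<subseteq> V" using J_I by (auto simp: V_def intro: bf.span_base)
qed (auto simp: V_def bf.span_scale bf.span_add)

end

end

end

section \<open>Reduced words\<close>

lemma adj_swap_simps [simp]: "adj_swap i i = Suc i" "adj_swap i (Suc i) = i"
    "adj_swap i (adj_swap i x) = x" "adj_swap i \<circ> (adj_swap i \<circ> f) = f"
  by (auto simp: adj_swap_def)

lemma adj_swap_apart: "apart i j \<Longrightarrow> adj_swap i (adj_swap j x) = adj_swap j (adj_swap i x)"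
  by (auto simp: adj_swap_def)

lemma adj_swap_permutes: "i \<in> {1..<n} \<Longrightarrow> adj_swap i permutes {1..n}"
  by (rule bij_imp_permutes, rule bij_betwI[where g = "adj_swap i"]) (auto simp: adj_swap_def)

lemma inj_adj_swap: "inj (adj_swap i)"
  by (metis adj_swap_simps(3) injI)

lemma perm_of_word_simps [simp]: "perm_of_word [] = id"
    "perm_of_word (ws @ [i]) = adj_swap i \<circ> perm_of_word ws"
  by (simp_all add: perm_of_word_def)

lemma perm_of_word_permutes: "set ws \<subseteq> {1..<n} \<Longrightarrow> perm_of_word ws permutes {1..n}"
  by (induction ws rule: rev_induct) (simp_all add: permutes_compose adj_swap_permutes permutes_id del: One_nat_def)

definition invs :: "(nat \<Rightarrow> nat) \<Rightarrow> (nat \<times> nat) set" where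
  "invs w = {(a, b). a < b \<and> w b < w a}"

lemma finite_invs:
  assumes "w permutes {1..n}"
  shows "finite (invs w)"
proof (rule finite_subset)
  have "a \<in> {1..n} \<and> b \<in> {1..n}" if "a < b" "w b < w a" for a b
  proof -
    have *: "w x \<in> {1..n} \<longleftrightarrow> x \<in> {1..n}" and **: "x \<notin> {1..n} \<Longrightarrow> w x = x" for x
      using assms permutes_in_image permutes_not_in by metis+
    show ?thesis using that *[of a] *[of b] **[of a] **[of b] by (auto simp: not_le)
  qed
  then show "invs w \<subseteq> {1..n} \<times> {1..n}" unfolding invs_def by blast
qed simp

text \<open>Composing with \<open>adj_swap i\<close> on the outside exchanges the values i and i +
  1, so only the pair of positions of these values changes its status. This is why ascents and
  descents are read off \<open>inv w\<close>.\<close>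

lemma invs_ascent:
  assumes w: "w permutes {1..n}" and lt: "inv w i < inv w (Suc i)"
  shows "card (invs (adj_swap i \<circ> w)) = Suc (card (invs w))"
proof -
  let ?a = "inv w i" and ?b = "inv w (Suc i)"
  have wa: "w ?a = i" and wb: "w ?b = Suc i" using permutes_inverses[OF w] by auto
  have inj: "w x = w y \<longleftrightarrow> x = y" for x y using permutes_inj[OF w] by (auto dest: injD)
  have "invs (adj_swap i \<circ> w) = insert (?a, ?b) (invs w)"
  proof (intro set_eqI, clarify)
    fix x y
    have a: "w x = i \<longleftrightarrow> x = ?a" "w y = i \<longleftrightarrow> y = ?a" "w x = Suc i \<longleftrightarrow> x = ?b" "w y = Suc i \<longleftrightarrow> y = ?b"
      using wa wb inj by metis+
    show "(x, y) \<in> invs (adj_swap i \<circ> w) \<longleftrightarrow> (x, y) \<in> insert (?a, ?b) (invs w)"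
      using lt wa wb a by (auto simp: invs_def adj_swap_def)
  qed
  moreover have "(?a, ?b) \<notin> invs w" by (simp add: invs_def wa wb)
  ultimately show ?thesis using finite_invs[OF w] by simp
qed

lemma inv_adj_swap_comp:
  assumes w: "w permutes {1..n}" and i: "i \<in> {1..<n}"
  shows "inv (adj_swap i \<circ> w) k = inv w (adj_swap i k)"
proof -
  have p: "(adj_swap i \<circ> w) permutes {1..n}"
    using w adj_swap_permutes[OF i] by (rule permutes_compose)
  have "(adj_swap i \<circ> w) (inv w (adj_swap i k)) = k"
    by (simp add: permutes_inverses[OF w])
  then show ?thesis using permutes_inverses(2)[OF p] by metis
qed

lemma invs_descent:
  assumes w: "w permutes {1..n}" and i: "i \<in> {1..<n}" and lt: "inv w (Suc i) < inv w i"
  shows "card (invs w) = Suc (card (invs (adj_swap i \<circ> w)))"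
  using invs_ascent[of "adj_swap i \<circ> w" n i] permutes_compose[OF w adj_swap_permutes[OF i]]
    inv_adj_swap_comp[OF w i] lt by simp

lemma ascent_or_descent:
  assumes w: "w permutes {1..n}"
  shows "inv w i < inv w (Suc i) \<or> inv w (Suc i) < inv w i"
  using permutes_inj[OF permutes_inv[OF w]] by (metis injD linorder_neqE_nat n_not_Suc_n)

lemma invs_id: "invs (\<lambda>x. x) = {}"
  by (auto simp: invs_def)

lemma card_invs_le:
  "set ws \<subseteq> {1..<n} \<Longrightarrow> card (invs (perm_of_word ws)) \<le> length ws"
proof (induction ws rule: rev_induct)
  case Nil
  show ?case using invs_id by simp
next
  case (snoc i ws)
  let ?w = "perm_of_word ws"
  have w: "?w permutes {1..n}" using snoc perm_of_word_permutes by auto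
  have i: "i \<in> {1..<n}" using snoc by auto
  show ?case
    using ascent_or_descent[OF w, of i] invs_ascent[OF w, of i] invs_descent[OF w i] snoc
    by (auto simp: comp_def)
qed

text \<open>An inverse without descents satisfies \<open>i \<le> inv w i\<close> on
  \<open>{1..n}\<close>, and among permutations only the identity does.\<close>

lemma no_descent_id:
  assumes w: "w permutes {1..n}" and asc: "\<And>i. i \<in> {1..<n} \<Longrightarrow> inv w i < inv w (Suc i)"
  shows "w = id"
proof -
  have v: "inv w permutes {1..n}" using w by (rule permutes_inv)
  have "i \<in> {1..n} \<longrightarrow> i \<le> inv w i" for i
  proof (induction i)
    case (Suc i)
    show ?case
    proof (cases "i = 0")
      case True
      then show ?thesis using permutes_in_image[OF v, of "Suc i"] by auto
    next
      case False
      then show ?thesis using Suc asc[of i] by auto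
    qed
  qed simp
  then have "inv w = id" using permutes_natset_ge[OF v] by blast
  then show ?thesis using permutes_inv_inv[OF w] by simp
qed

text \<open>Sorting: composing with the swap at a descent removes one inversion, until no descent is
  left.\<close>

lemma ex_short_word:
  "w permutes {1..n} \<Longrightarrow> \<exists>ws. is_word_for n w ws \<and> length ws = card (invs w)"
proof (induction "card (invs w)" arbitrary: w rule: less_induct)
  case less
  show ?case
  proof (cases "\<exists>i\<in>{1..<n}. inv w (Suc i) < inv w i")
    case True
    then obtain i where i: "i \<in> {1..<n}" "inv w (Suc i) < inv w i" by blast
    let ?v = "adj_swap i \<circ> w"
    have c: "card (invs w) = Suc (card (invs ?v))" using invs_descent[OF less.prems i] .
    have v: "?v permutes {1..n}" using less.prems adj_swap_permutes[OF i(1)] by (rule permutes_compose)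
    obtain ws where ws: "is_word_for n ?v ws" "length ws = card (invs ?v)"
      using less.hyps[OF _ v] c by auto
    have "is_word_for n w (ws @ [i])" using ws(1) i(1) by (auto simp: is_word_for_def)
    then show ?thesis using c ws(2) by (intro exI[of _ "ws @ [i]"]) simp
  next
    case False
    then have "w = id" using no_descent_id[OF less.prems] ascent_or_descent[OF less.prems] by blast
    then show ?thesis by (intro exI[of _ "[]"]) (simp add: is_word_for_def invs_id id_def)
  qed
qed

text \<open>Reducedness expressed by the inversion number instead of minimality among all words; in
  this form it passes to prefixes.\<close>

definition short_word :: "nat \<Rightarrow> nat list \<Rightarrow> (nat \<Rightarrow> nat) \<Rightarrow> bool" where
  "short_word n ws w \<longleftrightarrow> is_word_for n w ws \<and> length ws = card (invs w)"

lemma short_word_reduced: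
  assumes w: "w permutes {1..n}"
  shows "short_word n (reduced_word n w) w"
proof -
  let ?P = "\<lambda>ws. is_word_for n w ws \<and> (\<forall>ws'. is_word_for n w ws' \<longrightarrow> length ws \<le> length ws')"
  obtain ws where ws: "is_word_for n w ws" "length ws = card (invs w)"
    using ex_short_word[OF w] by blast
  have ge: "card (invs w) \<le> length ws'" if "is_word_for n w ws'" for ws'
    using card_invs_le[of ws'] that by (auto simp: is_word_for_def)
  have "?P ws" using ws ge by simp
  then have "?P (reduced_word n w)" unfolding reduced_word_def by (rule someI)
  then show ?thesis using ws ge[of "reduced_word n w"] by (auto simp: short_word_def intro: le_antisym)
qed

lemma short_word_Nil: "short_word n [] w \<Longrightarrow> w = id"
  by (auto simp: short_word_def is_word_for_def)

lemma short_word_id: "short_word n ws id \<Longrightarrow> ws = []"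
  by (simp add: short_word_def invs_id id_def)

text \<open>If the last letter were an ascent of \<open>w\<close>, the prefix would have more
  inversions than letters, against \<open>card_invs_le\<close>.\<close>

lemma short_word_snoc:
  assumes "short_word n (ws @ [i]) w"
  shows "i \<in> {1..<n}" "inv w (Suc i) < inv w i" "short_word n ws (adj_swap i \<circ> w)"
    "w permutes {1..n}"
proof -
  let ?v = "perm_of_word ws"
  from assms have i: "i \<in> {1..<n}" and s: "set ws \<subseteq> {1..<n}" and w: "w = adj_swap i \<circ> ?v"
    and len: "Suc (length ws) = card (invs w)"
    by (auto simp: short_word_def is_word_for_def)
  have v: "?v permutes {1..n}" using perm_of_word_permutes[OF s] .
  show wp: "w permutes {1..n}" unfolding w using v adj_swap_permutes[OF i] by (rule permutes_compose)
  have v': "adj_swap i \<circ> w = ?v" unfolding w by simp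
  have le: "card (invs ?v) \<le> length ws" using s by (rule card_invs_le)
  show "i \<in> {1..<n}" by (rule i)
  show lt: "inv w (Suc i) < inv w i"
  proof (rule ccontr)
    assume "\<not> inv w (Suc i) < inv w i"
    then have "inv w i < inv w (Suc i)" using ascent_or_descent[OF wp] by blast
    from invs_ascent[OF wp this] show False using le len v' by simp
  qed
  show "short_word n ws (adj_swap i \<circ> w)"
    using invs_descent[OF wp i lt] len s by (simp add: short_word_def is_word_for_def v')
qed

section \<open>Linear set partitions and idempotents\<close>

text \<open>A linear set partition is encoded by the set of i that it does not separate from i + 1.
  Refinement becomes inclusion, so the poset is the Boolean lattice on \<open>{1..<n}\<close> and
  the sum defining \<open>EE\<close> is an inclusion-exclusion sum.\<close>

definition noncuts :: "nat \<Rightarrow> nat set set \<Rightarrow> nat set" where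
  "noncuts n Q = {i \<in> {1..<n}. \<exists>B\<in>Q. i \<in> B \<and> Suc i \<in> B}"

text \<open>Inverse of the encoding: the block of i consists of the j that are reached from i
  without crossing a cut, in either direction.\<close>

definition run :: "nat \<Rightarrow> nat set \<Rightarrow> nat \<Rightarrow> nat set" where
  "run n N i = {j \<in> {1..n}. {min i j..<max i j} \<subseteq> N}"

lemma noncuts_subset: "noncuts n Q \<subseteq> {1..<n}"
  by (auto simp: noncuts_def)

lemma finite_noncuts [simp]: "finite (noncuts n Q)"
  using finite_subset[OF noncuts_subset] by blast

lemma block_eq_run:
  assumes Q: "Q \<in> linear_set_partitions n" and B: "B \<in> Q" "i \<in> B"
  shows "B = run n (noncuts n Q) i"
proof -
  have part: "partition_on {1..n} Q" using Q by (simp add: linear_set_partitions_def)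
  have sub: "B \<subseteq> {1..n}" using partition_onD1[OF part] B by auto
  obtain a b where ab: "B = {a..b}" using Q B by (auto simp: linear_set_partitions_def)
  have same: "k \<in> B \<longleftrightarrow> Suc k \<in> B" if "k \<in> noncuts n Q" for k
    using that partition_onD2[OF part] B(1) by (auto simp: noncuts_def disjoint_def)
  have chain: "k \<in> B \<longleftrightarrow> k + d \<in> B" if "{k..<k + d} \<subseteq> noncuts n Q" for k d
    using that
  proof (induction d)
    case (Suc d)
    have "{k..<k + d} \<subseteq> noncuts n Q" using Suc.prems by fastforce
    moreover have "k + d \<in> noncuts n Q" using Suc.prems by auto
    ultimately show ?case using Suc.IH same[of "k + d"] by simp
  qed simp
  show ?thesis
  proof (intro set_eqI iffI)
    fix j assume j: "j \<in> B"
    have "k \<in> noncuts n Q" if "k \<in> {min i j..<max i j}" for k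
    proof -
      have "k \<in> B" "Suc k \<in> B" using that j B(2) by (auto simp: ab min_def max_def split: if_splits)
      then show ?thesis using sub B(1) by (auto simp: noncuts_def)
    qed
    then show "j \<in> run n (noncuts n Q) i" using j sub by (auto simp: run_def)
  next
    fix j assume "j \<in> run n (noncuts n Q) i"
    then have s: "{min i j..<max i j} \<subseteq> noncuts n Q" by (simp add: run_def)
    show "j \<in> B"
    proof (cases "i \<le> j")
      case True
      then show ?thesis using chain[of i "j - i"] s B(2) by (auto simp: min_def max_def)
    next
      case False
      then show ?thesis using chain[of j "i - j"] s B(2) by (auto simp: min_def max_def split: if_splits)
    qed
  qed
qed

lemma lsp_eq_runs:
  assumes Q: "Q \<in> linear_set_partitions n"
  shows "Q = run n (noncuts n Q) ` {1..n}"
proof -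
  have part: "partition_on {1..n} Q" using Q by (simp add: linear_set_partitions_def)
  show ?thesis
  proof (intro set_eqI iffI)
    fix B assume B: "B \<in> Q"
    then obtain i where i: "i \<in> B" using partition_onD3[OF part] by (metis all_not_in_conv)
    moreover have "i \<in> {1..n}" using i B partition_onD1[OF part] by auto
    ultimately show "B \<in> run n (noncuts n Q) ` {1..n}" using block_eq_run[OF Q B i] by blast
  next
    fix B assume "B \<in> run n (noncuts n Q) ` {1..n}"
    then obtain i where i: "i \<in> {1..n}" "B = run n (noncuts n Q) i" by blast
    then obtain B' where "B' \<in> Q" "i \<in> B'" using partition_onD1[OF part] by blast
    then show "B \<in> Q" using block_eq_run[OF Q] i by auto
  qed
qed

lemma runs_lsp:
  assumes N: "N \<subseteq> {1..<n}"
  shows "run n N ` {1..n} \<in> linear_set_partitions n" "noncuts n (run n N ` {1..n}) = N"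
proof -
  have trans: "k \<in> run n N i" if "j \<in> run n N i" "k \<in> run n N j" for i j k
  proof -
    have "{min i k..<max i k} \<subseteq> {min i j..<max i j} \<union> {min j k..<max j k}"
      by (auto simp: min_def max_def)
    then show ?thesis using that by (auto simp: run_def)
  qed
  have sym: "i \<in> run n N j" if "j \<in> run n N i" "i \<in> {1..n}" for i j
    using that by (auto simp: run_def min.commute max.commute)
  have refl: "i \<in> run n N i" if "i \<in> {1..n}" for i using that by (auto simp: run_def)
  have "partition_on {1..n} (run n N ` {1..n})"
  proof (rule partition_onI)
    show "\<Union> (run n N ` {1..n}) = {1..n}" using refl by (auto simp: run_def)
    show "{} \<notin> run n N ` {1..n}" using refl by blast
    show "disjnt p p'" if p: "p \<in> run n N ` {1..n}" "p' \<in> run n N ` {1..n}" and ne: "p \<noteq> p'" for p p'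
    proof (rule ccontr)
      assume "\<not> disjnt p p'"
      then obtain i j k where "i \<in> {1..n}" "j \<in> {1..n}" "p = run n N i" "p' = run n N j"
        "k \<in> run n N i" "k \<in> run n N j"
        using p unfolding disjnt_def by blast
      then have "run n N i = run n N j" using trans sym by (meson set_eqI)
      then show False using ne \<open>p = _\<close> \<open>p' = _\<close> by simp
    qed
  qed
  moreover have "\<exists>a b. run n N i = {a..b}" if i: "i \<in> {1..n}" for i
  proof (intro exI set_eqI iffI)
    let ?R = "run n N i"
    have fin: "finite ?R" by (simp add: run_def)
    have ne: "?R \<noteq> {}" using refl[OF i] by blast
    fix x
    show "x \<in> {Min ?R..Max ?R}" if "x \<in> ?R" using that fin by simp
    assume x: "x \<in> {Min ?R..Max ?R}"
    have m: "Min ?R \<in> ?R" "Max ?R \<in> ?R" using fin ne by simp_all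
    have "{min i x..<max i x} \<subseteq> {min i (Min ?R)..<max i (Min ?R)} \<union> {min i (Max ?R)..<max i (Max ?R)}"
      using x by auto
    then show "x \<in> ?R" using m x by (auto simp: run_def)
  qed
  ultimately show "run n N ` {1..n} \<in> linear_set_partitions n"
    by (auto simp: linear_set_partitions_def)
  show "noncuts n (run n N ` {1..n}) = N"
  proof (intro set_eqI iffI)
    fix k assume "k \<in> noncuts n (run n N ` {1..n})"
    then obtain i where i: "k \<in> {1..<n}" "i \<in> {1..n}" "k \<in> run n N i" "Suc k \<in> run n N i"
      by (auto simp: noncuts_def)
    then have "Suc k \<in> run n N k" using sym trans by (meson)
    then show "k \<in> N" by (auto simp: run_def)
  next
    fix k assume k: "k \<in> N"
    then have "k \<in> run n N k" "Suc k \<in> run n N k" "k \<in> {1..n}" using N by (auto simp: run_def)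
    then show "k \<in> noncuts n (run n N ` {1..n})" using k N by (auto simp: noncuts_def)
  qed
qed

lemma bij_noncuts: "bij_betw (noncuts n) (linear_set_partitions n) (Pow {1..<n})"
proof (rule bij_betwI[where g = "\<lambda>N. run n N ` {1..n}"])
  show "noncuts n \<in> linear_set_partitions n \<rightarrow> Pow {1..<n}" using noncuts_subset by auto
  show "(\<lambda>N. run n N ` {1..n}) \<in> Pow {1..<n} \<rightarrow> linear_set_partitions n" using runs_lsp by auto
qed (use lsp_eq_runs runs_lsp in auto)

text \<open>Each block is represented by its maximum, and the maxima are the elements of
  \<open>{1..n}\<close> that are followed by a cut, n included.\<close>

lemma card_lsp:
  assumes Q: "Q \<in> linear_set_partitions n"
  shows "card Q = n - card (noncuts n Q)"
proof -
  have part: "partition_on {1..n} Q" using Q by (simp add: linear_set_partitions_def)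
  have sub: "B \<subseteq> {1..n}" if "B \<in> Q" for B
    using that partition_onD1[OF part] by blast
  have fin: "finite B" "B \<noteq> {}" if "B \<in> Q" for B
    using sub[OF that] finite_subset[of B "{1..n}"] that partition_onD3[OF part] by auto
  have same: "B = B'" if "B \<in> Q" "B' \<in> Q" "x \<in> B" "x \<in> B'" for B B' x
    using that partition_onD2[OF part] by (auto simp: disjoint_def)
  have "bij_betw Max Q ({1..n} - noncuts n Q)"
  proof (rule bij_betwI')
    fix B B' assume B: "B \<in> Q" "B' \<in> Q"
    show "Max B = Max B' \<longleftrightarrow> B = B'"
      using same[OF B] Max_in[OF fin(1,2)[OF B(1)]] Max_in[OF fin(1,2)[OF B(2)]] by metis
  next
    fix B assume B: "B \<in> Q"
    have m: "Max B \<in> B" using Max_in fin B by blast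
    have "Max B \<notin> noncuts n Q"
    proof
      assume "Max B \<in> noncuts n Q"
      then obtain B' where "B' \<in> Q" "Max B \<in> B'" "Suc (Max B) \<in> B'" by (auto simp: noncuts_def)
      then have "Suc (Max B) \<in> B" using same B m by blast
      then show False using Max_ge[OF fin(1)[OF B]] by fastforce
    qed
    then show "Max B \<in> {1..n} - noncuts n Q" using m sub[OF B] by blast
  next
    fix i assume i: "i \<in> {1..n} - noncuts n Q"
    then obtain B where B: "B \<in> Q" "i \<in> B" using partition_onD1[OF part] by blast
    obtain a b where ab: "B = {a..b}" using Q B by (auto simp: linear_set_partitions_def)
    have "b \<in> B" using B(2) by (simp add: ab)
    then have "b \<le> n" using sub[OF B(1)] by auto
    have "i = b"
    proof (rule ccontr)
      assume "i \<noteq> b"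
      then have "i \<in> {1..<n}" "Suc i \<in> B" using i B(2) \<open>b \<le> n\<close> by (auto simp: ab)
      then show False using i B by (auto simp: noncuts_def)
    qed
    then have "i = Max B" using B(2) by (auto simp: ab intro!: Max_eqI[symmetric])
    then show "\<exists>B\<in>Q. i = Max B" using B by blast
  qed
  then have "card Q = card ({1..n} - noncuts n Q)" by (rule bij_betw_same_card)
  also have "\<dots> = n - card (noncuts n Q)"
    using noncuts_subset[of n Q] by (subst card_Diff_subset) auto
  finally show ?thesis .
qed

lemma lsp_le_iff:
  assumes Q: "Q \<in> linear_set_partitions n" "Q' \<in> linear_set_partitions n"
  shows "lsp_le Q Q' \<longleftrightarrow> noncuts n Q \<subseteq> noncuts n Q'"
proof
  have part: "partition_on {1..n} Q" "partition_on {1..n} Q'"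
    using Q by (simp_all add: linear_set_partitions_def)
  have same: "B = B'" if "B \<in> Q" "B' \<in> Q" "x \<in> B" "x \<in> B'" for B B' x
    using that partition_onD2[OF part(1)] by (auto simp: disjoint_def)
  assume le: "lsp_le Q Q'"
  show "noncuts n Q \<subseteq> noncuts n Q'"
  proof
    fix i assume "i \<in> noncuts n Q"
    then obtain B where i: "i \<in> {1..<n}" and B: "B \<in> Q" "i \<in> B" "Suc i \<in> B" by (auto simp: noncuts_def)
    have "i \<in> {1..n}" using i by auto
    then obtain B' where B': "B' \<in> Q'" "i \<in> B'" using partition_onD1[OF part(2)] by blast
    obtain D where D: "D \<subseteq> Q" "B' = \<Union>D" using le B' by (auto simp: lsp_le_def)
    then obtain B2 where "B2 \<in> D" "i \<in> B2" using B' by blast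
    then have "B2 = B" using same D B by blast
    then have "Suc i \<in> B'" using D \<open>B2 \<in> D\<close> B by blast
    then show "i \<in> noncuts n Q'" using i B' by (auto simp: noncuts_def)
  qed
next
  have part: "partition_on {1..n} Q" "partition_on {1..n} Q'"
    using Q by (simp_all add: linear_set_partitions_def)
  assume sub: "noncuts n Q \<subseteq> noncuts n Q'"
  show "lsp_le Q Q'"
    unfolding lsp_le_def
  proof (intro ballI exI conjI)
    fix B assume B: "B \<in> Q'"
    show "{D \<in> Q. D \<subseteq> B} \<subseteq> Q" by blast
    show "B = \<Union>{D \<in> Q. D \<subseteq> B}"
    proof (intro set_eqI iffI)
      fix x assume x: "x \<in> B"
      then have "x \<in> {1..n}" using B partition_onD1[OF part(2)] by blast
      then obtain D where D: "D \<in> Q" "x \<in> D" using partition_onD1[OF part(1)] by blast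
      have "D \<subseteq> B" using sub
        unfolding block_eq_run[OF Q(1) D] block_eq_run[OF Q(2) B x] run_def by blast
      then show "x \<in> \<Union>{D \<in> Q. D \<subseteq> B}" using D by blast
    qed blast
  qed
qed

definition Eprod :: "nat \<Rightarrow> nat set \<Rightarrow> bfree" where
  "Eprod n S = prod_list (map eF (filter (\<lambda>i. i \<in> S) [1..<n]))"

text \<open>For \<open>N\<close> inside \<open>{1..<n}\<close> this is, modulo the relations, the
  product of the e_i with i in \<open>N\<close> and the 1 - e_i with i in \<open>{1..<n}\<close>
  outside \<open>N\<close>; hence e_i acts on it as 1 or as 0.\<close>

definition Eidem :: "nat \<Rightarrow> nat set \<Rightarrow> bfree" where
  "Eidem n N = (\<Sum>S | N \<subseteq> S \<and> S \<subseteq> {1..<n}. C ((- 1) ^ (card S - card N)) * Eprod n S)"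

lemma E_J_eq: "E_J n Q = Eprod n (noncuts n Q)"
proof -
  have "concat (map (\<lambda>i. if P i then [eF i] else []) xs) = map eF (filter P xs)" for P xs
    by (induction xs) auto
  moreover have "filter (\<lambda>i. \<exists>B\<in>Q. i \<in> B \<and> Suc i \<in> B) [1..<n] = filter (\<lambda>i. i \<in> noncuts n Q) [1..<n]"
    by (rule filter_cong) (auto simp: noncuts_def)
  ultimately show ?thesis by (simp add: E_J_def Eprod_def prodF_eq)
qed

lemma EE_eq:
  assumes Q: "Q \<in> linear_set_partitions n"
  shows "EE n Q = Eidem n (noncuts n Q)"
proof -
  let ?L = "{J \<in> linear_set_partitions n. lsp_le Q J}"
  have "bij_betw (noncuts n) ?L {S. noncuts n Q \<subseteq> S \<and> S \<subseteq> {1..<n}}"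
  proof (rule bij_betw_subset[OF bij_noncuts, of ?L, THEN bij_betw_cong[THEN iffD1, rotated]])
    show "noncuts n ` ?L = {S. noncuts n Q \<subseteq> S \<and> S \<subseteq> {1..<n}}"
    proof (intro set_eqI iffI)
      fix S assume "S \<in> {S. noncuts n Q \<subseteq> S \<and> S \<subseteq> {1..<n}}"
      then have S: "noncuts n Q \<subseteq> S" "S \<subseteq> {1..<n}" by auto
      have "S = noncuts n (run n S ` {1..n})" "run n S ` {1..n} \<in> ?L"
        using runs_lsp[OF S(2)] lsp_le_iff[OF Q runs_lsp(1)[OF S(2)]] S(1) by auto
      then show "S \<in> noncuts n ` ?L" by blast
    qed (use noncuts_subset lsp_le_iff[OF Q] in auto)
  qed auto
  then have "Eidem n (noncuts n Q)
      = (\<Sum>J\<in>?L. C ((- 1) ^ (card (noncuts n J) - card (noncuts n Q))) * Eprod n (noncuts n J))"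
    unfolding Eidem_def by (rule sum.reindex_bij_betw[symmetric])
  also have "\<dots> = EE n Q"
    unfolding EE_def
  proof (rule sum.cong)
    fix J assume "J \<in> ?L"
    then have J: "J \<in> linear_set_partitions n" by simp
    \<comment> \<open>These bounds make the truncated subtractions in \<open>card_lsp\<close> exact,
      so that both signs get the same exponent.\<close>
    have "card (noncuts n Q) \<le> n" "card (noncuts n J) \<le> n"
      using card_mono[OF _ noncuts_subset[of n Q]] card_mono[OF _ noncuts_subset[of n J]] by auto
    then have "card Q - card J = card (noncuts n J) - card (noncuts n Q)"
      by (simp add: card_lsp[OF Q] card_lsp[OF J])
    then show "C ((- 1) ^ (card (noncuts n J) - card (noncuts n Q))) * Eprod n (noncuts n J)
        = smultF ((- 1) ^ (card Q - card J)) (E_J n J)"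
      by (simp add: smultF_eq E_J_eq)
  qed simp
  finally show ?thesis by simp
qed

section \<open>The corner algebras\<close>

lemma bH_relsI:
  "i \<in> {1..<n} \<Longrightarrow> eF i * eF i - eF i \<in> bH_rels n"
  "i \<in> {1..<n} \<Longrightarrow> j \<in> {1..<n} \<Longrightarrow> eF i * eF j - eF j * eF i \<in> bH_rels n"
  "i \<in> {1..<n} \<Longrightarrow> j \<in> {1..<n} \<Longrightarrow> apart i j \<Longrightarrow> zF i * zF j - zF j * zF i \<in> bH_rels n"
  "i \<in> {1..<n} \<Longrightarrow> eF i * zF i - zF i \<in> bH_rels n"
  "i \<in> {1..<n} \<Longrightarrow> j \<in> {1..<n} \<Longrightarrow> eF i * zF j - zF j * eF i \<in> bH_rels n"
  "i \<in> {1..<n} \<Longrightarrow> zF i * zF i - eF i - C (qL - qinv) * zF i \<in> bH_rels n"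
  "i \<notin> {1..<n} \<Longrightarrow> eF i \<in> bH_rels n"
  "i \<notin> {1..<n} \<Longrightarrow> zF i \<in> bH_rels n"
  unfolding bH_rels_def mulF_eq smultF_eq by blast+
lemma TL_relsI: "i \<in> {1..<n} \<Longrightarrow> j \<in> {1..<n} \<Longrightarrow> i = Suc j \<or> j = Suc i \<Longrightarrow>
  eF i * (eF j * (1 + C qL * zF i + C qL * zF j + C (qL ^ 2) * (zF i * zF j)
         + C (qL ^ 2) * (zF j * zF i) + C (qL ^ 3) * (zF i * (zF j * zF i)))) \<in> TL_rels n"
  unfolding TL_rels_def mulF_eq smultF_eq oneF_eq Suc_eq_plus1 by blast

locale bTL = tsideal +
  fixes n :: nat
  assumes J_eq: "J = bTL_ideal n"
begin

lemma rel: "x \<in> bH_rels n \<union> TL_rels n \<Longrightarrow> x \<in> J"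
  unfolding J_eq bTL_ideal_def using ideal_gen_base by blast

lemmas bH_rel = bH_relsI[THEN UnI1, THEN rel]

lemmas e_outside = bH_rel(7) and z_outside = bH_rel(8)

lemma e_idem: "eF i * eF i \<approx> eF i"
  using bH_rel(1)[of i] e_outside[of i]
  by (cases "i \<in> {1..<n}") (simp_all add: cg_def Idiff Imult_left)

lemma e_z: "i \<in> {1..<n} \<Longrightarrow> eF i * zF i \<approx> zF i"
  unfolding cg_def by (rule bH_rel(4))

lemma z_far: "apart i j \<Longrightarrow> zF i * zF j \<approx> zF j * zF i"
  using bH_rel(3)[of i j] z_outside[of i] z_outside[of j]
  by (cases "i \<in> {1..<n}"; cases "j \<in> {1..<n}") (simp_all add: cg_def Idiff Imult_left Imult_right)

lemma e_central: "eF i * x \<approx> x * eF i"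
proof (rule tsi_commutant)
  fix g
  show "eF i * genF g \<approx> genF g * eF i"
  proof (cases g)
    case (E j)
    then show ?thesis using bH_rel(2)[of i j] e_outside[of i] e_outside[of j]
      by (cases "i \<in> {1..<n}"; cases "j \<in> {1..<n}")
        (simp_all add: cg_def Idiff Imult_left Imult_right eF_genF)
  next
    case (Z j)
    then show ?thesis using bH_rel(5)[of i j] e_outside[of i] z_outside[of j]
      by (cases "i \<in> {1..<n}"; cases "j \<in> {1..<n}")
        (simp_all add: cg_def Idiff Imult_left Imult_right eF_genF zF_genF)
  qed
qed

lemma prod_e_central: "prod_list (map eF is) * x \<approx> x * prod_list (map eF is)"
  by (intro prod_list_comm e_central)

lemma e_Eprod_in:
  assumes "i \<in> S" "S \<subseteq> {1..<n}"
  shows "eF i * Eprod n S \<approx> Eprod n S"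
proof -
  have "i \<in> set (filter (\<lambda>i. i \<in> S) [1..<n])" using assms by auto
  then obtain us vs where f: "filter (\<lambda>i. i \<in> S) [1..<n] = us @ i # vs" by (metis split_list)
  let ?p = "\<lambda>us. prod_list (map eF us)"
  have "eF i * Eprod n S = eF i * ?p us * (eF i * ?p vs)" by (simp add: Eprod_def f mult.assoc del: One_nat_def)
  also have "\<dots> \<approx> ?p us * eF i * (eF i * ?p vs)" using e_central by (rule cg_right)
  also have "\<dots> = ?p us * (eF i * eF i) * ?p vs" by (simp add: mult.assoc)
  also have "\<dots> \<approx> ?p us * eF i * ?p vs" using e_idem by (intro cg_right cg_left)
  finally show ?thesis by (simp add: Eprod_def f mult.assoc del: One_nat_def)
qed

lemma e_Eprod_notin:
  assumes "i \<notin> S" "i \<in> {1..<n}"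
  shows "eF i * Eprod n S \<approx> Eprod n (insert i S)"
proof -
  have upt: "[1..<n] = [1..<i] @ i # [Suc i..<n]"
    using assms(2) by (metis Suc_leI atLeastLessThan_iff le_refl upt_conv_Cons upt_add_eq_append le_add_diff_inverse less_imp_le)
  let ?p = "\<lambda>us. prod_list (map eF us)" and ?f = "filter (\<lambda>i. i \<in> S)"
  have 1: "Eprod n S = ?p (?f [1..<i]) * ?p (?f [Suc i..<n])"
    using assms(1) by (simp add: Eprod_def upt del: One_nat_def)
  have "filter (\<lambda>k. k \<in> insert i S) [1..<i] = ?f [1..<i]"
    "filter (\<lambda>k. k \<in> insert i S) [Suc i..<n] = ?f [Suc i..<n]"
    by (rule filter_cong; auto)+
  then have 2: "Eprod n (insert i S) = ?p (?f [1..<i]) * eF i * ?p (?f [Suc i..<n])"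
    by (simp add: Eprod_def upt mult.assoc del: insert_iff One_nat_def) simp
  have "eF i * Eprod n S = eF i * ?p (?f [1..<i]) * ?p (?f [Suc i..<n])" by (simp add: 1 mult.assoc)
  also have "\<dots> \<approx> ?p (?f [1..<i]) * eF i * ?p (?f [Suc i..<n])" using e_central by (rule cg_right)
  finally show ?thesis by (simp add: 2)
qed

lemma e_Eidem_in:
  assumes "i \<in> N"
  shows "eF i * Eidem n N \<approx> Eidem n N"
  unfolding Eidem_def sum_distrib_left
proof (rule cg_sum)
  fix S assume "S \<in> {S. N \<subseteq> S \<and> S \<subseteq> {1..<n}}"
  then have "eF i * Eprod n S \<approx> Eprod n S" using e_Eprod_in assms by blast
  then show "eF i * (C ((- 1) ^ (card S - card N)) * Eprod n S) \<approx> C ((- 1) ^ (card S - card N)) * Eprod n S"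
    unfolding C_left_commute by (rule cg_left)
qed

text \<open>The sets S without i and the sets \<open>insert i S\<close> cancel in pairs:
  multiplication by e_i turns both products into \<open>Eprod n (insert i S)\<close>, with opposite
  signs.\<close>

lemma e_Eidem_notin:
  assumes "i \<notin> N"
  shows "eF i * Eidem n N \<in> J"
proof (cases "i \<in> {1..<n}")
  case False
  then show ?thesis using e_outside Imult_right by blast
next
  case i: True
  let ?A = "{S. N \<subseteq> S \<and> S \<subseteq> {1..<n} \<and> i \<notin> S}" and ?B = "{S. N \<subseteq> S \<and> S \<subseteq> {1..<n} \<and> i \<in> S}"
  let ?c = "\<lambda>S. C ((- 1) ^ (card S - card N)) :: bfree"
  let ?g = "\<lambda>S. ?c S * Eprod n S"
  have fin: "finite ?A" "finite ?B" by (rule finite_subset[of _ "Pow {1..<n}"]; auto)+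
  have "{S. N \<subseteq> S \<and> S \<subseteq> {1..<n}} = ?A \<union> ?B" by auto
  then have "Eidem n N = sum ?g ?A + sum ?g ?B"
    unfolding Eidem_def using fin by (subst sum.union_disjoint[symmetric]) auto
  also have "sum ?g ?B = (\<Sum>S\<in>?A. ?g (insert i S))"
  proof (rule sum.reindex_bij_betw[symmetric], rule bij_betwI[where g = "\<lambda>S. S - {i}"])
    show "insert i \<in> ?A \<rightarrow> ?B" using i by auto
    show "(\<lambda>S. S - {i}) \<in> ?B \<rightarrow> ?A" using assms by auto
  qed auto
  finally have eq: "eF i * Eidem n N = (\<Sum>S\<in>?A. eF i * ?g S + eF i * ?g (insert i S))"
    by (simp add: sum_distrib_left sum.distrib distrib_left)
  have "eF i * ?g S + eF i * ?g (insert i S) \<in> J" if S: "S \<in> ?A" for S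
  proof -
    have finS: "finite S" using S by (auto intro: finite_subset)
    have "card N \<le> card S" using S finS by (intro card_mono) auto
    then have sgn: "?c (insert i S) = - ?c S"
      using S finS by (simp add: Suc_diff_le C_uminus)
    have "eF i * ?g S \<approx> ?c S * Eprod n (insert i S)"
      unfolding C_left_commute using e_Eprod_notin S i by (intro cg_left) auto
    moreover have "eF i * ?g (insert i S) \<approx> ?c (insert i S) * Eprod n (insert i S)"
      unfolding C_left_commute using e_Eprod_in[of i "insert i S"] S i by (intro cg_left) auto
    ultimately have "eF i * ?g S + eF i * ?g (insert i S)
        \<approx> ?c S * Eprod n (insert i S) + ?c (insert i S) * Eprod n (insert i S)"
      by (rule cg_add)
    also have "\<dots> = 0" by (simp add: sgn)
    finally show ?thesis by (simp add: cg_0)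
  qed
  then show ?thesis unfolding eq by (rule Isum)
qed

lemma Eprod_Eidem:
  assumes "N \<subseteq> {1..<n}" "S \<subseteq> {1..<n}"
  shows "Eprod n S * Eidem n N \<approx> (if S \<subseteq> N then Eidem n N else 0)"
proof -
  have "prod_list (map eF is) * Eidem n N \<approx> (if set is \<subseteq> N then Eidem n N else 0)" for "is"
  proof (induction "is")
    case (Cons i "is")
    have "prod_list (map eF (i # is)) * Eidem n N = eF i * (prod_list (map eF is) * Eidem n N)"
      by (simp add: mult.assoc)
    also have "\<dots> \<approx> eF i * (if set is \<subseteq> N then Eidem n N else 0)" using Cons by (rule cg_left)
    also have "\<dots> \<approx> (if set (i # is) \<subseteq> N then Eidem n N else 0)"
      using e_Eidem_in[of i N] e_Eidem_notin[of i N] by (auto simp: cg_0)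
    finally show ?case .
  qed simp
  from this[of "filter (\<lambda>i. i \<in> S) [1..<n]"] show ?thesis
    using assms(2) by (auto simp: Eprod_def subset_iff split: if_splits)
qed

lemma Eidem_idem:
  assumes N: "N \<subseteq> {1..<n}"
  shows "Eidem n N * Eidem n N \<approx> Eidem n N"
proof -
  let ?A = "{S. N \<subseteq> S \<and> S \<subseteq> {1..<n}}"
  have fin: "finite ?A" by (rule finite_subset[of _ "Pow {1..<n}"]) auto
  have "Eidem n N * Eidem n N
      = (\<Sum>S\<in>?A. C ((- 1) ^ (card S - card N)) * (Eprod n S * Eidem n N))"
    unfolding Eidem_def[of n N] sum_distrib_right by (simp add: mult.assoc)
  also have "\<dots> \<approx> (\<Sum>S\<in>?A. C ((- 1) ^ (card S - card N)) * (if S \<subseteq> N then Eidem n N else 0))"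
    using N by (intro cg_sum cg_left Eprod_Eidem) auto
  also have "\<dots> = (\<Sum>S\<in>?A. if S = N then Eidem n N else 0)"
    by (rule sum.cong) auto
  also have "\<dots> = Eidem n N" using fin N by (simp add: sum.delta')
  finally show ?thesis .
qed

lemma Eidem_central: "Eidem n N * x \<approx> x * Eidem n N"
  unfolding Eidem_def sum_distrib_left sum_distrib_right
proof (rule cg_sum)
  fix S
  show "C ((- 1) ^ (card S - card N)) * Eprod n S * x \<approx> x * (C ((- 1) ^ (card S - card N)) * Eprod n S)"
    unfolding C_left_commute mult.assoc Eprod_def by (intro cg_left prod_e_central)
qed

lemma Eidem_orth:
  assumes "N \<noteq> M"
  shows "Eidem n N * Eidem n M \<in> J"
proof -
  have "Eidem n N * Eidem n M \<in> J" if i: "i \<in> N" "i \<notin> M" for N M i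
  proof -
    have "Eidem n N * Eidem n M \<approx> eF i * Eidem n N * Eidem n M"
      by (rule cg_right[OF cg_sym[OF e_Eidem_in[OF i(1)]]])
    also have "\<dots> \<approx> Eidem n N * eF i * Eidem n M" using e_central by (intro cg_right)
    also have "\<dots> = Eidem n N * (eF i * Eidem n M)" by (simp add: mult.assoc)
    finally show ?thesis using Imult_left[OF e_Eidem_notin[OF i(2)]] by (rule cg_mem)
  qed
  note * = this
  consider i where "i \<in> N" "i \<notin> M" | i where "i \<in> M" "i \<notin> N" using assms by blast
  then show ?thesis
  proof cases
    case 1
    then show ?thesis by (rule *)
  next
    case 2
    from cg_mem[OF Eidem_central *[OF this]] show ?thesis .
  qed
qed

lemma Eprod_empty: "Eprod n {} = 1"
  by (simp add: Eprod_def)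

text \<open>After exchanging the sums, the coefficient of \<open>Eprod n S\<close> is the
  alternating sum over the subsets of S, which vanishes unless S is empty. The identity holds in the
  free algebra itself.\<close>

lemma Eidem_sum: "(\<Sum>N\<in>Pow {1..<n}. Eidem n N) = 1"
proof -
  let ?P = "Pow {1..<n}"
  let ?c = "\<lambda>N S. C ((- 1) ^ (card S - card N)) :: bfree"
  have alt: "(\<Sum>N\<in>Pow S. ?c N S) = (if S = {} then 1 else 0)" if S: "finite S" for S :: "nat set"
  proof (cases "S = {}")
    case False
    then obtain i where i: "i \<in> S" by blast
    define S' where "S' = S - {i}"
    have S': "S = insert i S'" "i \<notin> S'" "finite S'" using i S by (auto simp: S'_def)
    have "(\<Sum>N\<in>Pow S. ?c N S) = (\<Sum>N\<in>Pow S'. ?c N S) + (\<Sum>N\<in>insert i ` Pow S'. ?c N S)"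
      unfolding S'(1) Pow_insert using S'(2,3) by (subst sum.union_disjoint) auto
    also have "(\<Sum>N\<in>insert i ` Pow S'. ?c N S) = (\<Sum>N\<in>Pow S'. ?c (insert i N) S)"
      using S'(2) by (subst sum.reindex) (auto simp: inj_on_def)
    also have "\<dots> = (\<Sum>N\<in>Pow S'. - ?c N S)"
    proof (rule sum.cong)
      fix N assume N: "N \<in> Pow S'"
      have "finite N" "i \<notin> N" "card N \<le> card S'" using N S' by (auto intro: finite_subset card_mono)
      then show "?c (insert i N) S = - ?c N S"
        using S' by (simp add: Suc_diff_le C_uminus)
    qed simp
    finally show ?thesis using False by (simp add: sum_negf)
  qed simp
  have "(\<Sum>N\<in>?P. Eidem n N) = (\<Sum>N\<in>?P. \<Sum>S\<in>?P. if N \<subseteq> S then ?c N S * Eprod n S else 0)"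
    unfolding Eidem_def
    by (rule sum.cong[OF refl], subst sum.inter_filter[symmetric]) (auto intro!: sum.cong)
  also have "\<dots> = (\<Sum>S\<in>?P. \<Sum>N\<in>?P. if N \<subseteq> S then ?c N S * Eprod n S else 0)"
    by (rule sum.swap)
  also have "\<dots> = (\<Sum>S\<in>?P. (\<Sum>N\<in>Pow S. ?c N S) * Eprod n S)"
    unfolding sum_distrib_right
    by (rule sum.cong[OF refl], subst sum.inter_filter[symmetric]) (auto intro!: sum.cong)
  also have "\<dots> = (\<Sum>S\<in>?P. if S = {} then Eprod n S else 0)"
    by (rule sum.cong[OF refl]) (auto simp: alt finite_subset)
  also have "\<dots> = 1" by (simp add: sum.delta Eprod_empty)
  finally show ?thesis .
qed

section \<open>Stability of the ideal under the anti-involution, and the passage to the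
  corners\<close>

lemma rel_cases:
  assumes "x \<in> bH_rels n \<union> TL_rels n"
  obtains (ee) i where "i \<in> {1..<n}" "x = eF i * eF i - eF i"
  | (ee_comm) i j where "i \<in> {1..<n}" "j \<in> {1..<n}" "x = eF i * eF j - eF j * eF i"
  | (braid) i j where "i \<in> {1..<n}" "j \<in> {1..<n}" "i = Suc j \<or> j = Suc i"
      "x = zF i * (zF j * zF i) - zF j * (zF i * zF j)"
  | (far) i j where "i \<in> {1..<n}" "j \<in> {1..<n}" "apart i j" "x = zF i * zF j - zF j * zF i"
  | (ez) i where "i \<in> {1..<n}" "x = eF i * zF i - zF i"
  | (ez_comm) i j where "i \<in> {1..<n}" "j \<in> {1..<n}" "x = eF i * zF j - zF j * eF i"
  | (zz) i where "i \<in> {1..<n}" "x = zF i * zF i - eF i - C (qL - qinv) * zF i"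
  | (e_out) i where "i \<notin> {1..<n}" "x = eF i"
  | (z_out) i where "i \<notin> {1..<n}" "x = zF i"
  | (TL) i j where "i \<in> {1..<n}" "j \<in> {1..<n}" "i = Suc j \<or> j = Suc i"
      "x = eF i * (eF j * (1 + C qL * zF i + C qL * zF j + C (qL ^ 2) * (zF i * zF j)
         + C (qL ^ 2) * (zF j * zF i) + C (qL ^ 3) * (zF i * (zF j * zF i))))"
  using assms unfolding bH_rels_def TL_rels_def mulF_eq smultF_eq oneF_eq
  apply (elim UnE CollectE exE conjE)
  subgoal by (rule ee)
  subgoal by (rule ee_comm)
  subgoal by (rule braid) simp_all
  subgoal by (rule far)
  subgoal by (rule ez)
  subgoal by (rule ez_comm)
  subgoal by (rule zz)
  subgoal by (rule e_out)
  subgoal by (rule z_out)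
  subgoal by (rule TL) simp_all
  done

lemma star_ideal: "x \<in> J \<Longrightarrow> starF x \<in> J"
proof -
  let ?S = "{x. starF x \<in> J}"
  have "bTL_ideal n \<subseteq> ?S"
    unfolding bTL_ideal_def
  proof (rule ideal_gen_least)
    show "two_sided_ideal ?S"
      by (auto simp: two_sided_ideal_iff starF_add starF_mult Iadd Imult_left Imult_right)
    show "bH_rels n \<union> TL_rels n \<subseteq> ?S"
    proof (intro subsetI CollectI)
      fix x assume x: "x \<in> bH_rels n \<union> TL_rels n"
      then have xJ: "x \<in> J" by (rule rel)
      from x show "starF x \<in> J"
      proof (cases rule: rel_cases)
        case (ee_comm i j)
        then show ?thesis using e_central[of j "eF i"] by (simp add: starF_diff starF_mult cg_def)
      next
        case (far i j)
        then have "zF j * zF i \<approx> zF i * zF j" using z_far by blast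
        then show ?thesis using far by (simp add: starF_diff starF_mult cg_def)
      next
        case (ez i)
        have "zF i * eF i \<approx> zF i" using cg_trans[OF cg_sym[OF e_central] e_z] ez by blast
        then show ?thesis using ez by (simp add: starF_diff starF_mult cg_def)
      next
        case (ez_comm i j)
        then show ?thesis using cg_sym[OF e_central[of i "zF j"]]
          by (simp add: starF_diff starF_mult cg_def)
      next
        case (TL i j)
        let ?t = "1 + C qL * zF i + C qL * zF j + C (qL ^ 2) * (zF i * zF j)
         + C (qL ^ 2) * (zF j * zF i) + C (qL ^ 3) * (zF i * (zF j * zF i))"
        \<comment> \<open>The anti-involution fixes the palindromes and exchanges z_i z_j with z_j
          z_i, which have the same coefficient. The central factors e_i and e_j can be moved back to
          the front.\<close>
        have "starF ?t = ?t"
          by (simp add: starF_add starF_mult C_commute[of "zF _"] C_left_commute[of "zF _"] mult.assoc)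
        then have "starF x = ?t * eF j * eF i"
          using TL by (simp add: starF_mult)
        also have "\<dots> \<approx> eF i * (?t * eF j)" by (rule cg_sym[OF e_central])
        also have "\<dots> \<approx> eF i * (eF j * ?t)" by (intro cg_left cg_sym[OF e_central])
        also have "\<dots> = x" using TL by simp
        finally show ?thesis using xJ cg_mem by blast
      qed (use xJ in \<open>simp_all add: starF_diff starF_mult mult.assoc C_commute[of "zF _"]\<close>)
    qed
  qed
  then show "x \<in> J \<Longrightarrow> starF x \<in> J" using J_eq by blast
qed

lemma starF_Eidem: "starF (Eidem n N) \<approx> Eidem n N"
proof -
  have "prod_list (rev (map eF is)) \<approx> prod_list (map eF is)" for "is"
    unfolding rev_map by (intro prod_list_rev_comm e_central)
  then have "starF (Eprod n S) \<approx> Eprod n S" for S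
    by (simp add: Eprod_def starF_prod_list comp_def)
  then show ?thesis
    unfolding Eidem_def starF_sum starF_mult starF_C C_commute by (intro cg_sum cg_left)
qed

text \<open>Since the idempotent is central, \<open>e A\<close> is the quotient of \<open>A\<close> by the annihilator of \<open>e\<close>; so the
  corner algebra is the free algebra modulo the following ideal.\<close>

definition corner :: "nat set \<Rightarrow> bfree set" where
  "corner N = {x. Eidem n N * x \<in> J}"

lemma corner_star:
  assumes "x \<in> corner N"
  shows "starF x \<in> corner N"
proof -
  have "starF x * starF (Eidem n N) \<in> J"
    using star_ideal[of "Eidem n N * x"] assms by (simp add: corner_def starF_mult)
  moreover have "Eidem n N * starF x \<approx> starF x * starF (Eidem n N)"
    using cg_trans[OF Eidem_central cg_left[OF cg_sym[OF starF_Eidem]]] .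
  ultimately show ?thesis unfolding corner_def using cg_mem by blast
qed

lemma corner_TL_corner:
  assumes N: "N \<subseteq> {1..<n}"
  shows "TL_corner (corner N) N"
proof -
  let ?e = "Eidem n N"
  have J_corner: "x \<in> corner N" if "x \<in> J" for x using that by (simp add: corner_def Imult_left)
  interpret c: tsideal "corner N"
  proof
    have "?e * (a * x) \<in> J" if "?e * x \<in> J" for a x
    proof (rule cg_mem)
      show "?e * (a * x) \<approx> a * (?e * x)"
        using cg_right[OF Eidem_central, of N a x] by (simp add: mult.assoc)
    qed (use that Imult_left in blast)
    moreover have "?e * (x * a) \<in> J" if "?e * x \<in> J" for a x
      using Imult_right[OF that, of a] by (simp add: mult.assoc)
    ultimately show "two_sided_ideal (corner N)"
      by (auto simp: two_sided_ideal_iff corner_def distrib_left Iadd)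
  qed
  have Jc: "c.cg x y" if "x \<approx> y" for x y
    using that J_corner by (simp add: cg_def c.cg_def)
  have e_in: "c.cg (eF i) 1" if "i \<in> N" for i
    using cg_trans[OF cg_sym[OF e_central] e_Eidem_in[OF that]]
    unfolding c.cg_def cg_def by (simp add: corner_def algebra_simps)
  have e_out: "eF i \<in> corner N" if "i \<notin> N" for i
    using cg_mem[OF cg_sym[OF e_central] e_Eidem_notin[OF that]] by (simp add: corner_def)
  show ?thesis
  proof
    show "c.cg (eF i) 1" if "i \<in> N" for i using e_in that .
    show "eF i \<in> corner N" if "i \<notin> N" for i using e_out that .
    show "zF i \<in> corner N" if "i \<notin> N" for i
    proof (cases "i \<in> {1..<n}")
      case True
      then show ?thesis using c.cg_mem[OF Jc[OF cg_sym[OF e_z]]] c.Imult_right[OF e_out[OF that]] by blast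
    next
      case False
      then show ?thesis using z_outside J_corner by blast
    qed
    show "c.cg (zF i * zF i) (1 + C (qL - qinv) * zF i)" if "i \<in> N" for i
    proof -
      have "c.cg (zF i * zF i) (eF i + C (qL - qinv) * zF i)"
        using J_corner[OF bH_rel(6), of i] that N by (auto simp: c.cg_def algebra_simps)
      also have "c.cg \<dots> (1 + C (qL - qinv) * zF i)" using e_in[OF that] by (intro c.cg_add) auto
      finally show ?thesis .
    qed
    show "c.cg (zF i * zF j) (zF j * zF i)" if "apart i j" for i j
      using z_far[OF that] by (rule Jc)
    show "starF x \<in> corner N" if "x \<in> corner N" for x using corner_star that .
    show "1 + C qL * zF i + C qL * zF j + C (qL ^ 2) * (zF i * zF j) + C (qL ^ 2) * (zF j * zF i)
        + C (qL ^ 3) * (zF i * (zF j * zF i)) \<in> corner N" (is "?t \<in> _")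
      if ij: "i \<in> N" "j \<in> N" "i = Suc j \<or> j = Suc i" for i j
    proof -
      have "eF i * (eF j * ?t) \<in> J"
        using ij N by (intro rel UnI2 TL_relsI) auto
      then have "eF i * (eF j * ?t) \<in> corner N" by (rule J_corner)
      moreover have "c.cg ?t (eF i * (eF j * ?t))"
        using c.cg_mult[OF c.cg_sym[OF e_in[OF ij(1)]] c.cg_mult[OF c.cg_sym[OF e_in[OF ij(2)]] c.cg_refl]]
        by simp
      ultimately show ?thesis using c.cg_mem by blast
    qed
  qed
qed

end

section \<open>Compositions and two-column multitableaux\<close>

definition off :: "nat list \<Rightarrow> nat \<Rightarrow> nat" where "off p k = sum_list (take k p)"

lemma off_Suc: "k < length p \<Longrightarrow> off p (Suc k) = off p k + p ! k"
  by (simp add: off_def take_Suc_conv_app_nth)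

lemma off_length [simp]: "off p (length p) = sum_list p"
  by (simp add: off_def)

lemma off_mono: "k \<le> l \<Longrightarrow> off p k \<le> off p l"
proof -
  assume "k \<le> l"
  then have "take l p = take k p @ drop k (take l p)" by (metis append_take_drop_id min.absorb1 take_take)
  then show ?thesis unfolding off_def by (metis le_add1 sum_list_append)
qed

lemma off_le: "off p k \<le> sum_list p"
  unfolding off_def by (metis append_take_drop_id le_add1 sum_list_append)

lemma off_locate: "x < sum_list p \<Longrightarrow> \<exists>k<length p. off p k \<le> x \<and> x < off p (Suc k)"
proof (induction p rule: rev_induct)
  case (snoc y p)
  have o: "off (p @ [y]) k = off p k" if "k \<le> length p" for k using that by (simp add: off_def)
  show ?case
  proof (cases "x < sum_list p")
    case True
    then obtain k where k: "k < length p" "off p k \<le> x" "x < off p (Suc k)" using snoc.IH by blast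
    then show ?thesis using o[of k] o[of "Suc k"] by (intro exI[of _ k]) auto
  next
    case False
    then show ?thesis using snoc.prems o[of "length p"]
      by (intro exI[of _ "length p"]) (auto simp: off_def)
  qed
qed simp

lemma off_unique:
  assumes "off p k \<le> x" "x < off p (Suc k)" "off p l \<le> x" "x < off p (Suc l)"
  shows "k = l"
proof -
  have "\<not> k < l" "\<not> l < k"
    using assms off_mono[of "Suc k" l p] off_mono[of "Suc l" k p] by auto
  then show ?thesis by simp
qed

text \<open>The encoding of \<open>lsp_of_comp mu\<close> by its uncut positions, read directly off
  the partial sums.\<close>

definition ncut :: "nat list \<Rightarrow> nat set" where
  "ncut mu = {i. \<exists>k<length mu. off mu k < i \<and> i < off mu (Suc k)}"

lemma ncut_less: "i \<in> ncut mu \<Longrightarrow> 0 < i \<and> i < sum_list mu"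
  using off_le[of mu] by (auto simp: ncut_def) (meson less_le_trans)

lemma ncut_subset: "mu \<in> compositions n \<Longrightarrow> ncut mu \<subseteq> {1..<n}"
  using ncut_less[of _ mu] by (force simp: compositions_def)

lemma lsp_of_comp:
  assumes mu: "mu \<in> compositions n"
  shows "lsp_of_comp mu \<in> linear_set_partitions n" "noncuts n (lsp_of_comp mu) = ncut mu"
proof -
  have pos: "off mu k < off mu (Suc k)" if "k < length mu" for k
    using that mu by (simp add: off_Suc compositions_def)
  have sum: "sum_list mu = n" using mu by (simp add: compositions_def)
  have lsp: "lsp_of_comp mu = (\<lambda>k. {off mu k + 1..off mu (Suc k)}) ` {..<length mu}"
    by (auto simp: lsp_of_comp_def off_def)
  have "partition_on {1..n} (lsp_of_comp mu)"
    unfolding lsp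
  proof (rule partition_onI)
    show "\<Union> ((\<lambda>k. {off mu k + 1..off mu (Suc k)}) ` {..<length mu}) = {1..n}"
    proof (intro set_eqI iffI)
      fix i assume "i \<in> {1..n}"
      then have "i - 1 < sum_list mu" using sum by auto
      from off_locate[OF this] \<open>i \<in> {1..n}\<close>
      show "i \<in> \<Union> ((\<lambda>k. {off mu k + 1..off mu (Suc k)}) ` {..<length mu})"
        by (fastforce simp: less_eq_Suc_le)
    next
      fix i assume "i \<in> \<Union> ((\<lambda>k. {off mu k + 1..off mu (Suc k)}) ` {..<length mu})"
      then obtain k where "off mu k + 1 \<le> i" "i \<le> off mu (Suc k)" by auto
      then show "i \<in> {1..n}" using off_le[of mu "Suc k"] sum by simp
    qed
    show "disjnt A B" if AB: "A \<in> (\<lambda>k. {off mu k + 1..off mu (Suc k)}) ` {..<length mu}"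
      "B \<in> (\<lambda>k. {off mu k + 1..off mu (Suc k)}) ` {..<length mu}" "A \<noteq> B" for A B
    proof -
      obtain k l where kl: "A = {off mu k + 1..off mu (Suc k)}" "B = {off mu l + 1..off mu (Suc l)}"
        using AB by auto
      have "False" if "i \<in> A" "i \<in> B" for i
      proof -
        have "k = l" by (rule off_unique[of mu k "i - 1" l]) (use that in \<open>auto simp: kl\<close>)
        then show False using AB(3) kl by simp
      qed
      then show ?thesis by (auto simp: disjnt_def)
    qed
  qed (use pos in fastforce)
  then show "lsp_of_comp mu \<in> linear_set_partitions n"
    by (auto simp: linear_set_partitions_def lsp)
  show "noncuts n (lsp_of_comp mu) = ncut mu"
  proof (intro set_eqI iffI)
    fix i assume i: "i \<in> ncut mu"
    then have "i \<in> {1..<n}" using ncut_subset[OF mu] by blast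
    then show "i \<in> noncuts n (lsp_of_comp mu)" using i
      by (auto simp: noncuts_def lsp ncut_def less_eq_Suc_le)
  qed (auto simp: noncuts_def lsp ncut_def less_eq_Suc_le)
qed

lemma ncut_snoc: "ncut (mu @ [x]) = ncut mu \<union> {sum_list mu<..<sum_list mu + x}"
proof -
  have "off (mu @ [x]) k = off mu k" if "k \<le> length mu" for k using that by (simp add: off_def)
  moreover have "off (mu @ [x]) (Suc (length mu)) = sum_list mu + x" by (simp add: off_def)
  ultimately show ?thesis
    unfolding ncut_def by (auto simp: less_Suc_eq)
qed

text \<open>The cut in front of the last part is the largest number below n that is missing from the
  set, or 0; so the last part is determined and can be removed.\<close>

lemma ncut_inj:
  "mu \<in> compositions n \<Longrightarrow> nu \<in> compositions n \<Longrightarrow> ncut mu = ncut nu \<Longrightarrow> mu = nu"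
proof (induction mu arbitrary: nu n rule: rev_induct)
  case Nil
  then show ?case by (cases nu) (auto simp: compositions_def)
next
  case (snoc x mu)
  have sum: "sum_list mu + x = n" "x > 0" and mu: "mu \<in> compositions (sum_list mu)"
    using snoc.prems by (auto simp: compositions_def)
  have "nu \<noteq> []" using snoc.prems(2) sum by (auto simp: compositions_def)
  then obtain nu' y where nu: "nu = nu' @ [y]" by (metis rev_exhaust)
  have sum': "sum_list nu' + y = n" "y > 0" and nu': "nu' \<in> compositions (sum_list nu')"
    using snoc.prems(2) by (auto simp: compositions_def nu)
  have eq: "ncut mu \<union> {sum_list mu<..<n} = ncut nu' \<union> {sum_list nu'<..<n}"
    using snoc.prems(3) sum sum' by (simp add: ncut_snoc nu)
  have s: "sum_list mu = sum_list nu'"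
  proof (rule ccontr)
    assume "sum_list mu \<noteq> sum_list nu'"
    then consider "sum_list mu < sum_list nu'" | "sum_list nu' < sum_list mu" by linarith
    then show False
    proof cases
      case 1
      then have "sum_list nu' \<in> ncut nu' \<union> {sum_list nu'<..<n}" using eq sum' by auto
      then show False using ncut_less[of _ nu'] by auto
    next
      case 2
      then have "sum_list mu \<in> ncut mu \<union> {sum_list mu<..<n}" using eq sum by auto
      then show False using ncut_less[of _ mu] by auto
    qed
  qed
  have "ncut mu = ncut nu'"
  proof -
    have "ncut mu = (ncut mu \<union> {sum_list mu<..<n}) \<inter> {..<sum_list mu}" using ncut_less[of _ mu] by force
    also have "\<dots> = (ncut nu' \<union> {sum_list nu'<..<n}) \<inter> {..<sum_list nu'}" using eq s by simp
    also have "\<dots> = ncut nu'" using ncut_less[of _ nu'] by force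
    finally show ?thesis .
  qed
  then have "mu = nu'" using snoc.IH[OF mu] nu' s by simp
  then show ?case using s sum sum' nu by simp
qed

text \<open>From n to n + 1, either the last part grows by one or a part 1 is appended, according to
  whether n is in the set.\<close>

lemma ncut_surj: "N \<subseteq> {1..<n} \<Longrightarrow> \<exists>mu\<in>compositions n. ncut mu = N"
proof (induction n arbitrary: N)
  case 0
  then show ?case by (intro bexI[of _ "[]"]) (auto simp: compositions_def ncut_def)
next
  case (Suc n)
  have "N \<inter> {1..<n} \<subseteq> {1..<n}" by blast
  then obtain mu where mu: "mu \<in> compositions n" "ncut mu = N \<inter> {1..<n}" using Suc.IH by blast
  have sum: "sum_list mu = n" using mu by (simp add: compositions_def)
  show ?case
  proof (cases "n \<in> N")
    case True
    then have "mu \<noteq> []" using Suc.prems sum by auto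
    then obtain nu x where nu: "mu = nu @ [x]" by (metis rev_exhaust)
    have "nu @ [Suc x] \<in> compositions (Suc n)" using mu nu by (auto simp: compositions_def)
    moreover have "ncut (nu @ [Suc x]) = insert n (ncut mu)"
      using sum mu(1) by (auto simp: ncut_snoc nu compositions_def)
    moreover have "insert n (N \<inter> {1..<n}) = N" using True Suc.prems by auto
    ultimately show ?thesis using mu(2) by metis
  next
    case False
    have "mu @ [1] \<in> compositions (Suc n)" using mu by (auto simp: compositions_def)
    moreover have "ncut (mu @ [1]) = ncut mu" by (auto simp: ncut_snoc)
    moreover have "N \<inter> {1..<n} = N" using False Suc.prems by (force simp: less_Suc_eq)
    ultimately show ?thesis using mu(2) by metis
  qed
qed

lemma bij_ncut: "bij_betw ncut (compositions n) (Pow {1..<n})"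
proof (rule bij_betw_imageI)
  show "inj_on ncut (compositions n)" by (rule inj_onI) (rule ncut_inj)
  show "ncut ` compositions n = Pow {1..<n}"
  proof (intro set_eqI iffI)
    fix N assume "N \<in> Pow {1..<n}"
    then obtain mu where "mu \<in> compositions n" "ncut mu = N" using ncut_surj by (meson PowD)
    then show "N \<in> ncut ` compositions n" by blast
  qed (use ncut_subset in blast)
qed

section \<open>Two-column shapes and their tableaux of the initial kind\<close>

locale two_col =
  fixes n :: nat and lam :: "nat list list"
  assumes lam: "lam \<in> MPar2 n"
begin

abbreviation "nd \<equiv> nodes lam"
abbreviation "mu \<equiv> comp_of lam"
abbreviation "\<tau> \<equiv> t_lam lam"
abbreviation "T \<equiv> T_init lam"

lemma sum_mu: "sum_list mu = n"
  using lam by (simp add: MPar2_def multipartitions_def comp_of_def)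

lemma length_mu [simp]: "length mu = length lam"
  by (simp add: comp_of_def)

lemma mu_nth: "k < length lam \<Longrightarrow> mu ! k = sum_list (lam ! k)"
  by (simp add: comp_of_def)

lemma row: "k < length lam \<Longrightarrow> r < length (lam ! k) \<Longrightarrow> lam ! k ! r = 1 \<or> lam ! k ! r = 2"
  using lam by (fastforce simp: MPar2_def multipartitions_def dest: nth_mem)

lemma row_antimono: "k < length lam \<Longrightarrow> r \<le> r' \<Longrightarrow> r' < length (lam ! k) \<Longrightarrow> lam ! k ! r' \<le> lam ! k ! r"
  using lam by (cases "r = r'") (auto simp: MPar2_def multipartitions_def sorted_wrt_iff_nth_less dest!: nth_mem)

lemma mu_comp: "mu \<in> compositions n"
proof -
  have "0 < sum_list p" if "p \<in> set lam" for p
  proof -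
    have "p \<noteq> []" "\<forall>x\<in>set p. 0 < x" using that lam by (auto simp: MPar2_def multipartitions_def)
    then show ?thesis by (cases p) auto
  qed
  then show ?thesis using sum_mu by (auto simp: compositions_def comp_of_def)
qed

lemma nd_iff: "(k, r, c) \<in> nd \<longleftrightarrow> k < length lam \<and> r < length (lam ! k) \<and> c < lam ! k ! r"
  by (simp add: nodes_def)

lemma tau: "(k, r, c) \<in> nd \<Longrightarrow> \<tau> (k, r, c) = off mu k + off (lam ! k) r + c + 1"
  by (simp add: t_lam_def off_def)

lemma tau_row: "(k, r, c) \<in> nd \<Longrightarrow> off mu k + off (lam ! k) r < \<tau> (k, r, c) \<and>
    \<tau> (k, r, c) \<le> off mu k + off (lam ! k) (Suc r)"
  by (simp add: tau nd_iff off_Suc)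

lemma tau_block:
  assumes "(k, r, c) \<in> nd"
  shows "off mu k < \<tau> (k, r, c) \<and> \<tau> (k, r, c) \<le> off mu (Suc k)"
  using tau_row[OF assms] off_le[of "lam ! k" "Suc r"] assms
  by (simp add: off_Suc mu_nth nd_iff)

lemma tau_less:
  assumes "(k, r, c) \<in> nd" "(k', r', c') \<in> nd"
  shows "\<tau> (k, r, c) < \<tau> (k', r', c') \<longleftrightarrow> k < k' \<or> k = k' \<and> (r < r' \<or> r = r' \<and> c < c')"
proof -
  have lt: "\<tau> (k, r, c) < \<tau> (k', r', c')"
    if "(k, r, c) \<in> nd" "(k', r', c') \<in> nd" "k < k' \<or> k = k' \<and> (r < r' \<or> r = r' \<and> c < c')"
    for k r c k' r' c'
  proof -
    consider "k < k'" | "k = k'" "r < r'" | "k = k'" "r = r'" "c < c'" using \<open>k < k' \<or> _\<close> by blast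
    then show ?thesis
    proof cases
      case 1
      then show ?thesis using tau_block[OF that(1)] tau_block[OF that(2)] off_mono[of "Suc k" k' mu]
        by simp
    next
      case 2
      then show ?thesis using tau_row[OF that(1)] tau_row[OF that(2)] off_mono[of "Suc r" r' "lam ! k"]
        by simp
    next
      case 3
      then show ?thesis using tau[OF that(1)] tau[OF that(2)] by simp
    qed
  qed
  show ?thesis
    using lt[OF assms] lt[OF assms(2,1)] by (metis less_asym linorder_neqE_nat)
qed

lemma bij_tau: "bij_betw \<tau> nd {1..n}"
  unfolding bij_betw_def
proof (intro conjI set_eqI iffI)
  show "inj_on \<tau> nd"
  proof (rule inj_onI)
    fix x y assume xy: "x \<in> nd" "y \<in> nd" "\<tau> x = \<tau> y"
    obtain k r c k' r' c' where x: "x = (k, r, c)" and y: "y = (k', r', c')" by (metis prod_cases3)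
    have n: "\<not> (k < k' \<or> k = k' \<and> (r < r' \<or> r = r' \<and> c < c'))"
      "\<not> (k' < k \<or> k' = k \<and> (r' < r \<or> r' = r \<and> c' < c))"
      using tau_less[of k r c k' r' c'] tau_less[of k' r' c' k r c] xy unfolding x y by simp_all
    have k: "k = k'" using n by (meson linorder_neqE_nat)
    have r: "r = r'" using n unfolding k by (meson linorder_neqE_nat)
    have "c = c'" using n unfolding k r by (meson linorder_neqE_nat)
    then show "x = y" using x y k r by simp
  qed
next
  fix i assume "i \<in> \<tau> ` nd"
  then obtain k r c where "(k, r, c) \<in> nd" "i = \<tau> (k, r, c)" by auto
  then show "i \<in> {1..n}" using tau_block[of k r c] off_le[of mu "Suc k"] sum_mu by auto
next
  fix i assume i: "i \<in> {1..n}"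
  then have "i - 1 < sum_list mu" using sum_mu by auto
  then obtain k where k: "k < length lam" "off mu k \<le> i - 1" "i - 1 < off mu (Suc k)"
    using off_locate[of "i - 1" mu] by auto
  then have "i - 1 - off mu k < sum_list (lam ! k)" by (simp add: off_Suc mu_nth)
  then obtain r where r: "r < length (lam ! k)" "off (lam ! k) r \<le> i - 1 - off mu k"
    "i - 1 - off mu k < off (lam ! k) (Suc r)" using off_locate by blast
  let ?c = "i - 1 - off mu k - off (lam ! k) r"
  have nd: "(k, r, ?c) \<in> nd" using k(1) r by (simp add: nd_iff off_Suc)
  have "i = \<tau> (k, r, ?c)" using i k r tau[OF nd] unfolding atLeastAtMost_iff by linarith
  then show "i \<in> \<tau> ` nd" using nd by blast
qed

lemma finite_nd: "finite nd"
  using bij_betw_finite[OF bij_tau] by simp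

lemma image_comp_nodes:
  assumes t: "bij_betw t nd {1..n}"
    and b: "\<And>k r c. (k, r, c) \<in> nd \<Longrightarrow> off mu k < t (k, r, c) \<and> t (k, r, c) \<le> off mu (Suc k)"
    and k: "k < length lam"
  shows "t ` comp_nodes lam k = {off mu k<..off mu (Suc k)}"
proof (intro set_eqI iffI)
  fix i assume "i \<in> {off mu k<..off mu (Suc k)}"
  then have i: "off mu k < i" "i \<le> off mu (Suc k)" by auto
  then have "i \<in> t ` nd" using t off_le[of mu "Suc k"] sum_mu by (auto simp: bij_betw_def)
  then obtain k' r c where x: "(k', r, c) \<in> nd" "i = t (k', r, c)" by auto
  then have "k' = k" using b[OF x(1)] i by (intro off_unique[of mu _ "i - 1"]) auto
  then show "i \<in> t ` comp_nodes lam k" using x by (auto simp: comp_nodes_def)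
qed (use b in \<open>auto simp: comp_nodes_def\<close>)

text \<open>A bijection onto \<open>{1..n}\<close> that sends each component into its interval fills
  the intervals, so being of the initial kind is a matter of bounds.\<close>

lemma T_iff:
  "t \<in> T \<longleftrightarrow> standard_tab lam t \<and>
    (\<forall>k r c. (k, r, c) \<in> nd \<longrightarrow> off mu k < t (k, r, c) \<and> t (k, r, c) \<le> off mu (Suc k))"
proof -
  have 1: "off mu k < t (k, r, c) \<and> t (k, r, c) \<le> off mu (Suc k)"
    if "\<forall>k<length lam. t ` comp_nodes lam k = \<tau> ` comp_nodes lam k" "(k, r, c) \<in> nd" for k r c
  proof -
    have "k < length lam" "(k, r, c) \<in> comp_nodes lam k" using that(2) by (auto simp: nd_iff comp_nodes_def)
    then have "t (k, r, c) \<in> {off mu k<..off mu (Suc k)}"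
      using image_comp_nodes[OF bij_tau tau_block] that(1) by blast
    then show ?thesis by simp
  qed
  show ?thesis
  proof
    assume "t \<in> T"
    then show "standard_tab lam t \<and>
        (\<forall>k r c. (k, r, c) \<in> nd \<longrightarrow> off mu k < t (k, r, c) \<and> t (k, r, c) \<le> off mu (Suc k))"
      using 1 unfolding T_init_def by blast
  next
    assume t: "standard_tab lam t \<and>
        (\<forall>k r c. (k, r, c) \<in> nd \<longrightarrow> off mu k < t (k, r, c) \<and> t (k, r, c) \<le> off mu (Suc k))"
    then have "bij_betw t nd {1..n}" using sum_mu by (simp add: standard_tab_def)
    then have "t ` comp_nodes lam k = \<tau> ` comp_nodes lam k" if "k < length lam" for k
      using image_comp_nodes[of t k] image_comp_nodes[OF bij_tau tau_block] that t by simp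
    then show "t \<in> T" using t by (simp add: T_init_def)
  qed
qed

lemma standard_bij: "standard_tab lam t \<Longrightarrow> bij_betw t nd {1..n}"
  using sum_mu by (simp add: standard_tab_def)

lemma tau_T: "\<tau> \<in> T"
proof -
  have left: "(k, r, c) \<in> nd" if "(k, r, Suc c) \<in> nd" for k r c using that by (simp add: nd_iff)
  have above: "(k, r, c) \<in> nd" if "(k, Suc r, c) \<in> nd" for k r c
    using that row_antimono[of k r "Suc r"] by (auto simp: nd_iff)
  have "standard_tab lam \<tau>"
    unfolding standard_tab_def
  proof (intro conjI allI impI)
    show "bij_betw \<tau> nd {1..sum_list mu}" using bij_tau sum_mu by simp
    show "\<tau> x = 0" if "x \<notin> nd" for x using that by (cases x) (simp add: t_lam_def)
    show "\<tau> (k, r, c) < \<tau> (k, r, Suc c)" if "(k, r, Suc c) \<in> nd" for k r c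
      using tau_less[OF left[OF that] that] by simp
    show "\<tau> (k, r, c) < \<tau> (k, Suc r, c)" if "(k, Suc r, c) \<in> nd" for k r c
      using tau_less[OF above[OF that] that] by simp
  qed
  then show ?thesis using tau_block by (simp add: T_iff)
qed

end

definition cw :: "nat list list \<Rightarrow> (nat \<times> nat \<times> nat \<Rightarrow> nat) \<Rightarrow> nat \<Rightarrow> bool" where
  "cw lam t i \<longleftrightarrow> (\<exists>k r. (k, r, 1) \<in> nodes lam \<and> t (k, r, 1) = i)"

definition pairs :: "nat list list \<Rightarrow> nat set" where
  "pairs lam = {j. \<exists>k r. (k, r, 1) \<in> nodes lam \<and> t_lam lam (k, r, 0) = j}"

definition block :: "nat list \<Rightarrow> nat \<Rightarrow> nat set" where
  "block mu k = {off mu k<..off mu (Suc k)}"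

lemma block_swap:
  assumes "i \<in> ncut mu"
  shows "adj_swap i a \<in> block mu k \<longleftrightarrow> a \<in> block mu k"
proof -
  obtain l where l: "off mu l < i" "i < off mu (Suc l)" using assms by (auto simp: ncut_def)
  have "i \<in> block mu k \<longleftrightarrow> k = l" "Suc i \<in> block mu k \<longleftrightarrow> k = l"
    using l off_unique[of mu k "i - 1" l] off_unique[of mu k i l] by (auto simp: block_def)
  then show ?thesis by (auto simp: adj_swap_def)
qed

lemma cw_swap: "cw lam (adj_swap i \<circ> t) k \<longleftrightarrow> cw lam t (adj_swap i k)"
  unfolding cw_def comp_def by (metis adj_swap_simps(3))

context two_col
begin

lemma nd_c: "(k, r, c) \<in> nd \<Longrightarrow> c = 0 \<or> c = 1"
  using row[of k r] by (auto simp: nd_iff)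

lemma nd_0: "(k, r, c) \<in> nd \<Longrightarrow> (k, r, 0) \<in> nd"
  by (simp add: nd_iff)

lemma nd_up: "(k, r', c) \<in> nd \<Longrightarrow> r \<le> r' \<Longrightarrow> (k, r, c) \<in> nd"
  using row_antimono[of k r r'] by (auto simp: nd_iff)

lemma nd_1: "(k, r, 1) \<in> nd \<longleftrightarrow> k < length lam \<and> r < length (lam ! k) \<and> lam ! k ! r = 2"
  using row[of k r] by (auto simp: nd_iff)

lemma T_std: "t \<in> T \<Longrightarrow> standard_tab lam t"
  by (simp add: T_iff)

lemma T_bij: "t \<in> T \<Longrightarrow> bij_betw t nd {1..n}"
  by (rule standard_bij[OF T_std])

lemma T_zero: "t \<in> T \<Longrightarrow> x \<notin> nd \<Longrightarrow> t x = 0"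
  using T_std unfolding standard_tab_def by blast

lemma T_inj: "t \<in> T \<Longrightarrow> x \<in> nd \<Longrightarrow> y \<in> nd \<Longrightarrow> t x = t y \<Longrightarrow> x = y"
  using T_bij by (meson bij_betw_def inj_onD)

lemma T_range: "t \<in> T \<Longrightarrow> x \<in> nd \<Longrightarrow> t x \<in> {1..n}"
  using T_bij by (meson bij_betw_apply)

lemma T_node: "t \<in> T \<Longrightarrow> i \<in> {1..n} \<Longrightarrow> \<exists>k r c. (k, r, c) \<in> nd \<and> t (k, r, c) = i"
proof -
  assume "t \<in> T" "i \<in> {1..n}"
  then have "i \<in> t ` nd" using T_bij by (metis bij_betw_def)
  then show ?thesis by auto
qed

lemma T_bounds: "t \<in> T \<Longrightarrow> (k, r, c) \<in> nd \<Longrightarrow> off mu k < t (k, r, c) \<and> t (k, r, c) \<le> off mu (Suc k)"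
  by (simp add: T_iff)

lemma T_block: "t \<in> T \<Longrightarrow> (k, r, c) \<in> nd \<Longrightarrow> t (k, r, c) \<in> block mu l \<longleftrightarrow> l = k"
proof -
  assume "t \<in> T" "(k, r, c) \<in> nd"
  then have b: "off mu k < t (k, r, c)" "t (k, r, c) \<le> off mu (Suc k)" by (auto simp: T_iff)
  then show ?thesis using off_unique[of mu l "t (k, r, c) - 1" k] by (auto simp: block_def)
qed

lemma T_row: "t \<in> T \<Longrightarrow> (k, r, Suc c) \<in> nd \<Longrightarrow> t (k, r, c) < t (k, r, Suc c)"
  using T_std by (simp add: standard_tab_def)

lemma T_col: "t \<in> T \<Longrightarrow> r < r' \<Longrightarrow> (k, r', c) \<in> nd \<Longrightarrow> t (k, r, c) < t (k, r', c)"
proof (induction r')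
  case (Suc r')
  have "t (k, r', c) < t (k, Suc r', c)" using T_std Suc.prems by (simp add: standard_tab_def)
  moreover have "(k, r', c) \<in> nd" using nd_up[OF Suc.prems(3)] by simp
  ultimately show ?case using Suc by (cases "r = r'") auto
qed simp

lemma ncut_range: "i \<in> ncut mu \<Longrightarrow> i \<in> {1..<n}"
  using ncut_subset[OF mu_comp] by blast

text \<open>The swap reverses no order relation except that of i and i + 1, so standardness fails
  only if these are neighbours in a row or a column; i in \<open>ncut mu\<close> keeps the entries
  in their components.\<close>

lemma swap_T:
  assumes t: "t \<in> T" and i: "i \<in> ncut mu"
    and no: "\<And>k r c. (k, r, Suc c) \<in> nd \<Longrightarrow> \<not> (t (k, r, c) = i \<and> t (k, r, Suc c) = Suc i)"
      "\<And>k r c. (k, Suc r, c) \<in> nd \<Longrightarrow> \<not> (t (k, r, c) = i \<and> t (k, Suc r, c) = Suc i)"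
  shows "adj_swap i \<circ> t \<in> T"
proof -
  have lt: "adj_swap i a < adj_swap i b" if "a < b" "\<not> (a = i \<and> b = Suc i)" for a b
    using that by (auto simp: adj_swap_def)
  have "standard_tab lam (adj_swap i \<circ> t)"
    unfolding standard_tab_def
  proof (intro conjI allI impI)
    show "bij_betw (adj_swap i \<circ> t) nd {1..sum_list mu}"
      using bij_betw_trans[OF T_bij[OF t] permutes_imp_bij[OF adj_swap_permutes[OF ncut_range[OF i]]]] sum_mu
      by simp
    show "(adj_swap i \<circ> t) x = 0" if "x \<notin> nd" for x
      using T_zero[OF t that] ncut_range[OF i] by (simp add: adj_swap_def)
    show "(adj_swap i \<circ> t) (k, r, c) < (adj_swap i \<circ> t) (k, r, Suc c)" if "(k, r, Suc c) \<in> nd" for k r c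
      using T_row[OF t that] no(1)[OF that] by (simp add: lt)
    show "(adj_swap i \<circ> t) (k, r, c) < (adj_swap i \<circ> t) (k, Suc r, c)" if "(k, Suc r, c) \<in> nd" for k r c
      using T_col[OF t _ that, of r] no(2)[OF that] by (simp add: lt)
  qed
  moreover have "(adj_swap i \<circ> t) (k, r, c) \<in> block mu k" if "(k, r, c) \<in> nd" for k r c
    using block_swap[OF i] T_block[OF t that] by simp
  ultimately show ?thesis by (simp add: T_iff block_def)
qed

lemma cw_node: "t \<in> T \<Longrightarrow> (k, r, c) \<in> nd \<Longrightarrow> cw lam t (t (k, r, c)) \<longleftrightarrow> c = 1"
  unfolding cw_def using T_inj by blast

lemma up_T:
  assumes t: "t \<in> T" and i: "i \<in> ncut mu" and c: "cw lam t i" "\<not> cw lam t (Suc i)"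
  shows "adj_swap i \<circ> t \<in> T"
proof (rule swap_T[OF t i])
  fix k r c assume nd: "(k, r, Suc c) \<in> nd"
  then have "c = 0" using nd_c[OF nd] by simp
  then show "\<not> (t (k, r, c) = i \<and> t (k, r, Suc c) = Suc i)"
    using assms(3,4) cw_node[OF t nd] by auto
next
  fix k r c assume nd: "(k, Suc r, c) \<in> nd"
  then have "(k, r, c) \<in> nd" using nd_up by (meson Suc_n_not_le_n nle_le)
  then show "\<not> (t (k, r, c) = i \<and> t (k, Suc r, c) = Suc i)"
    using assms(3,4) cw_node[OF t nd] cw_node[OF t] by auto
qed

lemma diamond_T:
  assumes t: "t \<in> T" and ij: "i \<in> ncut mu" "j \<in> ncut mu" "apart i j"
    and i: "adj_swap i \<circ> t \<in> T" and j: "adj_swap j \<circ> t \<in> T"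
  shows "adj_swap i \<circ> (adj_swap j \<circ> t) \<in> T"
proof (rule swap_T[OF j ij(1)])
  have eq: "t x = i" "t y = Suc i" if "(adj_swap j \<circ> t) x = i \<and> (adj_swap j \<circ> t) y = Suc i" for x y
    using that ij(3) by (auto simp: adj_swap_def split: if_splits)
  show "\<not> ((adj_swap j \<circ> t) (k, r, c) = i \<and> (adj_swap j \<circ> t) (k, r, Suc c) = Suc i)"
    if "(k, r, Suc c) \<in> nd" for k r c
    using eq[of "(k, r, c)" "(k, r, Suc c)"] T_row[OF i that] by auto
  show "\<not> ((adj_swap j \<circ> t) (k, r, c) = i \<and> (adj_swap j \<circ> t) (k, Suc r, c) = Suc i)"
    if "(k, Suc r, c) \<in> nd" for k r c
    using eq[of "(k, r, c)" "(k, Suc r, c)"] T_col[OF i _ that, of r] by auto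
qed

lemma d_perm_tau: "x \<in> nd \<Longrightarrow> d_perm lam t (\<tau> x) = t x"
  using the_inv_into_f_f[OF bij_betw_imp_inj_on[OF bij_tau]] by (simp add: d_perm_def)

lemma d_perm_outside: "i \<notin> {1..n} \<Longrightarrow> d_perm lam t i = i"
  using bij_tau by (auto simp: d_perm_def bij_betw_def)

lemma d_perm_eqI:
  assumes "\<And>x. x \<in> nd \<Longrightarrow> w (\<tau> x) = t x" "\<And>i. i \<notin> {1..n} \<Longrightarrow> w i = i"
  shows "d_perm lam t = w"
proof
  fix i show "d_perm lam t i = w i"
  proof (cases "i \<in> {1..n}")
    case True
    then obtain x where "x \<in> nd" "\<tau> x = i" using bij_tau by (metis bij_betw_def imageE)
    then show ?thesis using assms(1) d_perm_tau by metis
  qed (simp add: assms(2) d_perm_outside)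
qed

lemma d_perm_permutes:
  assumes t: "t \<in> T"
  shows "d_perm lam t permutes {1..n}"
proof (rule bij_imp_permutes)
  have "bij_betw (\<lambda>x. d_perm lam t (\<tau> x)) nd {1..n}"
    using T_bij[OF t] by (rule bij_betw_cong[THEN iffD1, rotated]) (simp add: d_perm_tau)
  then show "bij_betw (d_perm lam t) {1..n} {1..n}"
    using bij_betw_comp_iff[OF bij_tau, of "d_perm lam t" "{1..n}"] by (simp add: comp_def)
qed (rule d_perm_outside)

lemma d_perm_tau_id: "d_perm lam \<tau> = id"
  by (rule d_perm_eqI) auto

lemma d_perm_id: "t \<in> T \<Longrightarrow> d_perm lam t = id \<Longrightarrow> t = \<tau>"
proof
  fix x assume t: "t \<in> T" and d: "d_perm lam t = id"
  show "t x = \<tau> x"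
  proof (cases "x \<in> nd")
    case True
    then show ?thesis using d_perm_tau[of x t] d by simp
  next
    case False
    then show ?thesis using T_zero[OF t] T_zero[OF tau_T] by simp
  qed
qed

lemma d_perm_swap: "i \<in> {1..<n} \<Longrightarrow> d_perm lam (adj_swap i \<circ> t) = adj_swap i \<circ> d_perm lam t"
  by (rule d_perm_eqI) (auto simp: d_perm_tau d_perm_outside adj_swap_def)

lemma inv_d_perm: "t \<in> T \<Longrightarrow> x \<in> nd \<Longrightarrow> inv (d_perm lam t) (t x) = \<tau> x"
  using permutes_inverses(2)[OF d_perm_permutes] d_perm_tau by metis

text \<open>At a descent, i + 1 precedes i in the row reading order of the shape. Standardness
  leaves one possibility: in the same component, i + 1 stands in the second column and i in the
  first column of a lower row. So every descent undoes to an upward step.\<close>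

lemma descent_T:
  assumes t: "t \<in> T" and i: "i \<in> {1..<n}"
    and d: "inv (d_perm lam t) (Suc i) < inv (d_perm lam t) i"
  shows "adj_swap i \<circ> t \<in> T" "i \<in> ncut mu" "\<not> cw lam t i" "cw lam t (Suc i)"
proof -
  obtain k r c where x: "(k, r, c) \<in> nd" "t (k, r, c) = i" using T_node[OF t, of i] i by auto
  obtain k' r' c' where y: "(k', r', c') \<in> nd" "t (k', r', c') = Suc i" using T_node[OF t, of "Suc i"] i by auto
  have "\<tau> (k', r', c') < \<tau> (k, r, c)"
    using d inv_d_perm[OF t x(1)] inv_d_perm[OF t y(1)] x y by simp
  then have lex: "k' < k \<or> k' = k \<and> (r' < r \<or> r' = r \<and> c' < c)"
    by (simp add: tau_less[OF y(1) x(1)])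
  have bx: "off mu k < i" "i \<le> off mu (Suc k)" and by': "off mu k' < Suc i" "Suc i \<le> off mu (Suc k')"
    using T_bounds[OF t x(1)] T_bounds[OF t y(1)] x(2) y(2) by simp_all
  \<comment> \<open>In a tableau of the initial kind earlier components have smaller entries, so i +
    1 cannot stand in an earlier component than i.\<close>
  have "\<not> k' < k" using bx by' off_mono[of "Suc k'" k mu] by auto
  with lex have k: "k' = k" and lex: "r' < r \<or> r' = r \<and> c' < c" by auto
  have kl: "k < length lam" using x by (simp add: nd_iff)
  show "i \<in> ncut mu" using bx by' k kl by (auto simp: ncut_def intro!: exI[of _ k])
  then have i': "i \<in> ncut mu" .
  have c: "c = 0 \<or> c = 1" "c' = 0 \<or> c' = 1" using nd_c x y by blast+
  have ltr: "t (k, r, 0) < t (k, r, 1)" if "(k, r, 1) \<in> nd" for r using T_row[OF t, of k r 0] that by simp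
  have r: "r' < r"
  proof (rule ccontr)
    assume "\<not> r' < r"
    with lex c have "r' = r" "c' = 0" "c = 1" by auto
    then show False using ltr[of r] x y k by simp
  qed
  have cc: "c' = 1 \<and> c = 0"
  proof (rule ccontr)
    assume "\<not> (c' = 1 \<and> c = 0)"
    then have "c' = c \<or> c' = 0 \<and> c = 1" using c by auto
    moreover have "t (k, r', c') < t (k, r, c')"
      by (rule T_col[OF t r]) (use calculation x(1) nd_0 in auto)
    moreover have "t (k, r, c') \<le> t (k, r, c)"
      using calculation(1) ltr[of r] x(1) by auto
    ultimately show False using x y k by simp
  qed
  show "\<not> cw lam t i" "cw lam t (Suc i)"
    using cw_node[OF t x(1)] cw_node[OF t y(1)] x(2) y(2) cc by auto
  show "adj_swap i \<circ> t \<in> T"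
  proof (rule swap_T[OF t i'])
    fix k1 r1 c1 assume nd: "(k1, r1, Suc c1) \<in> nd"
    show "\<not> (t (k1, r1, c1) = i \<and> t (k1, r1, Suc c1) = Suc i)"
    proof
      assume a: "t (k1, r1, c1) = i \<and> t (k1, r1, Suc c1) = Suc i"
      have "(k1, r1, c1) \<in> nd" using nd by (simp add: nd_iff)
      then show False using a T_inj[OF t _ x(1)] T_inj[OF t nd y(1)] x y r by fastforce
    qed
  next
    fix k1 r1 c1 assume nd: "(k1, Suc r1, c1) \<in> nd"
    show "\<not> (t (k1, r1, c1) = i \<and> t (k1, Suc r1, c1) = Suc i)"
    proof
      assume a: "t (k1, r1, c1) = i \<and> t (k1, Suc r1, c1) = Suc i"
      have "(k1, r1, c1) \<in> nd" using nd_up[OF nd, of r1] by simp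
      then show False using a T_inj[OF t _ x(1)] T_inj[OF t nd y(1)] x y r by fastforce
    qed
  qed
qed

text \<open>Within a component and a column the entries increase downwards, so the sets of entries
  of the two columns determine them row by row; \<open>le\<close> compares row r once the rows above
  agree.\<close>

lemma cw_inj:
  assumes t: "t \<in> T" and s: "s \<in> T" and eq: "cw lam t = cw lam s"
  shows "t = s"
proof
  have le: "s (k, r, c) \<le> t (k, r, c)"
    if t: "t \<in> T" and s: "s \<in> T" and eq: "cw lam t = cw lam s" and nd: "(k, r, c) \<in> nd"
      and IH: "\<And>r'. r' < r \<Longrightarrow> t (k, r', c) = s (k, r', c)" for t s k r c
  proof -
    obtain k' r' c' where y: "(k', r', c') \<in> nd" "s (k', r', c') = t (k, r, c)"
      using T_node[OF s T_range[OF t nd]] by auto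
    have "k' = k" using T_block[OF t nd] T_block[OF s y(1)] y(2) by metis
    moreover have "c' = c"
      using cw_node[OF t nd] cw_node[OF s y(1)] y(2) eq nd_c[OF nd] nd_c[OF y(1)] by auto
    ultimately have y: "(k, r', c) \<in> nd" "s (k, r', c) = t (k, r, c)" using y by auto
    have "\<not> r' < r"
    proof
      assume "r' < r"
      then have "t (k, r', c) = t (k, r, c)" using IH y by simp
      then show False using T_inj[OF t y(1) nd] \<open>r' < r\<close> by auto
    qed
    then show ?thesis using T_col[OF s _ y(1), of r] y(2) by (cases "r = r'") auto
  qed
  fix x :: "nat \<times> nat \<times> nat"
  obtain k r c where x: "x = (k, r, c)" by (metis prod_cases3)
  show "t x = s x"
  proof (cases "x \<in> nd")
    case True
    have "(k, r, c) \<in> nd \<Longrightarrow> t (k, r, c) = s (k, r, c)" for r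
    proof (induction r rule: less_induct)
      case (less r)
      have IH: "t (k, r', c) = s (k, r', c)" if "r' < r" for r'
        using less.IH[OF that] nd_up[OF less.prems, of r'] that by simp
      show ?case
        using le[OF t s eq less.prems IH] le[OF s t eq[symmetric] less.prems IH[symmetric]] by simp
    qed
    then show ?thesis using True x by simp
  next
    case False
    then show ?thesis using T_zero[OF t] T_zero[OF s] by simp
  qed
qed

lemma finite_T: "finite T"
proof (rule finite_subset)
  show "T \<subseteq> {f. \<forall>x. (x \<in> nd \<longrightarrow> f x \<in> {1..n}) \<and> (x \<notin> nd \<longrightarrow> f x = 0)}"
  proof (intro subsetI CollectI allI conjI impI)
    fix t x assume t: "t \<in> T"
    show "t x \<in> {1..n}" if "x \<in> nd" using T_range[OF t that] .
    show "t x = 0" if "x \<notin> nd" using T_zero[OF t that] .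
  qed
  show "finite {f. \<forall>x. (x \<in> nd \<longrightarrow> f x \<in> {1..n}) \<and> (x \<notin> nd \<longrightarrow> f x = (0::nat))}"
    by (rule finite_set_of_finite_funs) (simp_all add: finite_nd)
qed

section \<open>Rows of length two\<close>

lemma pairs_iff: "j \<in> pairs lam \<longleftrightarrow> (\<exists>k r. (k, r, 1) \<in> nd \<and> \<tau> (k, r, 0) = j)"
  by (simp add: pairs_def)

lemma tau_1: "(k, r, 1) \<in> nd \<Longrightarrow> \<tau> (k, r, 1) = Suc (\<tau> (k, r, 0))"
  using tau[of k r 1] tau[OF nd_0, of k r 1] by simp

lemma cw_tau: "cw lam \<tau> i \<longleftrightarrow> (\<exists>j\<in>pairs lam. i = Suc j)"
  unfolding cw_def pairs_def using tau_1 by auto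

lemma pairs_ncut: "pairs lam \<subseteq> ncut mu"
proof
  fix j assume "j \<in> pairs lam"
  then obtain k r where kr: "(k, r, 1) \<in> nd" "\<tau> (k, r, 0) = j" by (auto simp: pairs_iff)
  then show "j \<in> ncut mu"
    using tau_block[OF nd_0[OF kr(1)]] tau_block[OF kr(1)] tau_1[OF kr(1)]
    by (auto simp: ncut_def nd_iff intro!: exI[of _ k])
qed

lemma finite_pairs: "finite (pairs lam)"
  by (rule finite_subset[OF subset_trans[OF pairs_ncut ncut_subset[OF mu_comp]]]) simp

lemma pairs_apart: "j \<in> pairs lam \<Longrightarrow> Suc j \<notin> pairs lam"
proof
  assume "j \<in> pairs lam" "Suc j \<in> pairs lam"
  then obtain k r k' r' where "(k, r, 1) \<in> nd" "\<tau> (k, r, 0) = j" "(k', r', 1) \<in> nd" "\<tau> (k', r', 0) = Suc j"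
    by (auto simp: pairs_iff)
  then show False using tau_1[of k r] T_inj[OF tau_T, of "(k, r, 1)" "(k', r', 0)"] nd_0[of k' r' 1] by simp
qed

lemma tau_not_pair: "(k, r, c) \<in> nd \<Longrightarrow> \<tau> (k, r, c) \<in> pairs lam \<longleftrightarrow> c = 0 \<and> (k, r, 1) \<in> nd"
proof
  assume nd: "(k, r, c) \<in> nd" and "\<tau> (k, r, c) \<in> pairs lam"
  then obtain k' r' where "(k', r', 1) \<in> nd" "\<tau> (k', r', 0) = \<tau> (k, r, c)" by (auto simp: pairs_iff)
  then show "c = 0 \<and> (k, r, 1) \<in> nd" using T_inj[OF tau_T nd_0 nd, of k' r' 1] by auto
qed (auto simp: pairs_iff)

lemma pairs_eq: "pairs lam = {off mu k + off (lam ! k) r + 1 | k r. k < length lam \<and> r < length (lam ! k) \<and> lam ! k ! r = 2}"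
proof -
  have "\<tau> (k, r, 0) = off mu k + off (lam ! k) r + 1" if "(k, r, 1) \<in> nd" for k r
    using tau[OF nd_0[OF that]] by simp
  then show ?thesis unfolding pairs_def nd_1[symmetric] by (intro Collect_cong) metis
qed

text \<open>Rows r and r + 1, both of length one, are merged into a row of length two. By
  \<open>prev\<close> row r is the topmost row of length one, so the result is a partition; the rows
  of length two in this component lie above and keep their offsets.\<close>

lemma add_pair:
  assumes k: "k < length lam" and r: "Suc r < length (lam ! k)" "lam ! k ! r = 1"
    and prev: "r = 0 \<or> lam ! k ! (r - 1) = 2"
  shows "\<exists>lam'\<in>MPar2 n. comp_of lam' = mu \<and> pairs lam' = insert (off mu k + off (lam ! k) r + 1) (pairs lam)"
proof -
  define p where "p = lam ! k"
  define p' where "p' = take r p @ 2 # drop (Suc (Suc r)) p"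
  define lam' where "lam' = lam[k := p']"
  note r = r[folded p_def] and prev = prev[folded p_def]
  have row: "p ! i = 1 \<or> p ! i = 2" if "i < length p" for i using row[OF k] that by (simp add: p_def)
  have anti: "p ! i' \<le> p ! i" if "i \<le> i'" "i' < length p" for i i'
    using row_antimono[OF k that(1)] that(2) by (simp add: p_def)
  have r1: "p ! Suc r = 1" using anti[of r "Suc r"] row[of "Suc r"] r by auto
  have p: "p = take r p @ p ! r # p ! Suc r # drop (Suc (Suc r)) p"
    using r(1) by (metis Cons_nth_drop_Suc Suc_lessD append_take_drop_id)
  have sum: "sum_list p' = sum_list p"
    by (subst p) (simp add: p'_def r1 r)
  have p'_nth: "p' ! i = (if i < r then p ! i else if i = r then 2 else p ! Suc i)" if "i < length p'" for i
    using that r(1) by (auto simp: p'_def nth_append nth_Cons' min_def)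
  have len: "Suc (length p') = length p" using r(1) by (simp add: p'_def min_def)
  have small: "p ! i = 1" if "r \<le> i" "i < length p" for i
    using anti[OF that] row[OF that(2)] r(2) by auto
  have big: "p ! i = 2" if "i < r" for i
  proof -
    have "i \<le> r - 1" "r - 1 < length p" "i < length p" "r \<noteq> 0" using that r(1) by auto
    then show ?thesis using anti[of i "r - 1"] row[of i] prev by auto
  qed
  have lam_k: "p \<in> set lam" using k by (simp add: p_def)
  have "sorted_wrt (\<ge>) p'"
    unfolding sorted_wrt_iff_nth_less
    using p'_nth big small row len by (auto simp: less_Suc_eq)
  moreover have "\<forall>x\<in>set p'. 0 < x \<and> x \<le> 2"
  proof
    fix x assume "x \<in> set p'"
    then obtain i where i: "i < length p'" "x = p' ! i" by (auto simp: in_set_conv_nth)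
    show "0 < x \<and> x \<le> 2" using p'_nth[OF i(1)] big[of i] small[of "Suc i"] i len by auto
  qed
  moreover have "p' \<noteq> []" by (simp add: p'_def)
  moreover have comp: "comp_of lam' = mu"
    using k sum by (simp add: lam'_def comp_of_def map_update p_def list_update_same_conv)
  ultimately have "lam' \<in> MPar2 n"
    using lam sum_mu unfolding MPar2_def multipartitions_def comp_of_def[symmetric] lam'_def
    by (auto dest!: set_update_subset_insert[THEN subsetD])
  then interpret l: two_col n lam' by unfold_locales
  have off: "off p' i = off p i" if "i \<le> r" for i
    using that r(1) by (simp add: off_def p'_def)
  have iff: "i < length (lam' ! l) \<and> lam' ! l ! i = 2 \<longleftrightarrow>
     (l = k \<and> i = r) \<or> (i < length (lam ! l) \<and> lam ! l ! i = 2)" if "l < length lam" for l i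
  proof (cases "l = k")
    case True
    then have "lam' ! l = p'" "lam ! l = p" using k by (simp_all add: lam'_def p_def)
    then show ?thesis using p'_nth[of i] small[of i] small[of "Suc i"] big[of i] len r True
      by (cases i r rule: linorder_cases) auto
  qed (simp add: lam'_def)
  have offe: "off (lam' ! l) i = off (lam ! l) i"
    if "l < length lam" "(l = k \<and> i = r) \<or> (i < length (lam ! l) \<and> lam ! l ! i = 2)" for l i
  proof (cases "l = k")
    case True
    then have e: "lam' ! l = p'" "lam ! l = p" using k by (simp_all add: lam'_def p_def)
    have "i \<le> r" using that small[of i] True e by (cases "i \<le> r") auto
    then show ?thesis using e off by simp
  qed (simp add: lam'_def)
  have "pairs lam' = insert (off mu k + off (lam ! k) r + 1) (pairs lam)"
    unfolding l.pairs_eq pairs_eq comp using iff offe k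
    by (auto simp: lam'_def[symmetric] simp del: One_nat_def) (metis lam'_def length_list_update)+
  then show ?thesis using \<open>lam' \<in> MPar2 n\<close> comp by blast
qed

text \<open>A pattern 00 at j comes from two consecutive rows of length one. If the upper one is the
  topmost such row, merging gives a shape with one more pair; otherwise 00 also occurs at j - 1,
  which feeds an induction on j.\<close>

lemma base_case:
  assumes j: "j \<in> ncut mu" "\<not> cw lam \<tau> j" "\<not> cw lam \<tau> (Suc j)"
  shows "\<forall>i\<in>pairs lam. apart i j" "j \<notin> pairs lam"
    and "(\<exists>lam'\<in>MPar2 n. comp_of lam' = mu \<and> pairs lam' = insert j (pairs lam)) \<or>
         (\<exists>j'. j = Suc j' \<and> j' \<in> ncut mu \<and> \<not> cw lam \<tau> j' \<and> \<not> cw lam \<tau> (Suc j'))"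
proof -
  have "j \<in> {1..n}" using ncut_range[OF j(1)] by auto
  then obtain k r c where x: "(k, r, c) \<in> nd" "\<tau> (k, r, c) = j" using T_node[OF tau_T] by blast
  have c: "c = 0" using nd_c[OF x(1)] cw_node[OF tau_T x(1)] x(2) j(2) by auto
  have k: "k < length lam" "r < length (lam ! k)" using x by (auto simp: nd_iff)
  have jx: "j = off mu k + off (lam ! k) r + 1" using tau[OF x(1)] x(2) c by simp
  show jP: "j \<notin> pairs lam" using j(3) by (auto simp: cw_tau)
  have r1: "lam ! k ! r = 1"
    using row[OF k] nd_1[of k r] k jP tau_not_pair[OF x(1)] x(2) c by auto
  obtain l where l: "off mu l < j" "j < off mu (Suc l)" using j(1) by (auto simp: ncut_def)
  have "l = k" using l tau_block[OF x(1)] x(2) by (intro off_unique[of mu l "j - 1" k]) auto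
  then have "off (lam ! k) (Suc r) < sum_list (lam ! k)"
    using l k jx r1 by (simp add: off_Suc mu_nth)
  then have Sr: "Suc r < length (lam ! k)" using k(2) by (metis Suc_lessI nat_neq_iff off_length)
  have y: "(k, Suc r, 0) \<in> nd" using row[OF k(1) Sr] k Sr by (auto simp: nd_iff)
  have ty: "\<tau> (k, Suc r, 0) = Suc j" using tau[OF y] jx k r1 by (simp add: off_Suc)
  have "Suc j \<notin> pairs lam"
    using tau_not_pair[OF y] ty nd_1[of k "Suc r"] row_antimono[OF k(1) _ Sr, of r] r1 by auto
  moreover have "Suc i \<noteq> j" if "i \<in> pairs lam" for i using that j(2) by (auto simp: cw_tau)
  ultimately have "i \<noteq> Suc j \<and> Suc i \<noteq> j \<and> i \<noteq> j" if "i \<in> pairs lam" for i using that jP by auto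
  then show "\<forall>i\<in>pairs lam. apart i j" by (metis Suc_eq_plus1 Suc_lessI linorder_neqE_nat)
  show "(\<exists>lam'\<in>MPar2 n. comp_of lam' = mu \<and> pairs lam' = insert j (pairs lam)) \<or>
         (\<exists>j'. j = Suc j' \<and> j' \<in> ncut mu \<and> \<not> cw lam \<tau> j' \<and> \<not> cw lam \<tau> (Suc j'))"
  proof (cases "r = 0 \<or> lam ! k ! (r - 1) = 2")
    case True
    then show ?thesis using add_pair[OF k(1) Sr r1 True] jx by simp
  next
    case False
    then obtain r0 where r0: "r = Suc r0" "lam ! k ! r0 = 1"
      using row[OF k(1), of "r - 1"] k(2) by (cases r) auto
    then have z: "(k, r0, 0) \<in> nd" using k by (auto simp: nd_iff)
    have tz: "Suc (\<tau> (k, r0, 0)) = j" using tau[OF z] jx k r0 by (simp add: off_Suc)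
    have "\<tau> (k, r0, 0) \<in> ncut mu"
      using tau_block[OF z] tau_block[OF x(1)] x(2) tz k(1) by (auto simp: ncut_def intro!: exI[of _ k])
    moreover have "\<not> cw lam \<tau> (\<tau> (k, r0, 0))" using cw_node[OF tau_T z] by simp
    ultimately show ?thesis using tz j(2) by auto
  qed
qed

lemma card_cw:
  assumes t: "t \<in> T"
  shows "card {i \<in> block mu k. cw lam t i} = card {r. (k, r, 1) \<in> nd}"
proof -
  have "{i \<in> block mu k. cw lam t i} = (\<lambda>r. t (k, r, 1)) ` {r. (k, r, 1) \<in> nd}"
    using T_block[OF t] by (auto simp: cw_def)
  moreover have "inj_on (\<lambda>r. t (k, r, 1)) {r. (k, r, 1) \<in> nd}"
    using T_inj[OF t] by (intro inj_onI) blast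
  ultimately show ?thesis by (simp add: card_image)
qed

lemma pairs_block: "j \<in> pairs lam \<Longrightarrow> Suc j \<in> block mu k \<longleftrightarrow> j \<in> block mu k"
  using block_swap[of j mu j k] pairs_ncut by auto

lemma cw_tau_block: "{i \<in> block mu k. cw lam \<tau> i} = Suc ` (pairs lam \<inter> block mu k)"
  using pairs_block by (auto simp: cw_tau)

lemma card_pairs_block: "card (pairs lam \<inter> block mu k) = card {r. (k, r, 1) \<in> nd}"
  using card_cw[OF tau_T, of k] unfolding cw_tau_block by (simp add: card_image)

text \<open>A word that is nonconstant on a pair has exactly one true position there;
  \<open>?f\<close> selects it.\<close>

lemma pairs_count:
  assumes "\<And>j. j \<in> pairs lam \<Longrightarrow> u j \<noteq> u (Suc j)"
  shows "card (pairs lam \<inter> block mu k) \<le> card {i \<in> block mu k. u i}"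
proof (rule card_inj_on_le)
  let ?f = "\<lambda>j. if u j then j else Suc j"
  show "inj_on ?f (pairs lam \<inter> block mu k)"
    using pairs_apart by (auto simp: inj_on_def split: if_splits)
  show "?f ` (pairs lam \<inter> block mu k) \<subseteq> {i \<in> block mu k. u i}"
    using assms pairs_block by auto
qed (simp add: block_def)

lemma pairs_count_eq:
  assumes "\<And>j. j \<in> pairs lam \<Longrightarrow> u (Suc j)"
    and "card {i \<in> block mu k. u i} = card (pairs lam \<inter> block mu k)" and "i \<in> block mu k"
  shows "u i \<longleftrightarrow> cw lam \<tau> i"
proof -
  have fin: "finite (block mu k)" by (simp add: block_def)
  have sub: "{i \<in> block mu k. cw lam \<tau> i} \<subseteq> {i \<in> block mu k. u i}"
    using assms(1) by (auto simp: cw_tau)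
  have "card {i \<in> block mu k. cw lam \<tau> i} = card {i \<in> block mu k. u i}"
    using assms(2) card_cw[OF tau_T] card_pairs_block by simp
  then have "{i \<in> block mu k. cw lam \<tau> i} = {i \<in> block mu k. u i}"
    using card_subset_eq[OF _ sub] fin by simp
  then show ?thesis using assms(3) by blast
qed

lemma block_cover: "i \<in> {1..n} \<Longrightarrow> \<exists>k<length lam. i \<in> block mu k"
  using off_locate[of "i - 1" mu] sum_mu by (auto simp: block_def) (metis One_nat_def Suc_pred less_Suc_eq_le less_eq_Suc_le)

lemma card_pairs: "card (pairs lam) = (\<Sum>k<length lam. card (pairs lam \<inter> block mu k))"
proof -
  have "pairs lam = (\<Union>k<length lam. pairs lam \<inter> block mu k)"
  proof (intro set_eqI iffI)
    fix j assume j: "j \<in> pairs lam"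
    then have "j \<in> {1..n}" using pairs_ncut ncut_range by fastforce
    then show "j \<in> (\<Union>k<length lam. pairs lam \<inter> block mu k)" using block_cover j by blast
  qed blast
  then have "card (pairs lam) = card (\<Union>k<length lam. pairs lam \<inter> block mu k)" by simp
  also have "\<dots> = (\<Sum>k<length lam. card (pairs lam \<inter> block mu k))"
  proof (rule card_UN_disjoint)
    show "\<forall>i\<in>{..<length lam}. \<forall>j\<in>{..<length lam}. i \<noteq> j \<longrightarrow>
        (pairs lam \<inter> block mu i) \<inter> (pairs lam \<inter> block mu j) = {}"
    proof (intro ballI impI equals0I)
      fix i j x assume "i \<noteq> j" "x \<in> (pairs lam \<inter> block mu i) \<inter> (pairs lam \<inter> block mu j)"
      then have "i = j" by (intro off_unique[of mu i "x - 1" j]) (auto simp: block_def)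
      then show False using \<open>i \<noteq> j\<close> by contradiction
    qed
  qed (use finite_pairs in auto)
  finally show ?thesis .
qed

lemma count_twos: "k < length lam \<Longrightarrow> card (pairs lam \<inter> block mu k) = length (filter ((=) 2) (lam ! k))"
  unfolding card_pairs_block length_filter_conv_card by (rule arg_cong[where f = card]) (auto simp: nd_1 simp del: One_nat_def)

end

lemma two_col_partition:
  assumes "sorted_wrt (\<ge>) p" "\<forall>x\<in>set p. x = 1 \<or> x = (2::nat)"
  shows "p = replicate (length (filter ((=) 2) p)) 2 @ replicate (sum_list p - 2 * length (filter ((=) 2) p)) 1"
  using assms
proof (induction p)
  case (Cons x p)
  show ?case
  proof (cases "x = 2")
    case True
    then show ?thesis using Cons by simp
  next
    case False
    then have "x = 1" "\<forall>y\<in>set p. y = 1" using Cons.prems by fastforce+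
    then obtain m where "p = replicate m 1" by (metis replicate_length_same)
    then show ?thesis using \<open>x = 1\<close> by (simp add: sum_list_replicate)
  qed
qed simp

text \<open>A two-column partition is determined by its size and its number of rows of length two,
  and \<open>count_twos\<close> reads the latter off a block.\<close>

lemma shape_inj:
  assumes "lam \<in> MPar2 n" "lam' \<in> MPar2 n" "comp_of lam = comp_of lam'"
    and "\<And>k. k < length lam \<Longrightarrow> card (pairs lam \<inter> block (comp_of lam) k) = card (pairs lam' \<inter> block (comp_of lam) k)"
  shows "lam = lam'"
proof (rule nth_equalityI)
  interpret a: two_col n lam by unfold_locales fact
  interpret b: two_col n lam' by unfold_locales fact
  show len: "length lam = length lam'" using assms(3) a.length_mu b.length_mu by metis
  fix k assume k: "k < length lam"
  then have k': "k < length lam'" using len by simp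
  have "length (filter ((=) 2) (lam ! k)) = length (filter ((=) 2) (lam' ! k))"
    using assms(4)[OF k] a.count_twos[OF k] b.count_twos[OF k'] assms(3) by simp
  moreover have "sum_list (lam ! k) = sum_list (lam' ! k)"
    using a.mu_nth[OF k] b.mu_nth[OF k'] assms(3) by simp
  moreover have "sorted_wrt (\<ge>) (lam ! k)" "sorted_wrt (\<ge>) (lam' ! k)"
    using a.lam b.lam k k' by (auto simp: MPar2_def multipartitions_def)
  moreover have "\<forall>x\<in>set (lam ! k). x = 1 \<or> x = 2" "\<forall>x\<in>set (lam' ! k). x = 1 \<or> x = 2"
    using a.row[OF k] b.row[OF k'] by (metis in_set_conv_nth)+
  ultimately show "lam ! k = lam' ! k" using two_col_partition by metis
qed

lemma finite_MPar2: "finite (MPar2 n)"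
proof (rule finite_subset)
  let ?P = "{p :: nat list. set p \<subseteq> {1..2} \<and> length p \<le> n}"
  let ?L = "{l. set l \<subseteq> ?P \<and> length l \<le> n}"
  have le: "length p \<le> sum_list p" if "\<forall>x\<in>set p. 0 < x" for p :: "nat list"
    using that by (induction p) auto
  show "MPar2 n \<subseteq> ?L"
  proof
    fix lam assume lam: "lam \<in> MPar2 n"
    interpret two_col n lam by unfold_locales fact
    have "length lam \<le> n" using le[of mu] mu_comp sum_mu by (simp add: compositions_def)
    moreover have "p \<in> ?P" if "p \<in> set lam" for p
    proof -
      have "p \<noteq> [] \<and> (\<forall>x\<in>set p. 0 < x \<and> x \<le> 2)" using that lam by (auto simp: MPar2_def multipartitions_def)
      moreover have "sum_list p \<le> n"
        using that member_le_sum_list[of "sum_list p" mu] sum_mu by (auto simp: comp_of_def)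
      ultimately show ?thesis using le[of p] by (auto simp: Suc_le_eq)
    qed
    ultimately show "lam \<in> ?L" by blast
  qed
  show "finite ?L" by (intro finite_lists_length_le) auto
qed

section \<open>The action on words\<close>

type_synonym wfun = "(nat \<Rightarrow> bool) \<Rightarrow> laurent"

text \<open>The R-matrix action on a tensor power of a two-dimensional space, on which \<open>z\<close> has the
  eigenvalue \<open>-q\<^sup>-\<^sup>1\<close> on the constant words.\<close>

definition zact :: "nat \<Rightarrow> wfun \<Rightarrow> wfun" where
  "zact i f u = (if u i = u (Suc i) then - qinv * f u
     else if u i then f (u \<circ> adj_swap i) + (qL - qinv) * f u else f (u \<circ> adj_swap i))"

definition gact :: "nat set \<Rightarrow> gen \<Rightarrow> wfun \<Rightarrow> wfun" where
  "gact N g f u = (case g of E i \<Rightarrow> if i \<in> N then f u else 0 | Z i \<Rightarrow> if i \<in> N then zact i f u else 0)"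

definition wact :: "nat set \<Rightarrow> gen list \<Rightarrow> wfun \<Rightarrow> wfun" where
  "wact N l f = foldr (gact N) l f"

definition rho :: "nat set \<Rightarrow> bfree \<Rightarrow> wfun \<Rightarrow> wfun" where
  "rho N x f u = (\<Sum>l\<in>Poly_Mapping.keys x. Poly_Mapping.lookup x l * wact N l f u)"

lemma wact_simps [simp]: "wact N [] f = f" "wact N (g # l) f = gact N g (wact N l f)"
    "wact N (l @ l') f = wact N l (wact N l' f)"
  by (simp_all add: wact_def)

lemma gact_add: "gact N g (\<lambda>u. f u + h u) u = gact N g f u + gact N g h u"
  by (auto simp: gact_def zact_def algebra_simps split: gen.splits)

lemma gact_scale: "gact N g (\<lambda>u. r * f u) u = r * gact N g f u"
  by (auto simp: gact_def zact_def algebra_simps split: gen.splits)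

lemma wact_add: "wact N l (\<lambda>u. f u + h u) u = wact N l f u + wact N l h u"
proof (induction l arbitrary: u)
  case (Cons g l)
  have "wact N l (\<lambda>u. f u + h u) = (\<lambda>u. wact N l f u + wact N l h u)" using Cons by blast
  then show ?case by (simp add: gact_add)
qed simp

lemma wact_scale: "wact N l (\<lambda>u. r * f u) u = r * wact N l f u"
proof (induction l arbitrary: u)
  case (Cons g l)
  have "wact N l (\<lambda>u. r * f u) = (\<lambda>u. r * wact N l f u)" using Cons by blast
  then show ?case by (simp add: gact_scale)
qed simp

lemma rho_superset:
  assumes "finite A" "Poly_Mapping.keys x \<subseteq> A"
  shows "rho N x f u = (\<Sum>l\<in>A. Poly_Mapping.lookup x l * wact N l f u)"
  unfolding rho_def using assms by (intro sum.mono_neutral_left) (auto simp: in_keys_iff)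

lemma rho_single: "rho N (Poly_Mapping.single l r) f u = r * wact N l f u"
  by (subst rho_superset[of "{l}"]) auto

lemma rho_add: "rho N (x + y) f u = rho N x f u + rho N y f u"
proof -
  let ?A = "Poly_Mapping.keys x \<union> Poly_Mapping.keys y"
  have k: "Poly_Mapping.keys (x + y) \<subseteq> ?A" by (rule Poly_Mapping.keys_add)
  show ?thesis
    using k by (simp add: rho_superset[of ?A] lookup_add algebra_simps sum.distrib)
qed

lemma rho_0 [simp]: "rho N 0 f u = 0"
  by (simp add: rho_def)

lemma rho_uminus: "rho N (- x) f u = - rho N x f u"
  by (metis add.right_inverse minus_unique rho_0 rho_add)

lemma rho_diff: "rho N (x - y) f u = rho N x f u - rho N y f u"
  by (metis diff_conv_add_uminus rho_add rho_uminus)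

lemma rho_fun_add: "rho N x (\<lambda>u. f u + h u) u = rho N x f u + rho N x h u"
  by (induction x rule: bfree_induct) (simp_all add: rho_single rho_add wact_add algebra_simps)

lemma rho_fun_scale: "rho N x (\<lambda>u. r * f u) u = r * rho N x f u"
  by (induction x rule: bfree_induct) (simp_all add: rho_single rho_add wact_scale algebra_simps)

lemma rho_fun_0 [simp]: "rho N x (\<lambda>u. 0) u = 0"
  using rho_fun_scale[of N x 0 "\<lambda>u. 0"] by simp

lemma rho_mult: "rho N (x * y) f u = rho N x (rho N y f) u"
proof (induction x rule: bfree_induct)
  case (single l r)
  show ?case
  proof (induction y rule: bfree_induct)
    case (single l' s)
    have "rho N (Poly_Mapping.single l' s) f = (\<lambda>u. s * wact N l' f u)" by (auto simp: rho_single)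
    then show ?case by (simp add: mult_single plus_list_def rho_single wact_scale mult.assoc)
  next
    case (add y y')
    have "rho N (y + y') f = (\<lambda>u. rho N y f u + rho N y' f u)" by (auto simp: rho_add)
    then show ?case using add by (simp add: distrib_left rho_add rho_fun_add)
  qed
qed (simp add: distrib_right rho_add)

lemma rho_mult': "rho N (x * y) f = rho N x (rho N y f)"
  by (auto simp: rho_mult)

lemma rho_C: "rho N (C r) f u = r * f u"
  by (simp add: C_def rho_single)

lemma rho_1 [simp]: "rho N 1 f u = f u"
  using rho_C[of N 1 f u] by simp

lemma rho_sum: "rho N (sum g A) f u = (\<Sum>a\<in>A. rho N (g a) f u)"
  by (induction A rule: infinite_finite_induct) (simp_all add: rho_add)

lemma rho_e: "rho N (eF i) f u = (if i \<in> N then f u else 0)"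
  and rho_z: "rho N (zF i) f u = (if i \<in> N then zact i f u else 0)"
  by (simp_all add: eF_def zF_def rho_single gact_def)

lemma rho_e': "rho N (eF i) f = (if i \<in> N then f else (\<lambda>_. 0))"
  and rho_z': "rho N (zF i) f = (if i \<in> N then zact i f else (\<lambda>_. 0))"
  by (auto simp: rho_e rho_z fun_eq_iff)

lemma q_cancel [simp]: "qL * (qinv * x) = x" "qinv * (qL * x) = x" for x :: laurent
  by (simp_all flip: mult.assoc)

section \<open>The defining relations in the action\<close>

lemma zact_far: "apart i j \<Longrightarrow> zact i (zact j f) u = zact j (zact i f) u"
proof -
  assume a: "apart i j"
  have c: "u \<circ> adj_swap i \<circ> adj_swap j = u \<circ> adj_swap j \<circ> adj_swap i"
    using adj_swap_apart[OF a] by (auto simp: fun_eq_iff)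
  have "adj_swap i j = j" "adj_swap i (Suc j) = Suc j" "adj_swap j i = i" "adj_swap j (Suc i) = Suc i"
    using a by (auto simp: adj_swap_def)
  then show ?thesis using c by (simp add: zact_def algebra_simps)
qed

lemma zact_0 [simp]: "zact i (\<lambda>_. 0) u = 0"
  by (simp add: zact_def)

lemma zact_quadratic: "zact i (zact i f) u = f u + (qL - qinv) * zact i f u"
  by (simp add: zact_def comp_assoc algebra_simps) (simp add: comp_def)

text \<open>Writes a word as its three letters at i, i + 1, i + 2 over a fixed background, which
  turns a relation on three strands into eight finite checks.\<close>

definition put3 :: "nat \<Rightarrow> (nat \<Rightarrow> bool) \<Rightarrow> bool \<Rightarrow> bool \<Rightarrow> bool \<Rightarrow> nat \<Rightarrow> bool" where
  "put3 i u a b c = u(i := a, Suc i := b, Suc (Suc i) := c)"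

lemma put3_self: "put3 i u (u i) (u (Suc i)) (u (Suc (Suc i))) = u"
  by (auto simp: put3_def)

lemma zact_put3:
  "zact i f (put3 i u a b c) = (if a = b then - qinv * f (put3 i u a b c)
     else if a then f (put3 i u b a c) + (qL - qinv) * f (put3 i u a b c) else f (put3 i u b a c))"
  "zact (Suc i) f (put3 i u a b c) = (if b = c then - qinv * f (put3 i u a b c)
     else if b then f (put3 i u a c b) + (qL - qinv) * f (put3 i u a b c) else f (put3 i u a c b))"
proof -
  have s: "put3 i u a b c \<circ> adj_swap i = put3 i u b a c" "put3 i u a b c \<circ> adj_swap (Suc i) = put3 i u a c b"
    for a b c
    by (auto simp: put3_def adj_swap_def fun_eq_iff)
  have v: "put3 i u a b c i = a" "put3 i u a b c (Suc i) = b" "put3 i u a b c (Suc (Suc i)) = c"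
    for a b c
    by (simp_all add: put3_def)
  show "zact i f (put3 i u a b c) = (if a = b then - qinv * f (put3 i u a b c)
     else if a then f (put3 i u b a c) + (qL - qinv) * f (put3 i u a b c) else f (put3 i u b a c))"
  "zact (Suc i) f (put3 i u a b c) = (if b = c then - qinv * f (put3 i u a b c)
     else if b then f (put3 i u a c b) + (qL - qinv) * f (put3 i u a b c) else f (put3 i u a c b))"
    unfolding zact_def s v by (rule refl)+
qed

lemma zact_braid: "zact i (zact (Suc i) (zact i f)) u = zact (Suc i) (zact i (zact (Suc i) f)) u"
proof -
  have "zact i (zact (Suc i) (zact i f)) (put3 i u a b c) = zact (Suc i) (zact i (zact (Suc i) f)) (put3 i u a b c)"
    for a b c
    by (cases a; cases b; cases c) (simp_all add: zact_put3 algebra_simps)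
  from this[of "u i" "u (Suc i)" "u (Suc (Suc i))"] show ?thesis by (simp add: put3_self)
qed

text \<open>The operator is the symmetrizer on three strands. Its image would consist of common
  eigenvectors of both z for the eigenvalue q, the analogue of alternating tensors, and the third
  tensor power of a two-dimensional space has none.\<close>

lemma zact_TL:
  "f u + qL * zact i f u + qL * zact (Suc i) f u + qL ^ 2 * zact i (zact (Suc i) f) u
     + qL ^ 2 * zact (Suc i) (zact i f) u + qL ^ 3 * zact i (zact (Suc i) (zact i f)) u = 0"
proof -
  have "f v + qL * zact i f v + qL * zact (Suc i) f v + qL ^ 2 * zact i (zact (Suc i) f) v
     + qL ^ 2 * zact (Suc i) (zact i f) v + qL ^ 3 * zact i (zact (Suc i) (zact i f)) v = 0"
    if v: "v = put3 i u a b c" for v a b c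
    unfolding v
    by (cases a; cases b; cases c)
      (simp_all add: zact_put3 algebra_simps power2_eq_square power3_eq_cube)
  from this[of u "u i" "u (Suc i)" "u (Suc (Suc i))"] show ?thesis by (simp add: put3_self)
qed

definition ker :: "nat set \<Rightarrow> bfree set" where
  "ker N = {x. \<forall>f u. rho N x f u = 0}"

lemma tsi_ker: "two_sided_ideal (ker N)"
proof -
  have "rho N x f = (\<lambda>u. 0)" if "x \<in> ker N" for x f using that by (auto simp: ker_def)
  then show ?thesis by (auto simp: two_sided_ideal_iff ker_def rho_add rho_mult)
qed

context bTL
begin

lemma J_ker:
  assumes N: "N \<subseteq> {1..<n}"
  shows "J \<subseteq> ker N"
  unfolding J_eq bTL_ideal_def
proof (rule ideal_gen_least[OF subsetI tsi_ker])
  fix x assume x: "x \<in> bH_rels n \<union> TL_rels n"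
  have "rho N x f u = 0" for f u
    using x
  proof (cases rule: rel_cases)
    case (braid i j)
    then show ?thesis using zact_braid[of i f u] zact_braid[of j f u]
      by (auto simp: rho_diff rho_mult' rho_z rho_z')
  next
    case (far i j)
    then show ?thesis using zact_far[of i j f u] by (auto simp: rho_diff rho_mult' rho_z rho_z' zact_def)
  next
    case (zz i)
    then show ?thesis using zact_quadratic[of i f u]
      by (auto simp: rho_diff rho_mult' rho_z rho_z' rho_C rho_e)
  next
    case (ez_comm i j)
    then show ?thesis by (auto simp: rho_diff rho_mult' rho_z rho_z' rho_e rho_e' zact_def)
  next
    case (TL i j)
    \<comment> \<open>For i = j + 1 the braid relation rewrites the cubic term, so that
      \<open>zact_TL\<close> applies at j.\<close>
    then show ?thesis
      using zact_TL[of f u i] zact_TL[of f u j] zact_braid[of i f u] zact_braid[of j f u]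
      by (auto simp: rho_add rho_mult' rho_z rho_z' rho_C rho_e rho_e' algebra_simps)
  qed (use N in \<open>auto simp: rho_diff rho_mult' rho_z rho_z' rho_e rho_e' zact_def\<close>)
  then show "x \<in> ker N" by (simp add: ker_def)
qed

lemma rho_Eidem:
  assumes N: "N \<subseteq> {1..<n}"
  shows "rho N (Eidem n N) f u = f u"
proof -
  let ?A = "{S. N \<subseteq> S \<and> S \<subseteq> {1..<n}}"
  have fin: "finite ?A" by (rule finite_subset[of _ "Pow {1..<n}"]) auto
  have P: "rho N (prod_list (map eF is)) f u = (if set is \<subseteq> N then f u else 0)" for "is"
    by (induction "is") (auto simp: rho_mult rho_e)
  have "rho N (Eidem n N) f u = (\<Sum>S\<in>?A. (- 1) ^ (card S - card N) * rho N (Eprod n S) f u)"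
    unfolding Eidem_def rho_sum by (simp add: rho_mult rho_C)
  also have "\<dots> = (\<Sum>S\<in>?A. if S = N then f u else 0)"
  proof (rule sum.cong)
    fix S assume S: "S \<in> ?A"
    then have "set (filter (\<lambda>i. i \<in> S) [1..<n]) = S" by auto
    then show "(- 1) ^ (card S - card N) * rho N (Eprod n S) f u = (if S = N then f u else 0)"
      using S P[of "filter (\<lambda>i. i \<in> S) [1..<n]"] by (auto simp: Eprod_def)
  qed simp
  also have "\<dots> = f u" using fin N by (simp add: sum.delta')
  finally show ?thesis .
qed

text \<open>The idempotent acts as the identity by \<open>rho_Eidem\<close>, so whatever it
  annihilates acts by 0.\<close>

lemma corner_ker:
  assumes N: "N \<subseteq> {1..<n}" and x: "x \<in> corner N"
  shows "rho N x f u = 0"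
proof -
  have "rho N (Eidem n N * x) f u = 0" using x J_ker[OF N] by (auto simp: corner_def ker_def)
  then show ?thesis using rho_Eidem[OF N, of "rho N x f" u] by (simp add: rho_mult)
qed

end

section \<open>The anti-involution as transposition\<close>

definition words :: "nat \<Rightarrow> (nat \<Rightarrow> bool) set" where
  "words n = {u. \<forall>i. u i \<longrightarrow> i \<in> {1..n}}"

lemma finite_words: "finite (words n)"
proof (rule finite_subset)
  show "words n \<subseteq> (\<lambda>A i. i \<in> A) ` Pow {1..n}"
  proof
    fix u assume "u \<in> words n"
    then have "u = (\<lambda>i. i \<in> {i. u i})" "{i. u i} \<in> Pow {1..n}" by (auto simp: words_def)
    then show "u \<in> (\<lambda>A i. i \<in> A) ` Pow {1..n}" by blast
  qed
qed simp

lemma words_swap: "i \<in> {1..<n} \<Longrightarrow> u \<in> words n \<Longrightarrow> u \<circ> adj_swap i \<in> words n"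
  by (fastforce simp: words_def adj_swap_def split: if_splits)

lemma swap_swap: "(u \<circ> adj_swap i) \<circ> adj_swap i = u"
  by (auto simp: fun_eq_iff)

text \<open>In the basis of words the matrix of \<open>zact i\<close> is symmetric:
  \<open>?A\<close> is the diagonal, and the off-diagonal entry \<open>?B\<close> is the same at a
  word and at its swap.\<close>

lemma zact_adjoint:
  assumes i: "i \<in> {1..<n}"
  shows "(\<Sum>u\<in>words n. zact i f u * g u) = (\<Sum>u\<in>words n. f u * zact i g u)"
proof -
  let ?A = "\<lambda>u. (if u i = u (Suc i) then - qinv else if u i then qL - qinv else 0) :: laurent"
  let ?B = "\<lambda>u :: nat \<Rightarrow> bool. (if u i = u (Suc i) then 0 else 1) :: laurent"
  have z: "zact i h u = ?A u * h u + ?B u * h (u \<circ> adj_swap i)" for h u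
    by (simp add: zact_def)
  have "(\<Sum>u\<in>words n. ?B u * f (u \<circ> adj_swap i) * g u)
      = (\<Sum>u\<in>words n. ?B (u \<circ> adj_swap i) * f ((u \<circ> adj_swap i) \<circ> adj_swap i) * g (u \<circ> adj_swap i))"
    by (rule sum.reindex_bij_witness[where i = "\<lambda>u. u \<circ> adj_swap i" and j = "\<lambda>u. u \<circ> adj_swap i"])
      (auto simp: swap_swap words_swap[OF i])
  also have "\<dots> = (\<Sum>u\<in>words n. f u * (?B u * g (u \<circ> adj_swap i)))"
    unfolding swap_swap by (rule sum.cong) auto
  finally have B: "(\<Sum>u\<in>words n. ?B u * f (u \<circ> adj_swap i) * g u) = (\<Sum>u\<in>words n. f u * (?B u * g (u \<circ> adj_swap i)))" .
  have "(\<Sum>u\<in>words n. zact i f u * g u)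
      = (\<Sum>u\<in>words n. ?A u * f u * g u) + (\<Sum>u\<in>words n. ?B u * f (u \<circ> adj_swap i) * g u)"
    unfolding z by (simp only: distrib_right sum.distrib)
  also have "\<dots> = (\<Sum>u\<in>words n. f u * (?A u * g u)) + (\<Sum>u\<in>words n. f u * (?B u * g (u \<circ> adj_swap i)))"
    unfolding B by (simp only: mult.assoc mult.left_commute)
  also have "\<dots> = (\<Sum>u\<in>words n. f u * zact i g u)"
    unfolding z by (simp only: distrib_left sum.distrib)
  finally show ?thesis .
qed

lemma rho_adjoint:
  assumes N: "N \<subseteq> {1..<n}"
  shows "(\<Sum>u\<in>words n. rho N x f u * g u) = (\<Sum>u\<in>words n. f u * rho N (starF x) g u)"
proof (induction x rule: bfree_induct)
  case (single l r)
  have gen: "(\<Sum>u\<in>words n. gact N a f u * g u) = (\<Sum>u\<in>words n. f u * gact N a g u)" for a f g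
  proof (cases a)
    case (E i)
    then show ?thesis by (cases "i \<in> N") (simp_all add: gact_def)
  next
    case (Z i)
    then show ?thesis using zact_adjoint[of i n f g] N by (cases "i \<in> N") (auto simp: gact_def)
  qed
  have "(\<Sum>u\<in>words n. wact N l f u * g u) = (\<Sum>u\<in>words n. f u * wact N (rev l) g u)" for g
  proof (induction l arbitrary: g)
    case (Cons a l)
    have "(\<Sum>u\<in>words n. wact N (a # l) f u * g u) = (\<Sum>u\<in>words n. wact N l f u * gact N a g u)"
      by (simp add: gen)
    also have "\<dots> = (\<Sum>u\<in>words n. f u * wact N (rev (a # l)) g u)" using Cons by simp
    finally show ?case .
  qed simp
  then have "r * (\<Sum>u\<in>words n. wact N l f u * g u) = r * (\<Sum>u\<in>words n. f u * wact N (rev l) g u)" by simp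
  then show ?case by (simp add: starF_single rho_single sum_distrib_left mult_ac)
next
  case (add x y)
  then show ?case by (simp add: starF_add rho_add distrib_left distrib_right sum.distrib)
qed

text \<open>Generators move words only by swaps at \<open>N\<close>, so the values on a swap-stable
  set depend only on the values there. This allows vectors to be compared on a single weight
  space.\<close>

lemma rho_local:
  assumes W: "\<And>u i. u \<in> W \<Longrightarrow> i \<in> N \<Longrightarrow> u \<circ> adj_swap i \<in> W"
    and eq: "\<And>u. u \<in> W \<Longrightarrow> f u = g u" and u: "u \<in> W"
  shows "rho N x f u = rho N x g u"
proof -
  have "u \<in> W \<Longrightarrow> wact N l f u = wact N l g u" for l u
  proof (induction l arbitrary: u)
    case (Cons a l)
    then show ?case using W by (cases a) (auto simp: gact_def zact_def)
  qed (simp add: eq)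
  then show ?thesis using u by (simp add: rho_def)
qed

section \<open>The row symmetrizer\<close>

text \<open>For S without consecutive elements this is the product of the commuting transpositions
  of j and j + 1 with j in S.\<close>

definition flip :: "nat set \<Rightarrow> nat \<Rightarrow> nat" where
  "flip S i = (if i \<in> S then Suc i else if \<exists>j\<in>S. i = Suc j then i - 1 else i)"

definition rwt :: "nat \<Rightarrow> nat list list \<Rightarrow> (nat \<times> nat \<times> nat \<Rightarrow> nat) \<Rightarrow> nat list" where
  "rwt n lam t = reduced_word n (d_perm lam t)"

definition Xrow :: "nat \<Rightarrow> nat list list \<Rightarrow> bfree" where
  "Xrow n lam = (\<Sum>w\<in>row_stab lam. C (qL ^ perm_length n w) * ZZ (reduced_word n w))"

lemma z_perm_eq: "z_perm n w = ZZ (reduced_word n w)"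
  by (simp add: z_perm_def prodF_eq ZZ_def)

lemma m_elt_eq: "m_elt n lam s t = starF (ZZ (rwt n lam s)) *
    (EE n (lsp_of_comp (comp_of lam)) * (Xrow n lam * ZZ (rwt n lam t)))"
  by (simp add: m_elt_def mulF_eq smultF_eq z_perm_eq rwt_def Xrow_def)

lemma sorted_list_insert_max:
  fixes b :: nat
  assumes "finite A" "\<And>a. a \<in> A \<Longrightarrow> a < b"
  shows "sorted_list_of_set (insert b A) = sorted_list_of_set A @ [b]"
proof (rule sorted_distinct_set_unique)
  show "sorted (sorted_list_of_set A @ [b])" using assms by (auto simp: sorted_append less_imp_le)
  show "distinct (sorted_list_of_set A @ [b])" using assms by auto
  have "finite (insert b A)" using assms by simp
  from set_sorted_list_of_set[OF this]
  show "set (sorted_list_of_set (insert b A)) = set (sorted_list_of_set A @ [b])"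
    using assms(1) by (simp only: set_append set_sorted_list_of_set) simp
qed (rule sorted_sorted_list_of_set distinct_sorted_list_of_set)+

text \<open>Expansion of the product of the 1 + q z_j, each of which is q U_j; this is where the
  power of q comes from.\<close>

lemma sum_subsets_prod:
  assumes "finite A"
  shows "(\<Sum>S\<in>Pow A. C (qL ^ card S) * ZZ (sorted_list_of_set S)) = C (qL ^ card A) * UU (sorted_list_of_set A)"
  using assms
proof (induction A rule: finite_linorder_max_induct)
  case empty
  show ?case by simp
next
  case (insert b A)
  let ?g = "\<lambda>S. C (qL ^ card S) * ZZ (sorted_list_of_set S)"
  have b: "b \<notin> A" using insert by auto
  have step: "?g (insert b S) = ?g S * (C qL * zF b)" if "S \<in> Pow A" for S
  proof -
    have "finite S" "\<And>a. a \<in> S \<Longrightarrow> a < b" "b \<notin> S" using that insert b by (auto intro: finite_subset)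
    note e = sorted_list_insert_max[OF this(1,2)]
    show ?thesis unfolding e using \<open>finite S\<close> \<open>b \<notin> S\<close>
      by (subst e) (simp_all add: C_mult mult.assoc C_left_commute[of "ZZ _"] C_left_commute[of "C qL"])
  qed
  have "sum ?g (Pow (insert b A)) = sum ?g (Pow A) + sum ?g (insert b ` Pow A)"
    unfolding Pow_insert using insert b by (subst sum.union_disjoint) auto
  also have "sum ?g (insert b ` Pow A) = (\<Sum>S\<in>Pow A. ?g (insert b S))"
    using b by (subst sum.reindex) (auto simp: inj_on_def)
  also have "\<dots> = sum ?g (Pow A) * (C qL * zF b)"
    unfolding sum_distrib_right using step by (intro sum.cong) auto
  finally have "sum ?g (Pow (insert b A)) = sum ?g (Pow A) * (1 + C qL * zF b)"
    by (simp add: distrib_left)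
  also have "1 + C qL * zF b = C qL * UF b"
    by (simp add: UF_def distrib_left flip: C_mult)
  also have "sum ?g (Pow A) = C (qL ^ card A) * UU (sorted_list_of_set A)" using insert.IH .
  also have "C (qL ^ card A) * UU (sorted_list_of_set A) * (C qL * UF b)
      = C (qL ^ card (insert b A)) * UU (sorted_list_of_set (insert b A))"
    using insert.hyps(1) b
    by (subst sorted_list_insert_max) (use insert in \<open>simp_all add: C_mult mult.assoc C_left_commute[of "UU _"] C_left_commute[of "C qL"]\<close>)
  finally show ?case .
qed

context two_col
begin

lemma flip_simps:
  assumes "S \<subseteq> pairs lam"
  shows "j \<in> S \<Longrightarrow> flip S j = Suc j" "j \<in> S \<Longrightarrow> flip S (Suc j) = j" "flip S (flip S i) = i"
proof -
  have ap: "Suc j \<notin> S" if "j \<in> S" for j using that pairs_apart assms by blast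
  then show "j \<in> S \<Longrightarrow> flip S j = Suc j" "j \<in> S \<Longrightarrow> flip S (Suc j) = j" by (auto simp: flip_def)
  show "flip S (flip S i) = i" using ap by (auto simp: flip_def)
qed

lemma flip_permutes:
  assumes S: "S \<subseteq> pairs lam"
  shows "flip S permutes {1..n}"
proof (rule bij_imp_permutes)
  have r: "S \<subseteq> {1..<n}" using S pairs_ncut ncut_subset[OF mu_comp] by blast
  show "bij_betw (flip S) {1..n} {1..n}"
  proof (rule bij_betwI[where g = "flip S"])
    show "flip S \<in> {1..n} \<rightarrow> {1..n}" using r by (fastforce simp: flip_def)
    show "flip S \<in> {1..n} \<rightarrow> {1..n}" by fact
  qed (simp_all add: flip_simps[OF S])
  show "flip S i = i" if "i \<notin> {1..n}" for i using that r by (fastforce simp: flip_def)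
qed

text \<open>Rows have at most two entries, so an element of the row stabilizer is determined by the
  set of rows whose entries it exchanges.\<close>

lemma row_stab_eq: "row_stab lam = flip ` Pow (pairs lam)"
proof (intro set_eqI iffI)
  fix w assume "w \<in> row_stab lam"
  then have bij: "bij_betw w {1..n} {1..n}" and out: "\<And>i. i \<notin> {1..n} \<Longrightarrow> w i = i"
    and rows: "\<And>k r c. (k, r, c) \<in> nd \<Longrightarrow> \<exists>c'. (k, r, c') \<in> nd \<and> w (\<tau> (k, r, c)) = \<tau> (k, r, c')"
    by (auto simp: row_stab_def sum_mu)
  define S where "S = {j \<in> pairs lam. w j = Suc j}"
  have S: "S \<subseteq> pairs lam" by (auto simp: S_def)
  have "w i = flip S i" for i
  proof (cases "i \<in> {1..n}")
    case True
    then obtain k r c where x: "(k, r, c) \<in> nd" "\<tau> (k, r, c) = i" using T_node[OF tau_T] by blast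
    show ?thesis
    proof (cases "(k, r, 1) \<in> nd")
      case two: True
      let ?j = "\<tau> (k, r, 0)"
      note nd0 = nd_0[OF two]
      have j: "?j \<in> pairs lam" using two by (auto simp: pairs_iff)
      have j1: "\<tau> (k, r, 1) = Suc ?j" using tau_1[OF two] .
      have in2: "w (\<tau> (k, r, c)) = ?j \<or> w (\<tau> (k, r, c)) = Suc ?j" if "(k, r, c) \<in> nd" for c
        using rows[OF that] j1 nd_c by metis
      have "?j \<in> {1..n}" "Suc ?j \<in> {1..n}" using T_range[OF tau_T nd0] T_range[OF tau_T two] j1 by auto
      then have "w ?j \<noteq> w (Suc ?j)" using bij by (metis bij_betw_def inj_onD n_not_Suc_n)
      then have w: "w ?j = Suc ?j \<and> w (Suc ?j) = ?j \<or> w ?j = ?j \<and> w (Suc ?j) = Suc ?j"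
        using in2[OF nd0] in2[OF two] j1 by auto
      have i: "i = ?j \<or> i = Suc ?j" using x j1 nd_c by metis
      show ?thesis
      proof (cases "?j \<in> S")
        case True
        then show ?thesis using w i flip_simps(1,2)[OF S True] by (auto simp: S_def)
      next
        case False
        have "Suc ?j \<notin> S" using pairs_apart[OF j] S by blast
        moreover have "Suc j' \<noteq> ?j" if "j' \<in> S" for j'
          using pairs_apart[of j'] subsetD[OF S that] j by auto
        ultimately have f: "flip S ?j = ?j" "flip S (Suc ?j) = Suc ?j" using False
          unfolding flip_def by (metis n_not_Suc_n nat.inject)+
        have "w ?j \<noteq> Suc ?j" using False j unfolding S_def by blast
        then have "w ?j = ?j" "w (Suc ?j) = Suc ?j" using w by blast+
        then show ?thesis using i f by metis
      qed
    next
      case one: False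
      have c: "c = 0" using nd_c[OF x(1)] one x(1) by auto
      obtain c' where "(k, r, c') \<in> nd" "w i = \<tau> (k, r, c')" using rows[OF x(1)] x(2) by blast
      moreover have "c' = 0" using nd_c[OF calculation(1)] one calculation(1) by auto
      ultimately have "w i = i" using c x by simp
      moreover have "i \<notin> pairs lam" using tau_not_pair[OF x(1)] one x(2) by auto
      moreover have "\<not> cw lam \<tau> i" using cw_node[OF tau_T x(1)] c x(2) by auto
      ultimately show ?thesis using S by (auto simp: flip_def cw_tau)
    qed
  next
    case False
    then show ?thesis using out permutes_not_in[OF flip_permutes[OF S]] by metis
  qed
  then show "w \<in> flip ` Pow (pairs lam)" using S by blast
next
  fix w assume "w \<in> flip ` Pow (pairs lam)"
  then obtain S where S: "S \<subseteq> pairs lam" and w: "w = flip S" by blast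
  have "\<exists>c'. (k, r, c') \<in> nd \<and> flip S (\<tau> (k, r, c)) = \<tau> (k, r, c')" if nd: "(k, r, c) \<in> nd" for k r c
  proof -
    consider "\<tau> (k, r, c) \<in> S" | j where "\<tau> (k, r, c) = Suc j" "j \<in> S"
      | "\<tau> (k, r, c) \<notin> S" "\<not> (\<exists>j\<in>S. \<tau> (k, r, c) = Suc j)" by blast
    then show ?thesis
    proof cases
      case 1
      then have "c = 0" "(k, r, 1) \<in> nd" using tau_not_pair[OF nd] S by auto
      then show ?thesis using tau_1[of k r] flip_simps(1)[OF S 1] by auto
    next
      case 2
      then have "j \<in> pairs lam" using S by blast
      then obtain k' r' where j: "(k', r', 1) \<in> nd" "\<tau> (k', r', 0) = j" unfolding pairs_iff by blast
      then have "\<tau> (k', r', 1) = \<tau> (k, r, c)" using 2 tau_1 by simp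
      then have "k' = k" "r' = r" using T_inj[OF tau_T j(1) nd] by auto
      then show ?thesis using flip_simps(2)[OF S 2(2)] 2(1) j nd_0[OF j(1)] by auto
    next
      case 3
      then show ?thesis using nd by (auto simp: flip_def)
    qed
  qed
  then show "w \<in> row_stab lam"
    using flip_permutes[OF S] permutes_imp_bij[OF flip_permutes[OF S]]
    by (auto simp: row_stab_def sum_mu w permutes_def)
qed

lemma inj_flip: "inj_on flip (Pow (pairs lam))"
proof (rule inj_onI)
  have "S = {j \<in> pairs lam. flip S j = Suc j}" if "S \<in> Pow (pairs lam)" for S
    using that by (auto simp: flip_def split: if_splits)
  then show "S = S'" if "S \<in> Pow (pairs lam)" "S' \<in> Pow (pairs lam)" "flip S = flip S'" for S S'
    using that by metis
qed

end

context bTL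
begin

text \<open>The descents of \<open>flip S\<close> are the elements of S, so the last letter i of a
  reduced word lies in S and the prefix is reduced for \<open>flip (S - {i})\<close>. The letters
  are pairwise apart, so the factors can be put in increasing order.\<close>

lemma short_word_flip:
  assumes "two_col n lam"
  shows "S \<subseteq> pairs lam \<Longrightarrow> short_word n ws (flip S) \<Longrightarrow>
    ZZ ws \<approx> ZZ (sorted_list_of_set S) \<and> length ws = card S"
proof (induction ws arbitrary: S rule: rev_induct)
  case Nil
  interpret two_col n lam by fact
  have "flip S = id" using Nil short_word_Nil by blast
  then have "S = {}" using flip_simps(1)[OF Nil.prems(1)] by (metis equals0I id_apply n_not_Suc_n)
  then show ?case by simp
next
  case (snoc i ws)
  interpret two_col n lam by fact
  note S = snoc.prems(1)
  note sw = short_word_snoc[OF snoc.prems(2)]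
  have "inv (flip S) = flip S" using flip_simps(3)[OF S] by (metis inv_unique_comp comp_apply id_apply ext)
  then have lt: "flip S (Suc i) < flip S i" using sw(2) by simp
  have i: "i \<in> S" using lt by (auto simp: flip_def split: if_splits)
  have ap: "Suc j \<notin> S" if "j \<in> S" for j using that pairs_apart S by blast
  have "adj_swap i \<circ> flip S = flip (S - {i})"
    using i ap by (fastforce simp: fun_eq_iff flip_def adj_swap_def)
  then have IH: "ZZ ws \<approx> ZZ (sorted_list_of_set (S - {i}))" "length ws = card (S - {i})"
    using snoc.IH[of "S - {i}"] sw(3) S by auto
  have fin: "finite S" using S finite_pairs finite_subset by blast
  have "apart j i" if "j \<in> S" "j \<noteq> i" for j
  proof -
    have "j \<noteq> Suc i" "i \<noteq> Suc j" using ap i that by auto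
    then show ?thesis using that by linarith
  qed
  then have "ZZ (sorted_list_of_set S) \<approx> ZZ (remove1 i (sorted_list_of_set S)) * zF i"
    unfolding ZZ_def using i fin z_far by (intro prod_list_pull_out) auto
  also have "remove1 i (sorted_list_of_set S) = sorted_list_of_set (S - {i})"
    using fin by (simp add: sorted_list_of_set_remove)
  finally have "ZZ (ws @ [i]) \<approx> ZZ (sorted_list_of_set S)"
    using cg_trans[OF cg_right[OF IH(1), of "zF i"] cg_sym] by simp
  moreover have "length (ws @ [i]) = card S" using IH(2) card_Suc_Diff1[OF fin i] by simp
  ultimately show ?case by blast
qed

lemma Xrow_cg:
  assumes "lam \<in> MPar2 n"
  shows "Xrow n lam \<approx> C (qL ^ card (pairs lam)) * UU (sorted_list_of_set (pairs lam))"
proof -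
  interpret two_col n lam by unfold_locales fact
  have tc: "two_col n lam" by unfold_locales
  have "Xrow n lam = (\<Sum>S\<in>Pow (pairs lam). C (qL ^ perm_length n (flip S)) * ZZ (reduced_word n (flip S)))"
    unfolding Xrow_def row_stab_eq by (simp add: sum.reindex[OF inj_flip])
  also have "\<dots> \<approx> (\<Sum>S\<in>Pow (pairs lam). C (qL ^ card S) * ZZ (sorted_list_of_set S))"
  proof (rule cg_sum)
    fix S assume "S \<in> Pow (pairs lam)"
    then have S: "S \<subseteq> pairs lam" by blast
    note * = short_word_flip[OF tc S short_word_reduced[OF flip_permutes[OF S]]]
    then show "C (qL ^ perm_length n (flip S)) * ZZ (reduced_word n (flip S))
        \<approx> C (qL ^ card S) * ZZ (sorted_list_of_set S)"
      by (simp add: perm_length_def cg_left)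
  qed
  also have "\<dots> = C (qL ^ card (pairs lam)) * UU (sorted_list_of_set (pairs lam))"
    by (rule sum_subsets_prod[OF finite_pairs])
  finally show ?thesis .
qed

end

section \<open>The Murphy elements span\<close>

lemma span_mult_left:
  assumes "x \<in> bf.span B" "\<And>b. b \<in> B \<Longrightarrow> a * b \<in> bf.span B'"
  shows "a * x \<in> bf.span B'"
  using assms(1)
proof (induction rule: bf.span_induct_alt)
  case base
  show ?case by (simp add: bf.span_zero)
next
  case (step c x y)
  then show ?case
    using assms(2) by (simp add: distrib_left C_left_commute[of a] bf.span_add bf.span_scale)
qed

text \<open>The coefficients are attached to the indices in \<open>K\<close> rather than to the
  elements \<open>b k\<close>, as in the linear combinations of the cellular axioms.\<close>

lemma span_rep:
  assumes A: "bf.subspace A" and K: "finite K" and x: "x \<in> bf.span (A \<union> b ` K)"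
  shows "\<exists>r. x - (\<Sum>k\<in>K. C (r k) * b k) \<in> A"
  using x
proof (induction rule: bf.span_induct_alt)
  case base
  show ?case using bf.subspace_0[OF A] by (intro exI[of _ "\<lambda>_. 0"]) simp
next
  case (step c x y)
  then obtain r where r: "y - (\<Sum>k\<in>K. C (r k) * b k) \<in> A" by blast
  from step(1) consider "x \<in> A" | k where "k \<in> K" "x = b k" by blast
  then show ?case
  proof cases
    case 1
    then have "C c * x + (y - (\<Sum>k\<in>K. C (r k) * b k)) \<in> A"
      using A r by (intro bf.subspace_add bf.subspace_scale)
    then show ?thesis by (intro exI[of _ r]) (simp add: algebra_simps)
  next
    case 2
    let ?r = "r(k := r k + c)"
    have "(\<Sum>k'\<in>K. C (?r k') * b k') = (\<Sum>k'\<in>K. C (r k') * b k' + (if k' = k then C c * b k else 0))"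
      by (rule sum.cong) (auto simp: C_add algebra_simps)
    also have "\<dots> = (\<Sum>k\<in>K. C (r k) * b k) + C c * x"
      using K 2 by (simp add: sum.distrib sum.delta)
    finally show ?thesis using r by (intro exI[of _ ?r]) (simp add: algebra_simps)
  qed
qed

lemma (in tsideal) subspace_ideal: "bf.subspace J"
  by (simp add: bf.subspace_def Iadd Imult_left)

definition XX :: "nat list list \<Rightarrow> bfree" where "XX lam = UU (sorted_list_of_set (pairs lam))"

text \<open>The Murphy element without its idempotent, which is congruent to 1 modulo its
  annihilator; \<open>m_elt_mm\<close> restores the factor.\<close>

definition mm :: "nat \<Rightarrow> nat list list \<Rightarrow> (nat \<times> nat \<times> nat \<Rightarrow> nat) \<Rightarrow> (nat \<times> nat \<times> nat \<Rightarrow> nat) \<Rightarrow> bfree" where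
  "mm n lam s t = starF (ZZ (rwt n lam s)) * (Xrow n lam * ZZ (rwt n lam t))"

locale comp_ctx = bTL +
  fixes nu :: "nat list"
  assumes nu: "nu \<in> compositions n"

sublocale comp_ctx \<subseteq> c: TL_corner "corner (ncut nu)" "ncut nu"
  using corner_TL_corner[OF ncut_subset[OF nu]] .

context comp_ctx
begin

text \<open>The cell filtration, indexed by the total number of rows of length two. The annihilator
  of the idempotent is included, so that congruences in the corner are available in every
  layer.\<close>

definition Id :: "nat \<Rightarrow> bfree set" where
  "Id d = ideal_gen (corner (ncut nu) \<union> {XX l | l. l \<in> MPar2 n \<and> comp_of l = nu \<and> d \<le> card (pairs l)})"

definition KK :: "nat \<Rightarrow> (nat list list \<times> (nat \<times> nat \<times> nat \<Rightarrow> nat) \<times> (nat \<times> nat \<times> nat \<Rightarrow> nat)) set" where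
  "KK d = {(l, s, t). l \<in> MPar2 n \<and> comp_of l = nu \<and> d \<le> card (pairs l) \<and> s \<in> T_init l \<and> t \<in> T_init l}"

lemma tsi_Id: "two_sided_ideal (Id d)"
  unfolding Id_def by (rule ideal_gen_tsi)

lemma corner_Id: "x \<in> corner (ncut nu) \<Longrightarrow> x \<in> Id d"
  unfolding Id_def by (rule subsetD[OF ideal_gen_base]) blast

lemma XX_Id: "l \<in> MPar2 n \<Longrightarrow> comp_of l = nu \<Longrightarrow> d \<le> card (pairs l) \<Longrightarrow> XX l \<in> Id d"
  unfolding Id_def by (rule subsetD[OF ideal_gen_base]) blast

lemma J_corner: "x \<in> J \<Longrightarrow> x \<in> corner M"
  unfolding corner_def mem_Collect_eq by (rule Imult_left)

end

locale shape = comp_ctx + two_col n lam for lam +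
  assumes comp: "comp_of lam = nu"
begin

abbreviation "sz \<equiv> card (pairs lam)"
abbreviation "rw \<equiv> rwt n lam"

lemma lam_apart: "i \<in> pairs lam \<Longrightarrow> j \<in> pairs lam \<Longrightarrow> i \<noteq> j \<Longrightarrow> apart i j"
proof -
  assume "i \<in> pairs lam" "j \<in> pairs lam" "i \<noteq> j"
  moreover have "j \<noteq> Suc i" "i \<noteq> Suc j" using pairs_apart calculation by blast+
  ultimately show ?thesis by linarith
qed

lemma star_XX: "c.cg (starF (XX lam)) (XX lam)"
  unfolding XX_def starF_UU unfolding UU_def
proof (rule c.prod_list_rev_comm)
  fix i j assume "i \<in> set (sorted_list_of_set (pairs lam))" "j \<in> set (sorted_list_of_set (pairs lam))"
  then show "c.cg (UF i * UF j) (UF j * UF i)"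
    using c.U_comm lam_apart finite_pairs by (cases "i = j") auto
qed

text \<open>Induction that moves j up a column of rows of length one. At the topmost one,
  \<open>XX lam * UF j\<close> is the product of the enlarged shape. Otherwise U_j = U_j U_{j-1}
  U_j, and moving the first U_j to the left of \<open>XX lam\<close> leaves the product for j - 1
  inside.\<close>

lemma base00:
  "j \<in> ncut nu \<Longrightarrow> \<not> cw lam \<tau> j \<Longrightarrow> \<not> cw lam \<tau> (Suc j) \<Longrightarrow> XX lam * UF j \<in> Id (Suc sz)"
proof (induction j rule: less_induct)
  case (less j)
  interpret i: tsideal "Id (Suc sz)" by unfold_locales (rule tsi_Id)
  have j: "j \<in> ncut mu" using less.prems(1) comp by simp
  note bc = base_case[OF j less.prems(2,3)]
  have ap: "apart i j" if "i \<in> pairs lam" for i using bc(1) that by blast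
  from bc(3) consider l where "l \<in> MPar2 n" "comp_of l = mu" "pairs l = insert j (pairs lam)"
    | j' where "j = Suc j'" "j' \<in> ncut mu" "\<not> cw lam \<tau> j'" "\<not> cw lam \<tau> (Suc j')" by blast
  then show ?case
  proof cases
    case 1
    have "card (pairs l) = Suc sz" using 1(3) bc(2) finite_pairs by simp
    then have XI: "XX l \<in> Id (Suc sz)" using XX_Id 1 comp by simp
    have "c.cg (XX l) (UU (remove1 j (sorted_list_of_set (pairs l))) * UF j)"
      unfolding XX_def using 1(3) ap finite_pairs
      by (intro c.UU_pull_out distinct_sorted_list_of_set) (auto simp del: sorted_list_of_set_insert_remove)
    also have "remove1 j (sorted_list_of_set (pairs l)) = sorted_list_of_set (pairs l - {j})"
      using 1(3) finite_pairs by (intro sorted_list_of_set_remove[symmetric]) simp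
    also have "pairs l - {j} = pairs lam" using 1(3) bc(2) by auto
    finally have "c.cg (XX lam * UF j) (XX l)" unfolding XX_def[of lam] by (rule c.cg_sym)
    then have "i.cg (XX lam * UF j) (XX l)" unfolding c.cg_def i.cg_def by (rule corner_Id)
    then show ?thesis using XI by (rule i.cg_mem)
  next
    case 2
    have IH: "XX lam * UF j' \<in> Id (Suc sz)" using less.IH[of j'] 2 comp by simp
    have comm: "c.cg (XX lam * UF j) (UF j * XX lam)"
      unfolding XX_def using ap finite_pairs by (intro c.UU_comm_list) auto
    have "c.cg (XX lam * UF j) (XX lam * (UF j * UF j' * UF j))"
      using 2 less.prems(1) comp by (intro c.cg_left c.cg_sym[OF c.U_TL]) simp_all
    also have "XX lam * (UF j * UF j' * UF j) = XX lam * UF j * (UF j' * UF j)" by (simp add: mult.assoc)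
    also have "c.cg \<dots> (UF j * XX lam * (UF j' * UF j))" using comm by (rule c.cg_right)
    also have "UF j * XX lam * (UF j' * UF j) = UF j * (XX lam * UF j') * UF j" by (simp add: mult.assoc)
    finally have "i.cg (XX lam * UF j) (UF j * (XX lam * UF j') * UF j)"
      unfolding c.cg_def i.cg_def by (rule corner_Id)
    then show ?thesis by (rule i.cg_mem) (intro i.Imult_left i.Imult_right IH)
  qed
qed

end

sublocale shape \<subseteq> cell: TL_cell "corner (ncut nu)" "ncut nu" "Id (Suc (card (pairs lam)))" "pairs lam"
  "T_init lam" "t_lam lam" "cw lam" "\<lambda>i t. adj_swap i \<circ> t" "rwt n lam"
proof unfold_locales
  show "two_sided_ideal (Id (Suc (card (pairs lam))))" by (rule tsi_Id)
  show "corner (ncut nu) \<subseteq> Id (Suc (card (pairs lam)))" using corner_Id by blast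
  show "finite (pairs lam)" by (rule finite_pairs)
  show "pairs lam \<subseteq> ncut nu" using pairs_ncut comp by simp
  show "Suc j \<notin> pairs lam" if "j \<in> pairs lam" for j using pairs_apart that .
  show "cw lam \<tau> i = (\<exists>j\<in>pairs lam. i = Suc j)" for i by (rule cw_tau)
  show "\<tau> \<in> T" by (rule tau_T)
  show "cw lam (adj_swap i \<circ> t) k = cw lam t (adj_swap i k)" for i k t by (rule cw_swap)
  show "adj_swap i \<circ> t \<in> T" if "t \<in> T" "i \<in> ncut nu" "cw lam t i" "\<not> cw lam t (Suc i)" for i t
    using up_T that comp by simp
  show "adj_swap i \<circ> (adj_swap j \<circ> t) \<in> T"
    if "t \<in> T" "i \<in> ncut nu" "j \<in> ncut nu" "apart i j" "adj_swap i \<circ> t \<in> T" "adj_swap j \<circ> t \<in> T" for i j t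
    using diamond_T that comp by simp
  show "adj_swap i \<circ> (adj_swap i \<circ> t) = t" for i t by simp
  show "adj_swap i \<circ> (adj_swap j \<circ> t) = adj_swap j \<circ> (adj_swap i \<circ> t)" if "apart i j" for i j t
    using adj_swap_apart[OF that] by (simp add: fun_eq_iff)
qed

context shape
begin

text \<open>The last letter of a reduced word of d(t) is a descent, hence by
  \<open>descent_T\<close> the last step of an upward path.\<close>

lemma short_word_path: "t \<in> T \<Longrightarrow> short_word n ws (d_perm lam t) \<Longrightarrow> cell.path ws t"
proof (induction ws arbitrary: t rule: rev_induct)
  case Nil
  then have "t = \<tau>" using d_perm_id short_word_Nil by blast
  show ?case unfolding \<open>t = \<tau>\<close> by (rule cell.path.Nil)
next
  case (snoc i ws)
  note sw = short_word_snoc[OF snoc.prems(2)]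
  note d = descent_T[OF snoc.prems(1) sw(1,2)]
  let ?s = "adj_swap i \<circ> t"
  have "short_word n ws (d_perm lam ?s)" unfolding d_perm_swap[OF sw(1)] by (rule sw(3))
  then have "cell.path ws ?s" by (rule snoc.IH[OF d(1)])
  moreover have "cw lam ?s i" "\<not> cw lam ?s (Suc i)" using d(3,4) by (simp_all add: cw_swap)
  moreover have "i \<in> ncut nu" using d(2) comp by simp
  ultimately have "cell.path (ws @ [i]) (adj_swap i \<circ> ?s)" by (intro cell.path.snoc)
  then show ?case unfolding adj_swap_simps(4) .
qed

lemma rw_path: "t \<in> T \<Longrightarrow> cell.path (rw t) t"
  unfolding rwt_def using short_word_path short_word_reduced d_perm_permutes by blast

lemma XP_XX: "cell.XP = XX lam"
  by (simp add: cell.XP_def XX_def)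

lemma rw_tau: "rw \<tau> = []"
proof -
  have "short_word n (rw \<tau>) id"
    using short_word_reduced[OF d_perm_permutes[OF tau_T]] by (simp only: rwt_def d_perm_tau_id)
  then show ?thesis by (rule short_word_id)
qed

lemma Xrow_XX: "c.cg (Xrow n lam) (C (qL ^ sz) * XX lam)"
  using Xrow_cg[OF lam] unfolding cg_def c.cg_def XX_def by (rule J_corner)

lemma star_Xrow: "c.cg (starF (Xrow n lam)) (Xrow n lam)"
proof -
  have "c.cg (starF (Xrow n lam)) (starF (C (qL ^ sz) * XX lam))"
    using c.star_J Xrow_XX by (simp add: c.cg_def flip: starF_diff)
  also have "starF (C (qL ^ sz) * XX lam) = C (qL ^ sz) * starF (XX lam)"
    by (simp add: starF_mult C_commute[of "starF _"])
  also have "c.cg \<dots> (C (qL ^ sz) * XX lam)" using star_XX by (rule c.cg_left)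
  also have "c.cg \<dots> (Xrow n lam)" using Xrow_XX by (rule c.cg_sym)
  finally show ?thesis .
qed

lemma star_mm: "c.cg (starF (mm n lam s t)) (mm n lam t s)"
proof -
  have "starF (mm n lam s t) = starF (ZZ (rw t)) * (starF (Xrow n lam) * ZZ (rw s))"
    by (simp add: mm_def starF_mult mult.assoc)
  also have "c.cg \<dots> (mm n lam t s)"
    unfolding mm_def using star_Xrow by (intro c.cg_left c.cg_right)
  finally show ?thesis .
qed

lemma right_coeffs:
  assumes t: "t \<in> T"
  shows "\<exists>r. XX lam * ZZ (rw t) * a - (\<Sum>t'\<in>T. C (r t') * (XX lam * ZZ (rw t'))) \<in> Id (Suc sz)"
proof (rule span_rep[OF _ finite_T])
  interpret i: tsideal "Id (Suc sz)" by unfold_locales (rule tsi_Id)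
  show "bf.subspace (Id (Suc sz))" by (rule i.subspace_ideal)
  have V: "cell.V = bf.span (Id (Suc sz) \<union> (\<lambda>t. XX lam * ZZ (rw t)) ` T)"
    unfolding cell.V_def XP_XX by (rule arg_cong[where f = bf.span]) blast
  have "XX lam * ZZ (rw t) \<in> cell.V" unfolding V using t by (intro bf.span_base) blast
  then have "XX lam * ZZ (rw t) * a \<in> cell.V"
    by (rule cell.V_mult[rotated -1]) (use base00 rw_path XP_XX in auto)
  then show "XX lam * ZZ (rw t) * a \<in> bf.span (Id (Suc sz) \<union> (\<lambda>t. XX lam * ZZ (rw t)) ` T)"
    unfolding V .
qed

lemma star_Id: "x \<in> Id d \<Longrightarrow> starF x \<in> Id d"
proof -
  interpret i: tsideal "Id d" by unfold_locales (rule tsi_Id)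
  have "Id d \<subseteq> {x. starF x \<in> Id d}"
    unfolding Id_def[of d]
  proof (rule ideal_gen_least, unfold Id_def[of d, symmetric])
    show "two_sided_ideal {x. starF x \<in> Id d}"
      by (auto simp: two_sided_ideal_iff starF_add starF_mult i.Iadd i.Imult_left i.Imult_right)
    have "starF (XX l) \<in> Id d" if l: "l \<in> MPar2 n" "comp_of l = nu" "d \<le> card (pairs l)" for l
    proof -
      interpret l: shape J n nu l by unfold_locales fact+
      have "i.cg (starF (XX l)) (XX l)"
        using l.star_XX unfolding c.cg_def i.cg_def by (rule corner_Id)
      then show ?thesis using XX_Id[OF l] by (rule i.cg_mem)
    qed
    then show "corner (ncut nu) \<union> {XX l |l. l \<in> MPar2 n \<and> comp_of l = nu \<and> d \<le> card (pairs l)}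
        \<subseteq> {x. starF x \<in> Id d}"
      using corner_Id c.star_J by blast
  qed
  then show "x \<in> Id d \<Longrightarrow> starF x \<in> Id d" by blast
qed

lemma mm_right:
  assumes t: "t \<in> T"
  shows "\<exists>r. mm n lam s t * a - (\<Sum>t'\<in>T. C (r t') * mm n lam s t') \<in> Id (Suc sz)"
proof -
  interpret i: tsideal "Id (Suc sz)" by unfold_locales (rule tsi_Id)
  let ?S = "starF (ZZ (rw s)) * C (qL ^ sz)"
  obtain r where r: "XX lam * ZZ (rw t) * a - (\<Sum>t'\<in>T. C (r t') * (XX lam * ZZ (rw t'))) \<in> Id (Suc sz)"
    using right_coeffs[OF t] by blast
  have m: "i.cg (mm n lam s t) (?S * (XX lam * ZZ (rw t)))" for t
  proof -
    have "c.cg (mm n lam s t) (starF (ZZ (rw s)) * (C (qL ^ sz) * XX lam * ZZ (rw t)))"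
      unfolding mm_def using Xrow_XX by (intro c.cg_left c.cg_right)
    then show ?thesis unfolding c.cg_def i.cg_def mult.assoc by (rule corner_Id)
  qed
  have "i.cg (mm n lam s t * a - (\<Sum>t'\<in>T. C (r t') * mm n lam s t'))
      (?S * (XX lam * ZZ (rw t)) * a - (\<Sum>t'\<in>T. C (r t') * (?S * (XX lam * ZZ (rw t')))))"
    by (intro i.cg_diff i.cg_right i.cg_sum i.cg_left m)
  also have "?S * (XX lam * ZZ (rw t)) * a - (\<Sum>t'\<in>T. C (r t') * (?S * (XX lam * ZZ (rw t'))))
      = ?S * (XX lam * ZZ (rw t) * a - (\<Sum>t'\<in>T. C (r t') * (XX lam * ZZ (rw t'))))"
    by (simp add: right_diff_distrib sum_distrib_left mult.assoc C_left_commute[of "starF _"] C_left_commute[of "C (qL ^ _)"])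
  finally show ?thesis using i.cg_mem i.Imult_left[OF r] by blast
qed

text \<open>Apply the anti-involution to \<open>right_coeffs\<close> for \<open>starF a\<close>. The
  coefficients are fixed before t enters, as (C3) requires.\<close>

lemma mm_left:
  assumes s: "s \<in> T"
  shows "\<exists>r. \<forall>t. a * mm n lam s t - (\<Sum>s'\<in>T. C (r s') * mm n lam s' t) \<in> Id (Suc sz)"
proof -
  interpret i: tsideal "Id (Suc sz)" by unfold_locales (rule tsi_Id)
  obtain r where r: "XX lam * ZZ (rw s) * starF a - (\<Sum>t'\<in>T. C (r t') * (XX lam * ZZ (rw t'))) \<in> Id (Suc sz)"
    using right_coeffs[OF s] by blast
  let ?y = "a * (starF (ZZ (rw s)) * starF (XX lam)) - (\<Sum>t'\<in>T. C (r t') * (starF (ZZ (rw t')) * starF (XX lam)))"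
  have y: "?y \<in> Id (Suc sz)"
    using star_Id[OF r] by (simp add: starF_diff starF_sum starF_mult C_commute[of "_ * _"])
  have "a * mm n lam s t - (\<Sum>s'\<in>T. C (r s') * mm n lam s' t) \<in> Id (Suc sz)" for t
  proof -
    let ?Z = "C (qL ^ sz) * ZZ (rw t)"
    have m: "i.cg (mm n lam s t) (starF (ZZ (rw s)) * starF (XX lam) * ?Z)" for s
    proof -
      have "c.cg (mm n lam s t) (starF (ZZ (rw s)) * (C (qL ^ sz) * XX lam * ZZ (rw t)))"
        unfolding mm_def using Xrow_XX by (intro c.cg_left c.cg_right)
      also have "c.cg \<dots> (starF (ZZ (rw s)) * (C (qL ^ sz) * starF (XX lam) * ZZ (rw t)))"
        by (intro c.cg_left c.cg_right) (rule c.cg_sym[OF star_XX])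
      also have "\<dots> = starF (ZZ (rw s)) * starF (XX lam) * ?Z"
        by (simp add: mult.assoc C_left_commute[of "starF _"])
      finally show ?thesis unfolding c.cg_def i.cg_def by (rule corner_Id)
    qed
    have "i.cg (a * mm n lam s t - (\<Sum>s'\<in>T. C (r s') * mm n lam s' t))
        (a * (starF (ZZ (rw s)) * starF (XX lam) * ?Z) - (\<Sum>s'\<in>T. C (r s') * (starF (ZZ (rw s')) * starF (XX lam) * ?Z)))"
      by (intro i.cg_diff i.cg_sum i.cg_left m)
    also have "\<dots> = ?y * ?Z"
      by (simp add: left_diff_distrib sum_distrib_right mult.assoc)
    finally show ?thesis using i.cg_mem i.Imult_right[OF y] by blast
  qed
  then show ?thesis by blast
qed

end

context comp_ctx
begin

lemma shapeI: "l \<in> MPar2 n \<Longrightarrow> comp_of l = nu \<Longrightarrow> shape J n nu l"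
  by unfold_locales

lemma finite_KK: "finite (KK d)"
proof (rule finite_subset)
  show "KK d \<subseteq> (SIGMA l : {l \<in> MPar2 n. comp_of l = nu}. T_init l \<times> T_init l)"
    by (auto simp: KK_def)
  show "finite (SIGMA l : {l \<in> MPar2 n. comp_of l = nu}. T_init l \<times> T_init l)"
    using finite_MPar2
    by (intro finite_SigmaI finite_cartesian_product) (auto intro!: two_col.finite_T[of n] two_col.intro)
qed

abbreviation mmk :: "nat list list \<times> (nat \<times> nat \<times> nat \<Rightarrow> nat) \<times> (nat \<times> nat \<times> nat \<Rightarrow> nat) \<Rightarrow> bfree" where
  "mmk k \<equiv> (case k of (l, s, t) \<Rightarrow> mm n l s t)"

definition MM :: "nat \<Rightarrow> bfree set" where
  "MM d = bf.span (corner (ncut nu) \<union> mmk ` KK d)"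

text \<open>By \<open>mm_left\<close> and \<open>mm_right\<close> the span is a two-sided ideal, so
  it suffices that it contains the generators of \<open>Id d\<close>.\<close>

lemma Id_step: "Id d \<subseteq> bf.span (Id (Suc d) \<union> mmk ` {k \<in> KK d. card (pairs (fst k)) = d})"
  (is "_ \<subseteq> bf.span (_ \<union> ?B)")
  unfolding Id_def[of d]
proof (rule ideal_gen_least)
  let ?R = "bf.span (Id (Suc d) \<union> ?B)"
  interpret i: tsideal "Id (Suc d)" by unfold_locales (rule tsi_Id)
  have sumR: "x \<in> ?R" if "x - (\<Sum>t\<in>A. C (r t) * f t) \<in> Id (Suc d)" "\<And>t. t \<in> A \<Longrightarrow> f t \<in> ?R" for x A r f
  proof -
    have "(x - (\<Sum>t\<in>A. C (r t) * f t)) + (\<Sum>t\<in>A. C (r t) * f t) \<in> ?R"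
      using that by (intro bf.span_add bf.span_sum bf.span_scale) (auto intro: bf.span_base)
    then show ?thesis by simp
  qed
  have mmR: "mm n l s t \<in> ?R" if "l \<in> MPar2 n" "comp_of l = nu" "card (pairs l) = d" "s \<in> T_init l" "t \<in> T_init l" for l s t
    by (rule bf.span_base, rule UnI2, rule image_eqI[where x = "(l, s, t)"]) (use that in \<open>auto simp: KK_def\<close>)
  have right: "b * a \<in> ?R" and left: "a * b \<in> ?R" if "b \<in> Id (Suc d) \<union> ?B" for a b
  proof -
    have "b * a \<in> ?R \<and> a * b \<in> ?R"
      using that
    proof
      assume "b \<in> Id (Suc d)"
      then show ?thesis using i.Imult_left i.Imult_right by (auto intro: bf.span_base)
    next
      assume "b \<in> ?B"
      then obtain l s t where l: "l \<in> MPar2 n" "comp_of l = nu" "card (pairs l) = d" "s \<in> T_init l" "t \<in> T_init l"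
        and b: "b = mm n l s t" by (auto simp: KK_def)
      interpret l: shape J n nu l using shapeI l by blast
      obtain r where r: "mm n l s t * a - (\<Sum>t'\<in>T_init l. C (r t') * mm n l s t') \<in> Id (Suc d)"
        using l.mm_right[OF l(5)] l(3) by blast
      obtain r' where r': "a * mm n l s t - (\<Sum>s'\<in>T_init l. C (r' s') * mm n l s' t) \<in> Id (Suc d)"
        using l.mm_left[OF l(4)] l(3) by blast
      have "b * a \<in> ?R" unfolding b by (rule sumR[OF r]) (use mmR l in blast)
      moreover have "a * b \<in> ?R" unfolding b by (rule sumR[OF r']) (use mmR l in blast)
      ultimately show ?thesis by blast
    qed
    then show "b * a \<in> ?R" "a * b \<in> ?R" by auto
  qed
  show "two_sided_ideal ?R"
    unfolding two_sided_ideal_iff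
  proof (intro conjI ballI allI)
    show "a * x \<in> ?R" "x * a \<in> ?R" if "x \<in> ?R" for x a
      using span_mult_left[OF that left] span_mult_right[OF that right] by blast+
  qed (simp_all add: bf.span_zero bf.span_add)
  show "corner (ncut nu) \<union> {XX l |l. l \<in> MPar2 n \<and> comp_of l = nu \<and> d \<le> card (pairs l)} \<subseteq> ?R"
  proof (intro Un_least subsetI)
    fix x assume "x \<in> corner (ncut nu)"
    then show "x \<in> ?R" using corner_Id by (intro bf.span_base) blast
  next
    fix x assume "x \<in> {XX l |l. l \<in> MPar2 n \<and> comp_of l = nu \<and> d \<le> card (pairs l)}"
    then obtain l where l: "l \<in> MPar2 n" "comp_of l = nu" "d \<le> card (pairs l)" and x: "x = XX l" by blast
    interpret l: shape J n nu l using shapeI l by blast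
    show "x \<in> ?R"
    proof (cases "card (pairs l) = d")
      case True
      \<comment> \<open>Both words of the initial tableau are empty, so this Murphy element is the
        row symmetrizer, which is q^d times \<open>XX l\<close> in the corner.\<close>
      have "mm n l (t_lam l) (t_lam l) \<in> ?R" using mmR[OF l(1,2) True] l.tau_T by blast
      then have "C (qinv ^ d) * Xrow n l \<in> ?R" by (simp add: mm_def l.rw_tau bf.span_scale)
      moreover have "XX l - C (qinv ^ d) * Xrow n l \<in> corner (ncut nu)"
      proof -
        have "C (qinv ^ d) * (C (qL ^ d) * XX l) = XX l"
          by (simp add: mult.assoc[symmetric] flip: C_mult power_mult_distrib)
        moreover have "c.cg (C (qinv ^ d) * (C (qL ^ d) * XX l)) (C (qinv ^ d) * Xrow n l)"
          using l.Xrow_XX True by (intro c.cg_left c.cg_sym[of "Xrow n l"]) simp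
        ultimately show ?thesis by (simp add: c.cg_def)
      qed
      ultimately have "(XX l - C (qinv ^ d) * Xrow n l) + C (qinv ^ d) * Xrow n l \<in> ?R"
        using corner_Id by (intro bf.span_add) (auto intro: bf.span_base)
      then show ?thesis by (simp add: x)
    next
      case False
      then show ?thesis using XX_Id[of l "Suc d"] l x by (intro bf.span_base) auto
    qed
  qed
qed

text \<open>Downward induction on d, run on n - d: for positive d with \<open>n \<le> d\<close> no
  shape has d pairs, and the layer is the annihilator itself.\<close>

lemma Id_MM: "Id d \<subseteq> MM d"
proof (induction "n - d" arbitrary: d)
  case 0
  have "card (pairs l) < d" if "l \<in> MPar2 n" "comp_of l = nu" "d > 0" for l
  proof -
    interpret l: shape J n nu l using shapeI that by blast
    have "card (pairs l) \<le> card {1..<n}"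
      using l.pairs_ncut ncut_subset[OF l.mu_comp] by (intro card_mono) auto
    then show ?thesis using 0 that(3) by simp
  qed
  note small = this
  show ?case
  proof (cases "d = 0")
    \<comment> \<open>This happens only for n = 0, where \<open>small\<close> says nothing: the
      empty shape has no pairs and belongs to layer 0, so \<open>Id_step\<close> is applied
      once.\<close>
    case True
    with 0 have n: "n = 0" by simp
    have "pairs l = {}" if "l \<in> MPar2 n" for l
    proof -
      interpret two_col n l by unfold_locales fact
      show ?thesis using pairs_ncut ncut_subset[OF mu_comp] n by auto
    qed
    then have "Id (Suc d) \<subseteq> corner (ncut nu)"
      unfolding Id_def using c.tsi by (intro ideal_gen_least) auto
    moreover have "Id d \<subseteq> bf.span (Id (Suc d) \<union> mmk ` {k \<in> KK d. card (pairs (fst k)) = d})"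
      by (rule Id_step)
    moreover have "bf.span (Id (Suc d) \<union> mmk ` {k \<in> KK d. card (pairs (fst k)) = d}) \<subseteq> MM d"
      unfolding MM_def using calculation(1) by (intro bf.span_mono) blast
    ultimately show ?thesis by blast
  next
    case False
    then have "\<not> d \<le> card (pairs l)" if "l \<in> MPar2 n" "comp_of l = nu" for l
      using small[OF that] by simp
    then have "Id d \<subseteq> corner (ncut nu)"
      unfolding Id_def using c.tsi by (intro ideal_gen_least) blast+
    then show ?thesis unfolding MM_def by (auto intro: bf.span_base)
  qed
next
  case (Suc m)
  then have IH: "Id (Suc d) \<subseteq> MM (Suc d)" by simp
  have "KK (Suc d) \<subseteq> KK d" by (auto simp: KK_def)
  then have "MM (Suc d) \<subseteq> MM d" unfolding MM_def by (intro bf.span_mono Un_mono image_mono) auto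
  with IH have I: "Id (Suc d) \<subseteq> MM d" by blast
  have "x \<in> MM d" if "x \<in> bf.span (Id (Suc d) \<union> mmk ` {k \<in> KK d. card (pairs (fst k)) = d})" for x
    unfolding MM_def
  proof (rule span_subsetI[OF _ that])
    fix b assume "b \<in> Id (Suc d) \<union> mmk ` {k \<in> KK d. card (pairs (fst k)) = d}"
    then consider "b \<in> Id (Suc d)" | "b \<in> mmk ` KK d" by blast
    then show "b \<in> bf.span (corner (ncut nu) \<union> mmk ` KK d)"
      using I unfolding MM_def by cases (blast, intro bf.span_base UnI2)
  qed
  then show ?case using Id_step by blast
qed

text \<open>The witness has a single column in each component, so there are no pairs and
  \<open>XX\<close> is the empty product. Hence layer 0 is the whole algebra.\<close>

lemma one_Id: "1 \<in> Id 0"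
proof -
  let ?l = "map (\<lambda>m. replicate m 1) nu"
  have pos: "\<forall>x\<in>set nu. 0 < x" "sum_list nu = n" using nu by (auto simp: compositions_def)
  have sums: "map sum_list ?l = nu" by (simp add: comp_def sum_list_replicate)
  have l: "?l \<in> MPar2 n" "comp_of ?l = nu"
    using pos sums by (auto simp: MPar2_def multipartitions_def comp_of_def sorted_wrt_iff_nth_less simp del: map_map)
  interpret l: two_col n ?l by unfold_locales fact
  have "(k, r, 1) \<notin> nodes ?l" for k r
    by (cases "k < length nu") (auto simp: nodes_def)
  then have "pairs ?l = {}" unfolding l.pairs_iff[abs_def] set_eq_iff by blast
  then have "XX ?l = 1" by (simp add: XX_def)
  then show ?thesis using XX_Id[OF l, of 0] by simp
qed

lemma spanning: "\<exists>r. x - (\<Sum>k\<in>KK 0. C (r k) * mmk k) \<in> corner (ncut nu)"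
proof (rule span_rep[OF c.subspace_ideal finite_KK])
  interpret i: tsideal "Id 0" by unfold_locales (rule tsi_Id)
  have "x \<in> Id 0" using i.Imult_right[OF one_Id, of x] by simp
  then show "x \<in> bf.span (corner (ncut nu) \<union> mmk ` KK 0)" using Id_MM by (auto simp: MM_def)
qed

lemma C3:
  assumes l: "l \<in> MPar2 n" "comp_of l = nu" and s: "s \<in> T_init l"
  shows "\<exists>r. \<forall>t. \<exists>r'. a * mm n l s t - (\<Sum>s'\<in>T_init l. C (r s') * mm n l s' t)
    - (\<Sum>k\<in>KK (Suc (card (pairs l))). C (r' k) * mmk k) \<in> corner (ncut nu)"
proof -
  interpret l: shape J n nu l using shapeI l by blast
  obtain r where r: "\<forall>t. a * mm n l s t - (\<Sum>s'\<in>T_init l. C (r s') * mm n l s' t) \<in> Id (Suc (card (pairs l)))"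
    using l.mm_left[OF s] by blast
  have "\<exists>r'. a * mm n l s t - (\<Sum>s'\<in>T_init l. C (r s') * mm n l s' t)
    - (\<Sum>k\<in>KK (Suc (card (pairs l))). C (r' k) * mmk k) \<in> corner (ncut nu)" for t
    using r Id_MM by (intro span_rep[OF c.subspace_ideal finite_KK]) (auto simp: MM_def)
  then show ?thesis by blast
qed

end

section \<open>Linear independence\<close>

text \<open>The height of a word. An upward step raises it by one, and leading words of the vectors
  \<open>G\<close> are taken with respect to it.\<close>

definition psum :: "(nat \<Rightarrow> bool) \<Rightarrow> nat" where "psum u = \<Sum>{i. u i}"

lemma words_finite: "u \<in> words n \<Longrightarrow> finite {i. u i}"
  by (rule finite_subset[of _ "{1..n}"]) (auto simp: words_def)

lemma psum_swap:
  assumes fin: "finite {i. u i}" and u: "u j" "\<not> u (Suc j)"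
  shows "psum (u \<circ> adj_swap j) = Suc (psum u)"
proof -
  let ?A = "{i. u i} - {j}"
  have eq: "{i. (u \<circ> adj_swap j) i} = insert (Suc j) ?A" using u by (auto simp: adj_swap_def)
  have "psum (u \<circ> adj_swap j) = Suc j + \<Sum>?A"
    unfolding psum_def eq using fin u by (subst sum.insert) auto
  moreover have "psum u = j + \<Sum>?A" unfolding psum_def using fin u by (intro sum.remove) auto
  ultimately show ?thesis by simp
qed

lemma psum_swap':
  assumes fin: "finite {i. u i}" and u: "\<not> u j" "u (Suc j)"
  shows "psum u = Suc (psum (u \<circ> adj_swap j))"
proof -
  have "{i. (u \<circ> adj_swap j) i} \<subseteq> insert j {i. u i}"
    using u by (auto simp: adj_swap_def split: if_splits)
  then have "finite {i. (u \<circ> adj_swap j) i}" by (rule finite_subset) (use fin in simp)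
  from psum_swap[of "u \<circ> adj_swap j" j, OF this] u show ?thesis by (simp add: swap_swap)
qed

context shape
begin

abbreviation "R \<equiv> rho (ncut nu)"

lemma N_range: "ncut nu \<subseteq> {1..<n}"
  by (rule ncut_subset[OF nu])

lemma R_cg: "c.cg x y \<Longrightarrow> R x f u = R y f u"
  using corner_ker[OF N_range, of "x - y" f u] by (simp add: c.cg_def rho_diff)

definition W :: "(nat \<Rightarrow> bool) set" where
  "W = {u \<in> words n. \<forall>k<length lam. card {i \<in> block mu k. u i} = card (pairs lam \<inter> block mu k)}"

lemma W_swap:
  assumes u: "u \<in> W" and i: "i \<in> ncut nu"
  shows "u \<circ> adj_swap i \<in> W"
proof -
  have "{k' \<in> block mu k. (u \<circ> adj_swap i) k'} = adj_swap i ` {k' \<in> block mu k. u k'}" for k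
  proof (intro set_eqI iffI)
    fix x assume x: "x \<in> {k' \<in> block mu k. (u \<circ> adj_swap i) k'}"
    then have "adj_swap i x \<in> {k' \<in> block mu k. u k'}" using block_swap i comp by simp
    then have "adj_swap i (adj_swap i x) \<in> adj_swap i ` {k' \<in> block mu k. u k'}" by (rule imageI)
    then show "x \<in> adj_swap i ` {k' \<in> block mu k. u k'}" by simp
  qed (use block_swap i comp in auto)
  then have "card {k' \<in> block mu k. (u \<circ> adj_swap i) k'} = card {k' \<in> block mu k. u k'}" for k
    by (simp add: card_image inj_on_subset[OF inj_adj_swap])
  moreover have "u \<circ> adj_swap i \<in> words n" using words_swap u i N_range by (auto simp: W_def)
  ultimately show ?thesis using u by (simp add: W_def)
qed

lemma cw_W: "t \<in> T \<Longrightarrow> cw lam t \<in> W"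
proof -
  assume t: "t \<in> T"
  have "cw lam t \<in> words n" unfolding words_def cw_def using T_range[OF t] by blast
  then show ?thesis unfolding W_def using card_cw[OF t] card_pairs_block by simp
qed

lemma R_UF:
  assumes "j \<in> ncut nu"
  shows "R (UF j) f u = zact j f u + qinv * f u"
  using assms by (simp add: UF_def rho_add rho_z rho_C)

text \<open>\<open>XX lam\<close> begins with U_j up to commutation, and a function in the image of
  U_j vanishes where the letters at j, j + 1 agree and has at 10 the value q times that at
  01.\<close>

lemma XX_local:
  assumes j: "j \<in> pairs lam"
  shows "u j = u (Suc j) \<Longrightarrow> R (XX lam) f u = 0"
    and "u j \<Longrightarrow> \<not> u (Suc j) \<Longrightarrow> R (XX lam) f u = qL * R (XX lam) f (u \<circ> adj_swap j)"
proof -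
  let ?y = "UU (sorted_list_of_set (pairs lam - {j}))"
  have "c.cg (XX lam) (?y * UF j)" using cell.XP_pull[OF j] by (simp add: XP_XX)
  also have "c.cg (?y * UF j) (UF j * ?y)"
    using lam_apart[OF _ j] finite_pairs by (intro c.UU_comm_list) auto
  finally have X: "R (XX lam) f u = R (UF j) (R ?y f) u" for u
    using R_cg by (simp add: rho_mult)
  have jN: "j \<in> ncut nu" using j pairs_ncut comp by blast
  show "u j = u (Suc j) \<Longrightarrow> R (XX lam) f u = 0"
    unfolding X R_UF[OF jN] by (simp add: zact_def)
  show "u j \<Longrightarrow> \<not> u (Suc j) \<Longrightarrow> R (XX lam) f u = qL * R (XX lam) f (u \<circ> adj_swap j)"
    unfolding X R_UF[OF jN] by (simp add: zact_def swap_swap algebra_simps)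
qed

text \<open>The tensor product over the pairs of the vector with value 1 at 01 and q at 10. By
  \<open>XX_G0\<close> every image under \<open>XX lam\<close> is on \<open>W\<close> a multiple of
  it.\<close>

definition G0 :: wfun where
  "G0 u = (if \<forall>j\<in>pairs lam. u j \<noteq> u (Suc j) then qL ^ card {j \<in> pairs lam. u j} else 0)"

text \<open>If every pair reads 01, the pairs already use up all the ones that \<open>W\<close>
  allows in each block.\<close>

lemma W_no_inversion:
  assumes u: "u \<in> W" and d: "\<forall>j\<in>pairs lam. u j \<noteq> u (Suc j)" and z: "card {j \<in> pairs lam. u j} = 0"
  shows "u = cw lam \<tau>"
proof
  fix i
  have "\<not> u j" if "j \<in> pairs lam" for j using z finite_pairs that by auto
  then have S: "u (Suc j)" if "j \<in> pairs lam" for j using d that by blast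
  show "u i = cw lam \<tau> i"
  proof (cases "i \<in> {1..n}")
    case True
    then obtain k where "k < length lam" "i \<in> block mu k" using block_cover by blast
    then show ?thesis using pairs_count_eq[of u k i] S u by (simp add: W_def)
  next
    case False
    then show ?thesis using u cw_W[OF tau_T] by (auto simp: W_def words_def)
  qed
qed

text \<open>Turning one pair from 10 to 01 takes out a factor q and raises \<open>psum\<close> by
  one; when all pairs are turned, the word is that of the initial tableau.\<close>

lemma XX_W:
  assumes "u \<in> W" "\<forall>j\<in>pairs lam. u j \<noteq> u (Suc j)"
  shows "R (XX lam) f u = qL ^ card {j \<in> pairs lam. u j} * R (XX lam) f (cw lam \<tau>)"
    and "psum u + card {j \<in> pairs lam. u j} = psum (cw lam \<tau>)"
proof -
  have "R (XX lam) f u = qL ^ card {j \<in> pairs lam. u j} * R (XX lam) f (cw lam \<tau>) \<and>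
     psum u + card {j \<in> pairs lam. u j} = psum (cw lam \<tau>)"
    using assms
  proof (induction "card {j \<in> pairs lam. u j}" arbitrary: u)
    case 0
    then have "u = cw lam \<tau>" using W_no_inversion by simp
    then show ?case using 0 by simp
  next
    case (Suc m)
    then have "{j \<in> pairs lam. u j} \<noteq> {}" by (metis card.empty nat.distinct(1))
    then obtain j where j: "j \<in> pairs lam" "u j" by blast
    then have uS: "\<not> u (Suc j)" using Suc.prems by blast
    let ?v = "u \<circ> adj_swap j"
    have fix': "?v i = u i" "?v (Suc i) = u (Suc i)" if "i \<in> pairs lam" "i \<noteq> j" for i
      using lam_apart[OF that(1) j(1) that(2)] by (auto simp: adj_swap_def)
    have set: "{i \<in> pairs lam. ?v i} = {i \<in> pairs lam. u i} - {j}"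
    proof (intro set_eqI iffI)
      fix i assume i: "i \<in> {i \<in> pairs lam. ?v i}"
      then have "i \<noteq> j" using uS by auto
      then show "i \<in> {i \<in> pairs lam. u i} - {j}" using i fix'(1)[of i] by simp
    next
      fix i assume "i \<in> {i \<in> pairs lam. u i} - {j}"
      then show "i \<in> {i \<in> pairs lam. ?v i}" using fix'(1)[of i] by simp
    qed
    have card: "card {i \<in> pairs lam. u i} = Suc (card {i \<in> pairs lam. ?v i})"
      unfolding set using j finite_pairs by (intro card.remove) auto
    have v: "?v \<in> W" using W_swap[OF Suc.prems(1)] j(1) pairs_ncut comp by blast
    have vd: "\<forall>i\<in>pairs lam. ?v i \<noteq> ?v (Suc i)"
    proof
      fix i assume "i \<in> pairs lam"
      then show "?v i \<noteq> ?v (Suc i)"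
        using fix'[of i] Suc.prems(2) j(2) uS by (cases "i = j") auto
    qed
    have "m = card {j \<in> pairs lam. ?v j}" using Suc.hyps(2) card by linarith
    note IH = Suc.hyps(1)[OF this v vd]
    have "psum ?v = Suc (psum u)"
      by (rule psum_swap[OF words_finite[of u n] j(2) uS]) (use Suc.prems(1) in \<open>simp add: W_def\<close>)
    moreover have "R (XX lam) f u = qL * R (XX lam) f ?v" using XX_local(2)[OF j(1) j(2) uS] .
    ultimately show ?case unfolding card power_Suc mult.assoc using IH by (intro conjI) (simp, linarith)
  qed
  then show "R (XX lam) f u = qL ^ card {j \<in> pairs lam. u j} * R (XX lam) f (cw lam \<tau>)"
    and "psum u + card {j \<in> pairs lam. u j} = psum (cw lam \<tau>)" by blast+
qed

lemma G0_1: "\<forall>j\<in>pairs lam. u j \<noteq> u (Suc j) \<Longrightarrow> G0 u = qL ^ card {j \<in> pairs lam. u j}"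
  and G0_0: "j \<in> pairs lam \<Longrightarrow> u j = u (Suc j) \<Longrightarrow> G0 u = 0"
  unfolding G0_def by meson+

lemma XX_G0:
  assumes u: "u \<in> W"
  shows "R (XX lam) f u = G0 u * R (XX lam) f (cw lam \<tau>)"
proof (cases "\<forall>j\<in>pairs lam. u j \<noteq> u (Suc j)")
  case True
  show ?thesis unfolding G0_1[OF True] by (rule XX_W(1)[OF u True])
next
  case False
  then obtain j where "j \<in> pairs lam" "u j = u (Suc j)" by blast
  then show ?thesis using XX_local(1) G0_0 by simp
qed

lemma cw_tau_01: "j \<in> pairs lam \<Longrightarrow> \<not> cw lam \<tau> j \<and> cw lam \<tau> (Suc j)"
  using pairs_apart by (auto simp: cw_tau)

lemma G0_tri:
  assumes "u \<in> W" "psum (cw lam \<tau>) \<le> psum u"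
  shows "G0 u = (if u = cw lam \<tau> then 1 else 0)"
proof (cases "\<forall>j\<in>pairs lam. u j \<noteq> u (Suc j)")
  case True
  have z: "card {j \<in> pairs lam. u j} = 0" using XX_W(2)[OF assms(1) True] assms(2) by linarith
  have "G0 u = 1" using G0_1[OF True] z by simp
  then show ?thesis using W_no_inversion[OF assms(1) True z] by simp
next
  case False
  then obtain j where j: "j \<in> pairs lam" "u j = u (Suc j)" by blast
  then have "u \<noteq> cw lam \<tau>" using cw_tau_01[OF j(1)] by blast
  then show ?thesis using G0_0[of _ u, OF j] by simp
qed

text \<open>\<open>starF\<close> reverses the word, so that appending a letter i applies
  \<open>zact i\<close> last, in step with the construction of paths.\<close>

definition G :: "nat list \<Rightarrow> wfun" where "G ws = R (starF (ZZ ws)) G0"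

lemma G_snoc: "i \<in> ncut nu \<Longrightarrow> G (ws @ [i]) u = zact i (G ws) u"
  by (simp add: G_def starF_mult rho_mult rho_z)

text \<open>An upward step lifts the leading word by one in \<open>psum\<close>. At a word u of at
  least that height the old vector vanishes, so only the value at the swapped word remains, and it
  is nonzero only if that word is the old leading word.\<close>

lemma G_tri:
  assumes "cell.path ws t" "u \<in> W" "psum (cw lam t) \<le> psum u"
  shows "G ws u = (if u = cw lam t then 1 else 0)"
  using assms
proof (induction arbitrary: u rule: cell.path.induct)
  case Nil
  then show ?case using G0_tri by (simp add: G_def)
next
  case (snoc ws t i)
  let ?w = "cw lam t" and ?w' = "cw lam (adj_swap i \<circ> t)"
  have w': "?w' = ?w \<circ> adj_swap i" by (rule ext) (simp add: cw_swap)
  have tT: "t \<in> T" using cell.path_T[OF snoc.hyps(1)] .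
  have "finite {k. ?w k}" using cw_W[OF tT] words_finite by (auto simp: W_def)
  then have ps: "psum ?w' = Suc (psum ?w)" unfolding w' using snoc.hyps(3,4) by (rule psum_swap)
  have fu: "finite {k. u k}" using snoc.prems(1) words_finite by (auto simp: W_def)
  have su: "u \<circ> adj_swap i \<in> W" using W_swap snoc.prems(1) snoc.hyps(2) by blast
  have "psum ?w < psum u" using snoc.prems(2) ps by linarith
  then have Gu: "G ws u = 0" using snoc.IH[OF snoc.prems(1)] by auto
  have w'i: "\<not> ?w' i" "?w' (Suc i)" using snoc.hyps(3,4) by (simp_all add: w')
  consider "u i = u (Suc i)" | "u i" "\<not> u (Suc i)" | "\<not> u i" "u (Suc i)" by blast
  then show ?case
  proof cases
    case 1
    then have "u \<noteq> ?w'" using w'i by metis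
    then show ?thesis unfolding if_not_P[OF \<open>u \<noteq> ?w'\<close>] G_snoc[OF snoc.hyps(2)] using 1 Gu by (simp add: zact_def)
  next
    case 2
    have "psum (u \<circ> adj_swap i) = Suc (psum u)" using psum_swap[OF fu 2] .
    then have "psum ?w < psum (u \<circ> adj_swap i)" using snoc.prems(2) ps by linarith
    then have ne: "u \<circ> adj_swap i \<noteq> ?w" and le: "psum ?w \<le> psum (u \<circ> adj_swap i)" by (metis less_irrefl, linarith)
    have "G ws (u \<circ> adj_swap i) = (if u \<circ> adj_swap i = ?w then 1 else 0)" using le by (rule snoc.IH[OF su])
    then have "G ws (u \<circ> adj_swap i) = 0" unfolding if_not_P[OF ne] .
    moreover have "u \<noteq> ?w'" using 2 w'i by metis
    ultimately show ?thesis unfolding if_not_P[OF \<open>u \<noteq> ?w'\<close>] G_snoc[OF snoc.hyps(2)]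
      using 2 Gu by (simp add: zact_def)
  next
    case 3
    have "psum u = Suc (psum (u \<circ> adj_swap i))" using psum_swap'[OF fu 3] .
    then have "psum ?w \<le> psum (u \<circ> adj_swap i)" using snoc.prems(2) ps by linarith
    then have "G ws (u \<circ> adj_swap i) = (if u \<circ> adj_swap i = ?w then 1 else 0)"
      by (rule snoc.IH[OF su])
    moreover have "u \<circ> adj_swap i = ?w \<longleftrightarrow> u = ?w'"
      unfolding w' by (metis swap_swap)
    moreover have "G (ws @ [i]) u = G ws (u \<circ> adj_swap i)"
      unfolding G_snoc[OF snoc.hyps(2)] using 3 by (simp add: zact_def)
    ultimately show ?thesis by (simp only:)
  qed
qed

abbreviation delta :: "(nat \<Rightarrow> bool) \<Rightarrow> wfun" where "delta v \<equiv> (\<lambda>u. if u = v then 1 else 0)"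

text \<open>Each \<open>UF j\<close> changes letters only at j and j + 1, so a deviation elsewhere
  is never repaired. Hence at \<open>cw lam \<tau>\<close> only the diagonal term q^-1 of each
  factor survives.\<close>

lemma UU_delta:
  assumes "distinct xs" "set xs \<subseteq> pairs lam"
  shows "(\<exists>i. u i \<noteq> cw lam \<tau> i \<and> (\<forall>j\<in>set xs. i \<noteq> j \<and> i \<noteq> Suc j)) \<Longrightarrow> R (UU xs) (delta (cw lam \<tau>)) u = 0"
    and "R (UU xs) (delta (cw lam \<tau>)) (cw lam \<tau>) = qinv ^ length xs"
proof -
  let ?w = "cw lam \<tau>"
  have "(\<forall>u. (\<exists>i. u i \<noteq> ?w i \<and> (\<forall>j\<in>set xs. i \<noteq> j \<and> i \<noteq> Suc j)) \<longrightarrow> R (UU xs) (delta ?w) u = 0) \<and>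
     R (UU xs) (delta ?w) ?w = qinv ^ length xs"
    using assms
  proof (induction xs)
    case Nil
    then show ?case by auto
  next
    case (Cons j xs)
    then have IH1: "R (UU xs) (delta ?w) u = 0" if "u i \<noteq> ?w i" "\<And>j. j \<in> set xs \<Longrightarrow> i \<noteq> j \<and> i \<noteq> Suc j" for u i
      using that by auto
    have IH2: "R (UU xs) (delta ?w) ?w = qinv ^ length xs" using Cons by simp
    have j: "j \<in> pairs lam" "j \<notin> set xs" and jN: "j \<in> ncut nu"
      using Cons.prems pairs_ncut comp by auto
    have X: "R (UU (j # xs)) f u = zact j (R (UU xs) f) u + qinv * R (UU xs) f u" for f u
      using R_UF[OF jN] by (simp add: rho_mult)
    have 1: "R (UU (j # xs)) (delta ?w) u = 0"
      if i: "u i \<noteq> ?w i" "\<forall>j\<in>set (j # xs). i \<noteq> j \<and> i \<noteq> Suc j" for u i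
    proof -
      have "R (UU xs) (delta ?w) u = 0" using i by (intro IH1[of _ i]) auto
      moreover have "(u \<circ> adj_swap j) i \<noteq> ?w i" using i by (simp add: adj_swap_def)
      then have "R (UU xs) (delta ?w) (u \<circ> adj_swap j) = 0" using i by (intro IH1[of _ i]) auto
      ultimately show ?thesis unfolding X by (simp add: zact_def)
    qed
    have "R (UU xs) (delta ?w) (?w \<circ> adj_swap j) = 0"
    proof (rule IH1[of _ j])
      show "(?w \<circ> adj_swap j) j \<noteq> ?w j" using cw_tau_01[OF j(1)] by simp
      fix j' assume "j' \<in> set xs"
      then have "j' \<in> pairs lam" "j' \<noteq> j" using Cons.prems j by auto
      then show "j \<noteq> j' \<and> j \<noteq> Suc j'" using lam_apart[of j' j] j(1) by auto
    qed
    then have "R (UU (j # xs)) (delta ?w) ?w = qinv ^ length (j # xs)"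
      unfolding X using cw_tau_01[OF j(1)] IH2 by (simp add: zact_def)
    then show ?case using 1 by blast
  qed
  then show "(\<exists>i. u i \<noteq> ?w i \<and> (\<forall>j\<in>set xs. i \<noteq> j \<and> i \<noteq> Suc j)) \<Longrightarrow> R (UU xs) (delta ?w) u = 0"
    and "R (UU xs) (delta ?w) ?w = qinv ^ length xs" by blast+
qed

text \<open>Transposition by \<open>rho_adjoint\<close> turns the right half of a Murphy element
  into the vector \<open>G ws\<close> that also describes its left half; the scalar is the diagonal
  value from \<open>UU_delta\<close>.\<close>

lemma G_dual:
  assumes v: "v \<in> W"
  shows "R (XX lam * ZZ ws) (delta v) (cw lam \<tau>) = qinv ^ sz * G ws v"
proof -
  let ?w = "cw lam \<tau>" and ?x = "XX lam * ZZ ws"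
  have w: "?w \<in> words n" and vw: "v \<in> words n" using cw_W[OF tau_T] v by (auto simp: W_def)
  have one: "(\<Sum>u\<in>words n. f u * delta v' u) = f v'" if "v' \<in> words n" for f :: wfun and v'
    using finite_words that by (simp add: if_distrib[of "\<lambda>x. _ * x"] sum.delta' cong: if_cong)
  have "R ?x (delta v) ?w = (\<Sum>u\<in>words n. R ?x (delta v) u * delta ?w u)" using one[OF w] by simp
  also have "\<dots> = (\<Sum>u\<in>words n. delta v u * R (starF ?x) (delta ?w) u)"
    by (rule rho_adjoint[OF N_range])
  also have "\<dots> = R (starF ?x) (delta ?w) v"
    using one[OF vw, of "R (starF ?x) (delta ?w)"] by (simp add: mult.commute)
  also have "\<dots> = R (starF (ZZ ws)) (R (starF (XX lam)) (delta ?w)) v"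
    by (simp add: starF_mult rho_mult)
  also have "\<dots> = R (starF (ZZ ws)) (\<lambda>u. qinv ^ sz * G0 u) v"
  proof (rule rho_local[OF W_swap _ v])
    fix u assume u: "u \<in> W"
    have "R (starF (XX lam)) (delta ?w) u = R (XX lam) (delta ?w) u" using star_XX by (rule R_cg)
    also have "\<dots> = G0 u * R (XX lam) (delta ?w) ?w" using XX_G0[OF u] .
    also have "R (XX lam) (delta ?w) ?w = qinv ^ sz"
      using UU_delta(2)[of "sorted_list_of_set (pairs lam)"] finite_pairs by (simp add: XX_def)
    finally show "R (starF (XX lam)) (delta ?w) u = qinv ^ sz * G0 u" by (simp add: mult.commute)
  qed
  also have "\<dots> = qinv ^ sz * G ws v" by (simp add: rho_fun_scale G_def)
  finally show ?thesis .
qed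

text \<open>On \<open>W\<close> the middle factor \<open>XX lam\<close> has image in the multiples
  of \<open>G0\<close>, so the element splits into a column from s and a row from t. The power of q
  in the row symmetrizer cancels the scalar of \<open>G_dual\<close>.\<close>

lemma mm_rank_one:
  assumes u: "u \<in> W" and v: "v \<in> W"
  shows "R (mm n lam s t) (delta v) u = G (rw s) u * G (rw t) v"
proof -
  have "c.cg (mm n lam s t) (starF (ZZ (rw s)) * (C (qL ^ sz) * XX lam * ZZ (rw t)))"
    unfolding mm_def using Xrow_XX by (intro c.cg_left c.cg_right)
  then have "R (mm n lam s t) (delta v) u
      = R (starF (ZZ (rw s))) (R (C (qL ^ sz) * (XX lam * ZZ (rw t))) (delta v)) u"
    using R_cg by (simp add: rho_mult mult.assoc)
  also have "\<dots> = R (starF (ZZ (rw s))) (\<lambda>u. G (rw t) v * G0 u) u"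
  proof (rule rho_local[OF W_swap _ u])
    fix u assume u: "u \<in> W"
    have "R (C (qL ^ sz) * (XX lam * ZZ (rw t))) (delta v) u = qL ^ sz * R (XX lam) (R (ZZ (rw t)) (delta v)) u"
      by (simp add: rho_mult rho_C)
    also have "\<dots> = qL ^ sz * (G0 u * R (XX lam * ZZ (rw t)) (delta v) (cw lam \<tau>))"
      using XX_G0[OF u] by (simp add: rho_mult)
    also have "\<dots> = (qL ^ sz * qinv ^ sz) * (G (rw t) v * G0 u)"
      unfolding G_dual[OF v] by (simp add: mult_ac)
    also have "qL ^ sz * qinv ^ sz = 1" by (simp flip: power_mult_distrib)
    finally show "R (C (qL ^ sz) * (XX lam * ZZ (rw t))) (delta v) u = G (rw t) v * G0 u" by simp
  qed
  also have "\<dots> = G (rw s) u * G (rw t) v"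
    by (subst rho_fun_scale) (simp add: G_def mult.commute)
  finally show ?thesis .
qed

text \<open>If \<open>XX l\<close> does not vanish at a word of \<open>W\<close>, the word is
  nonconstant on every pair of l, so in each block l has at most as many pairs as
  \<open>lam\<close>. Its total is not smaller, so equality holds in every block and
  \<open>shape_inj\<close> gives l = \<open>lam\<close>.\<close>

lemma mm_vanish:
  assumes l: "l \<in> MPar2 n" "comp_of l = nu" and ne: "l \<noteq> lam" and sz: "sz \<le> card (pairs l)"
    and u: "u \<in> W"
  shows "R (mm n l s t) f u = 0"
proof -
  interpret l: shape J n nu l using shapeI l by blast
  have len: "length l = length lam" using l(2) comp l.length_mu length_mu by metis
  have zero: "R (XX l) g u = 0" if u: "u \<in> W" for g u
  proof (rule ccontr)
    assume "R (XX l) g u \<noteq> 0"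
    then have d: "u j \<noteq> u (Suc j)" if "j \<in> pairs l" for j using l.XX_local(1)[OF that] by metis
    have le: "card (pairs l \<inter> block nu k) \<le> card (pairs lam \<inter> block nu k)" if "k < length lam" for k
      using l.pairs_count[of u k, OF d] u that l(2) comp by (simp add: W_def)
    have tot: "(\<Sum>k<length lam. card (pairs lam \<inter> block nu k)) \<le> (\<Sum>k<length lam. card (pairs l \<inter> block nu k))"
      using sz card_pairs l.card_pairs len l(2) comp by simp
    have "card (pairs l \<inter> block nu k) = card (pairs lam \<inter> block nu k)" if k: "k < length lam" for k
    proof (rule ccontr)
      assume "card (pairs l \<inter> block nu k) \<noteq> card (pairs lam \<inter> block nu k)"
      then have "card (pairs l \<inter> block nu k) < card (pairs lam \<inter> block nu k)" using le[OF k] by simp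
      then have "(\<Sum>k<length lam. card (pairs l \<inter> block nu k)) < (\<Sum>k<length lam. card (pairs lam \<inter> block nu k))"
        using le k by (intro sum_strict_mono_ex1) auto
      then show False using tot by simp
    qed
    then have "l = lam" using len l comp by (intro shape_inj[OF l(1) lam]) auto
    then show False using ne by contradiction
  qed
  have "c.cg (mm n l s t) (starF (ZZ (l.rw s)) * (C (qL ^ l.sz) * XX l * ZZ (l.rw t)))"
    unfolding mm_def using l.Xrow_XX by (intro c.cg_left c.cg_right)
  then have "R (mm n l s t) f u
      = R (starF (ZZ (l.rw s))) (R (C (qL ^ l.sz) * (XX l * ZZ (l.rw t))) f) u"
    using R_cg by (simp add: rho_mult mult.assoc)
  also have "\<dots> = R (starF (ZZ (l.rw s))) (\<lambda>u. 0) u"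
    by (rule rho_local[OF W_swap _ u]) (simp_all add: rho_mult rho_C zero)
  finally show ?thesis by simp
qed

end

context comp_ctx
begin

text \<open>Extremal choice: a shape with a nonzero coefficient and as few pairs as possible, and
  for it s0, t0 with maximal sum of the two heights. In the matrix entry at the words of s0 and t0
  all other terms vanish by \<open>mm_vanish\<close> and \<open>G_tri\<close>, and the coefficient
  itself is left.\<close>

lemma independence:
  assumes "(\<Sum>k\<in>KK 0. C (r k) * mmk k) \<in> corner (ncut nu)"
  shows "\<forall>k\<in>KK 0. r k = 0"
proof (rule ccontr)
  assume "\<not> (\<forall>k\<in>KK 0. r k = 0)"
  then have "\<exists>l s t. (l, s, t) \<in> KK 0 \<and> r (l, s, t) \<noteq> 0" by auto
  then obtain l where l: "\<exists>s t. (l, s, t) \<in> KK 0 \<and> r (l, s, t) \<noteq> 0"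
    and lmin: "\<And>l'. \<exists>s t. (l', s, t) \<in> KK 0 \<and> r (l', s, t) \<noteq> 0 \<Longrightarrow> card (pairs l) \<le> card (pairs l')"
    using ex_has_least_nat[of "\<lambda>l. \<exists>s t. (l, s, t) \<in> KK 0 \<and> r (l, s, t) \<noteq> 0" _ "\<lambda>l. card (pairs l)"]
    by blast
  have lsh: "l \<in> MPar2 n" "comp_of l = nu" using l by (auto simp: KK_def)
  interpret l: shape J n nu l using shapeI lsh by blast
  let ?P = "\<lambda>p. p \<in> T_init l \<times> T_init l \<and> r (l, p) \<noteq> 0"
  let ?f = "\<lambda>p. psum (cw l (fst p)) + psum (cw l (snd p))"
  have "\<exists>p. ?P p" using l by (auto simp: KK_def)
  then have ne: "{p. ?P p} \<noteq> {}" by blast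
  have fin: "finite {p. ?P p}"
    by (rule finite_subset[of _ "T_init l \<times> T_init l"]) (use l.finite_T in auto)
  have "Max (?f ` {p. ?P p}) \<in> ?f ` {p. ?P p}" using fin ne by (intro Max_in) auto
  then obtain p0 where p0: "?P p0" "?f p0 = Max (?f ` {p. ?P p})" by auto
  obtain s0 t0 where st: "p0 = (s0, t0)" by (cases p0)
  have s0: "s0 \<in> T_init l" and t0: "t0 \<in> T_init l" and r0: "r (l, s0, t0) \<noteq> 0"
    using p0 by (auto simp: st)
  have pmax: "psum (cw l s) + psum (cw l t) \<le> psum (cw l s0) + psum (cw l t0)"
    if "s \<in> T_init l" "t \<in> T_init l" "r (l, s, t) \<noteq> 0" for s t
  proof -
    have "?f (s, t) \<in> ?f ` {p. ?P p}" by (rule imageI) (use that in simp)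
    then have "?f (s, t) \<le> ?f p0" unfolding p0(2) using fin by (intro Max_ge finite_imageI)
    then show ?thesis by (simp add: st)
  qed
  let ?u = "cw l s0" and ?v = "cw l t0"
  have uW: "?u \<in> l.W" and vW: "?v \<in> l.W" using l.cw_W s0 t0 by blast+
  have tm: "r k * l.R (mmk k) (l.delta ?v) ?u = (if k = (l, s0, t0) then r (l, s0, t0) else 0)"
    if k: "k \<in> KK 0" for k
  proof (cases "r k = 0")
    case True
    then show ?thesis using r0 by auto
  next
    case False
    obtain l' s t where k': "k = (l', s, t)" by (metis prod_cases3)
    then have l': "l' \<in> MPar2 n" "comp_of l' = nu" "s \<in> T_init l'" "t \<in> T_init l'"
      using k by (auto simp: KK_def)
    show ?thesis
    proof (cases "l' = l")
      case False
      have "card (pairs l) \<le> card (pairs l')" using lmin[of l'] k k' \<open>r k \<noteq> 0\<close> by blast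
      then have "l.R (mm n l' s t) (l.delta ?v) ?u = 0"
        using l.mm_vanish[OF l'(1,2) False _ uW] by blast
      then show ?thesis using False k' by simp
    next
      case True
      have sT: "s \<in> T_init l" "t \<in> T_init l" using l' True by auto
      have e: "l.R (mmk k) (l.delta ?v) ?u = l.G (l.rw s) ?u * l.G (l.rw t) ?v"
        using l.mm_rank_one[OF uW vW] k' True by simp
      have Gs: "l.G (l.rw s) ?u = (if s = s0 then 1 else 0)" if "psum (cw l s) \<le> psum ?u"
        using l.G_tri[OF l.rw_path[OF sT(1)] uW that] l.cw_inj[OF s0 sT(1)] by auto
      have Gt: "l.G (l.rw t) ?v = (if t = t0 then 1 else 0)" if "psum (cw l t) \<le> psum ?v"
        using l.G_tri[OF l.rw_path[OF sT(2)] vW that] l.cw_inj[OF t0 sT(2)] by auto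
      have mx: "psum (cw l s) + psum (cw l t) \<le> psum ?u + psum ?v"
        using pmax[OF sT] \<open>r k \<noteq> 0\<close> k' True by simp
      \<comment> \<open>Maximality bounds only the sum: if one word is too high for
        \<open>G_tri\<close>, the other is strictly lower than its counterpart, and its factor is
        0.\<close>
      consider "psum (cw l s) \<le> psum ?u" "psum (cw l t) \<le> psum ?v"
        | "psum (cw l t) < psum ?v" | "psum (cw l s) < psum ?u" using mx by linarith
      then show ?thesis
      proof cases
        case 1
        then show ?thesis using e Gs Gt k' True by simp
      next
        case 2
        then have "t \<noteq> t0" by auto
        then show ?thesis using e Gt 2 k' True by simp
      next
        case 3
        then have "s \<noteq> s0" by auto
        then show ?thesis using e Gs 3 k' True by simp
      qed
    qed
  qed
  have "0 = l.R (\<Sum>k\<in>KK 0. C (r k) * mmk k) (l.delta ?v) ?u"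
    using corner_ker[OF l.N_range assms] by simp
  also have "\<dots> = (\<Sum>k\<in>KK 0. r k * l.R (mmk k) (l.delta ?v) ?u)"
    by (simp add: rho_sum rho_mult rho_C)
  also have "\<dots> = (\<Sum>k\<in>KK 0. if k = (l, s0, t0) then r (l, s0, t0) else 0)"
    using tm by (intro sum.cong) auto
  also have "\<dots> = r (l, s0, t0)"
  proof -
    have "(l, s0, t0) \<in> KK 0" using s0 t0 lsh by (simp add: KK_def)
    then show ?thesis using finite_KK by simp
  qed
  finally show False using r0 by simp
qed

end

section \<open>Cellularity\<close>

definition mk :: "nat \<Rightarrow> nat list list \<times> (nat \<times> nat \<times> nat \<Rightarrow> nat) \<times> (nat \<times> nat \<times> nat \<Rightarrow> nat) \<Rightarrow> bfree" where
  "mk n k = (case k of (l, s, t) \<Rightarrow> m_elt n l s t)"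

text \<open>Only shapes of the same composition are compared, so one order serves for every corner
  and for the whole algebra.\<close>

definition more_pairs :: "nat list list \<Rightarrow> nat list list \<Rightarrow> bool" where
  "more_pairs l' l \<longleftrightarrow> comp_of l' = comp_of l \<and> card (pairs l) < card (pairs l')"

lemma cellular_wrtI:
  fixes Lam :: "nat list list set"
  defines "K \<equiv> {(l, s, t). l \<in> Lam \<and> s \<in> T_init l \<and> t \<in> T_init l}"
  assumes tsi: "two_sided_ideal J"
    and fin: "finite Lam" "\<And>l. l \<in> Lam \<Longrightarrow> finite (T_init l)"
    and star: "\<And>x. x \<in> J \<Longrightarrow> starF x \<in> J" "starF e - e \<in> J"
    and mem: "\<And>k. k \<in> K \<Longrightarrow> e * (mk n k * e) - mk n k \<in> J"
    and span: "\<And>x. \<exists>r. e * (x * e) - (\<Sum>k\<in>K. C (r k) * mk n k) \<in> J"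
    and indep: "\<And>r. (\<Sum>k\<in>K. C (r k) * mk n k) \<in> J \<Longrightarrow> \<forall>k\<in>K. r k = 0"
    and C2: "\<And>l s t. (l, s, t) \<in> K \<Longrightarrow> starF (m_elt n l s t) - m_elt n l t s \<in> J"
    and C3: "\<And>l a s. l \<in> Lam \<Longrightarrow> s \<in> T_init l \<Longrightarrow> \<exists>r. \<forall>t. \<exists>r'.
      e * (a * e) * m_elt n l s t - (\<Sum>s'\<in>T_init l. C (r s') * m_elt n l s' t)
        - (\<Sum>k | k \<in> K \<and> more_pairs (fst k) l. C (r' k) * mk n k) \<in> J"
  shows "cellular_wrt J e starF Lam T_init (m_elt n)"
proof -
  have comb: "(\<Sum>(l, s, t)\<in>A. smultF (r (l, s, t)) (m_elt n l s t)) = (\<Sum>k\<in>A. C (r k) * mk n k)" for r A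
    by (rule sum.cong) (auto simp: smultF_eq mk_def)
  have K: "{(l, s, t). l \<in> Lam \<and> s \<in> T_init l \<and> t \<in> T_init l} = K" by (simp add: K_def)
  have low: "{(l', u, v). (l', u, v) \<in> K \<and> more_pairs l' l} = {k. k \<in> K \<and> more_pairs (fst k) l}" for l by auto
  show ?thesis
    unfolding cellular_wrt_def Let_def comb K
  proof (intro conjI)
    show "anti_involution_mod J e starF"
      using star tsi by (simp add: anti_involution_mod_def starF_add starF_mult smultF_eq mulF_eq
          two_sided_ideal_iff C_commute[of "starF _"])
    show "\<forall>(l, s, t)\<in>K. mulF e (mulF (m_elt n l s t) e) - m_elt n l s t \<in> J"
      using mem by (force simp: mulF_eq mk_def)
    show "\<forall>x. \<exists>r. mulF e (mulF x e) - (\<Sum>k\<in>K. C (r k) * mk n k) \<in> J"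
      using span by (simp add: mulF_eq)
    show "\<exists>lt. (\<forall>l\<in>Lam. \<not> lt l l) \<and> (\<forall>a\<in>Lam. \<forall>b\<in>Lam. \<forall>d\<in>Lam. lt a b \<longrightarrow> lt b d \<longrightarrow> lt a d) \<and>
      (\<forall>l\<in>Lam. \<forall>a. \<forall>s\<in>T_init l. \<exists>r. \<forall>t\<in>T_init l. \<exists>r'.
        mulF (mulF e (mulF a e)) (m_elt n l s t) - (\<Sum>s'\<in>T_init l. smultF (r s') (m_elt n l s' t))
         - (\<Sum>k\<in>{(l', u, v). (l', u, v) \<in> K \<and> lt l' l}. C (r' k) * mk n k) \<in> J)"
    proof (intro exI[of _ more_pairs] conjI ballI allI)
      fix l a s assume "l \<in> Lam" "s \<in> T_init l"
      from C3[OF this, of a] obtain r where r: "\<And>t. \<exists>r'.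
        e * (a * e) * m_elt n l s t - (\<Sum>s'\<in>T_init l. C (r s') * m_elt n l s' t)
          - (\<Sum>k | k \<in> K \<and> more_pairs (fst k) l. C (r' k) * mk n k) \<in> J" by blast
      show "\<exists>r. \<forall>t\<in>T_init l. \<exists>r'.
        mulF (mulF e (mulF a e)) (m_elt n l s t) - (\<Sum>s'\<in>T_init l. smultF (r s') (m_elt n l s' t))
         - (\<Sum>k\<in>{(l', u, v). (l', u, v) \<in> K \<and> more_pairs l' l}. C (r' k) * mk n k) \<in> J"
        unfolding low mulF_eq smultF_eq using r by (intro exI[of _ r] ballI)
    qed (auto simp: more_pairs_def)
  qed (use fin indep C2 in auto)
qed

context comp_ctx
begin

abbreviation "\<epsilon> \<equiv> Eidem n (ncut nu)"

lemma EE_nu: "EE n (lsp_of_comp nu) = \<epsilon>"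
  using EE_eq[OF lsp_of_comp(1)[OF nu]] lsp_of_comp(2)[OF nu] by simp

lemma eps_idem: "\<epsilon> * \<epsilon> \<approx> \<epsilon>"
  by (rule Eidem_idem[OF ncut_subset[OF nu]])

lemma m_elt_mm:
  assumes "comp_of l = nu"
  shows "m_elt n l s t \<approx> \<epsilon> * mm n l s t"
proof -
  have "m_elt n l s t = starF (ZZ (rwt n l s)) * \<epsilon> * (Xrow n l * ZZ (rwt n l t))"
    by (simp add: m_elt_eq assms EE_nu mult.assoc)
  also have "\<dots> \<approx> \<epsilon> * starF (ZZ (rwt n l s)) * (Xrow n l * ZZ (rwt n l t))"
    by (rule cg_right[OF cg_sym[OF Eidem_central]])
  finally show ?thesis by (simp add: mm_def mult.assoc)
qed

lemma mk_mm: "k \<in> KK d \<Longrightarrow> mk n k \<approx> \<epsilon> * mmk k"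
  unfolding KK_def mk_def using m_elt_mm by auto

text \<open>The bridge back to \<open>J\<close>: multiplication by the idempotent turns a congruence
  modulo its annihilator into one modulo \<open>J\<close>.\<close>

lemma eps_cg: "x - y \<in> corner (ncut nu) \<Longrightarrow> \<epsilon> * x \<approx> \<epsilon> * y"
  by (simp add: corner_def cg_def right_diff_distrib)

lemma eps_absorb:
  assumes "y \<approx> \<epsilon> * x"
  shows "\<epsilon> * y \<approx> y" "y * \<epsilon> \<approx> y"
proof -
  have "\<epsilon> * y \<approx> \<epsilon> * (\<epsilon> * x)" using assms by (rule cg_left)
  also have "\<dots> = \<epsilon> * \<epsilon> * x" by (simp add: mult.assoc)
  also have "\<dots> \<approx> \<epsilon> * x" using eps_idem by (rule cg_right)
  also have "\<dots> \<approx> y" using assms by (rule cg_sym)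
  finally show 1: "\<epsilon> * y \<approx> y" .
  show "y * \<epsilon> \<approx> y" using cg_trans[OF cg_sym[OF Eidem_central] 1] .
qed

lemma sum_mk: "A \<subseteq> KK d \<Longrightarrow> (\<Sum>k\<in>A. C (r k) * mk n k) \<approx> \<epsilon> * (\<Sum>k\<in>A. C (r k) * mmk k)"
  unfolding sum_distrib_left C_left_commute[of \<epsilon>]
  using mk_mm by (intro cg_sum cg_left) blast

lemma mk_span: "\<exists>r. \<epsilon> * x \<approx> (\<Sum>k\<in>KK 0. C (r k) * mk n k)"
proof -
  obtain r where "x - (\<Sum>k\<in>KK 0. C (r k) * mmk k) \<in> corner (ncut nu)" using spanning by blast
  then have "\<epsilon> * x \<approx> \<epsilon> * (\<Sum>k\<in>KK 0. C (r k) * mmk k)" by (rule eps_cg)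
  also have "\<dots> \<approx> (\<Sum>k\<in>KK 0. C (r k) * mk n k)" by (rule cg_sym[OF sum_mk[OF subset_refl]])
  finally show ?thesis by blast
qed

lemma mk_indep:
  assumes "(\<Sum>k\<in>KK 0. C (r k) * mk n k) \<in> J"
  shows "\<forall>k\<in>KK 0. r k = 0"
proof -
  have "\<epsilon> * (\<Sum>k\<in>KK 0. C (r k) * mmk k) \<in> J"
    by (rule cg_mem[OF cg_sym[OF sum_mk[OF subset_refl]] assms])
  then show ?thesis by (intro independence) (simp add: corner_def)
qed

lemma m_elt_star:
  assumes "l \<in> MPar2 n" "comp_of l = nu"
  shows "starF (m_elt n l s t) \<approx> m_elt n l t s"
proof -
  interpret l: shape J n nu l using shapeI assms by blast
  have "starF (m_elt n l s t) \<approx> starF (\<epsilon> * mm n l s t)"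
    using star_ideal m_elt_mm[OF assms(2)] by (simp add: cg_def flip: starF_diff)
  also have "starF (\<epsilon> * mm n l s t) = starF (mm n l s t) * starF \<epsilon>" by (simp add: starF_mult)
  also have "\<dots> \<approx> starF (mm n l s t) * \<epsilon>" using starF_Eidem by (rule cg_left)
  also have "\<dots> \<approx> \<epsilon> * starF (mm n l s t)" by (rule cg_sym[OF Eidem_central])
  also have "\<dots> \<approx> \<epsilon> * mm n l t s" using l.star_mm by (intro eps_cg) (simp add: c.cg_def)
  also have "\<dots> \<approx> m_elt n l t s" by (rule cg_sym[OF m_elt_mm[OF assms(2)]])
  finally show ?thesis .
qed

lemma m_elt_C3:
  assumes l: "l \<in> MPar2 n" "comp_of l = nu" and s: "s \<in> T_init l"
  shows "\<exists>r. \<forall>t. \<exists>r'. a * m_elt n l s t - (\<Sum>s'\<in>T_init l. C (r s') * m_elt n l s' t)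
    - (\<Sum>k\<in>KK (Suc (card (pairs l))). C (r' k) * mk n k) \<in> J"
proof -
  let ?d = "Suc (card (pairs l))"
  obtain r where r: "\<And>t. \<exists>r'. a * mm n l s t - (\<Sum>s'\<in>T_init l. C (r s') * mm n l s' t)
    - (\<Sum>k\<in>KK ?d. C (r' k) * mmk k) \<in> corner (ncut nu)"
    using C3[OF assms] by blast
  have "\<exists>r'. a * m_elt n l s t - (\<Sum>s'\<in>T_init l. C (r s') * m_elt n l s' t)
    - (\<Sum>k\<in>KK ?d. C (r' k) * mk n k) \<in> J" for t
  proof -
    obtain r' where r': "a * mm n l s t - (\<Sum>s'\<in>T_init l. C (r s') * mm n l s' t)
      - (\<Sum>k\<in>KK ?d. C (r' k) * mmk k) \<in> corner (ncut nu)" (is "?z \<in> _") using r by blast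
    have 1: "a * m_elt n l s t \<approx> \<epsilon> * (a * mm n l s t)"
    proof -
      have "a * m_elt n l s t \<approx> a * (\<epsilon> * mm n l s t)" using m_elt_mm[OF l(2)] by (rule cg_left)
      also have "\<dots> = a * \<epsilon> * mm n l s t" by (simp add: mult.assoc)
      also have "\<dots> \<approx> \<epsilon> * a * mm n l s t" by (rule cg_right[OF cg_sym[OF Eidem_central]])
      finally show ?thesis by (simp add: mult.assoc)
    qed
    have 2: "(\<Sum>s'\<in>T_init l. C (r s') * m_elt n l s' t) \<approx> \<epsilon> * (\<Sum>s'\<in>T_init l. C (r s') * mm n l s' t)"
      unfolding sum_distrib_left C_left_commute[of \<epsilon>] by (intro cg_sum cg_left m_elt_mm[OF l(2)])
    have "a * m_elt n l s t - (\<Sum>s'\<in>T_init l. C (r s') * m_elt n l s' t) - (\<Sum>k\<in>KK ?d. C (r' k) * mk n k)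
        \<approx> \<epsilon> * (a * mm n l s t) - \<epsilon> * (\<Sum>s'\<in>T_init l. C (r s') * mm n l s' t) - \<epsilon> * (\<Sum>k\<in>KK ?d. C (r' k) * mmk k)"
      by (intro cg_diff 1 2 sum_mk[of _ ?d]) simp
    also have "\<dots> = \<epsilon> * ?z" by (simp only: right_diff_distrib)
    finally have "a * m_elt n l s t - (\<Sum>s'\<in>T_init l. C (r s') * m_elt n l s' t)
      - (\<Sum>k\<in>KK ?d. C (r' k) * mk n k) \<in> J"
      by (rule cg_mem) (use r' in \<open>simp only: corner_def mem_Collect_eq\<close>)
    then show ?thesis by blast
  qed
  then show ?thesis by blast
qed

lemma KK_0: "{(l, s, t). l \<in> {lam \<in> MPar2 n. comp_of lam = nu} \<and> s \<in> T_init l \<and> t \<in> T_init l} = KK 0"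
  by (auto simp: KK_def)

lemma finite_T_init: "l \<in> MPar2 n \<Longrightarrow> finite (T_init l)"
  using two_col.finite_T[of n l] two_col.intro by blast

lemma cellular_corner: "cellular_wrt J \<epsilon> starF {lam \<in> MPar2 n. comp_of lam = nu} T_init (m_elt n)"
proof (rule cellular_wrtI[OF tsi], unfold KK_0)
  show "finite {lam \<in> MPar2 n. comp_of lam = nu}" using finite_MPar2 by simp
  show "finite (T_init l)" if "l \<in> {lam \<in> MPar2 n. comp_of lam = nu}" for l
    using that finite_T_init by simp
  show "starF \<epsilon> - \<epsilon> \<in> J" using starF_Eidem by (simp add: cg_def)
  show "\<epsilon> * (mk n k * \<epsilon>) - mk n k \<in> J" if "k \<in> KK 0" for k
    using cg_trans[OF cg_left[OF eps_absorb(2)] eps_absorb(1)] mk_mm[OF that] unfolding cg_def by blast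
  show "\<exists>r. \<epsilon> * (x * \<epsilon>) - (\<Sum>k\<in>KK 0. C (r k) * mk n k) \<in> J" for x
  proof -
    have "\<epsilon> * (x * \<epsilon>) \<approx> \<epsilon> * (\<epsilon> * x)" by (rule cg_left[OF cg_sym[OF Eidem_central]])
    also have "\<dots> \<approx> \<epsilon> * x" using cg_right[OF eps_idem, of x] by (simp add: mult.assoc)
    finally show ?thesis using mk_span[of x] cg_trans unfolding cg_def by blast
  qed
  show "\<forall>k\<in>KK 0. r k = 0" if "(\<Sum>k\<in>KK 0. C (r k) * mk n k) \<in> J" for r using mk_indep that .
  show "starF (m_elt n l s t) - m_elt n l t s \<in> J" if "(l, s, t) \<in> KK 0" for l s t
    using m_elt_star[of l s t] that by (simp add: KK_def cg_def)
  show "\<exists>r. \<forall>t. \<exists>r'. \<epsilon> * (a * \<epsilon>) * m_elt n l s t - (\<Sum>s'\<in>T_init l. C (r s') * m_elt n l s' t)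
      - (\<Sum>k | k \<in> KK 0 \<and> more_pairs (fst k) l. C (r' k) * mk n k) \<in> J"
    if "l \<in> {lam \<in> MPar2 n. comp_of lam = nu}" "s \<in> T_init l" for l a s
  proof -
    have l: "l \<in> MPar2 n" "comp_of l = nu" using that by auto
    have low: "{k. k \<in> KK 0 \<and> more_pairs (fst k) l} = KK (Suc (card (pairs l)))"
      using l by (auto simp: KK_def more_pairs_def)
    show ?thesis unfolding low by (rule m_elt_C3[OF l that(2)])
  qed
qed (rule star_ideal)

end

context bTL
begin

lemma comp_ctxI: "nu \<in> compositions n \<Longrightarrow> comp_ctx J n nu"
  by unfold_locales

text \<open>The idempotents sum to 1, so the spanning sets of the corners add up. They are
  orthogonal, so multiplying a relation by one of them isolates the terms of its composition. In
  (C3) all terms stay in the composition of l.\<close>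

lemma cellular_all: "cellular_wrt J 1 starF (MPar2 n) T_init (m_elt n)"
proof (rule cellular_wrtI[OF tsi])
  let ?K = "{(l, s, t). l \<in> MPar2 n \<and> s \<in> T_init l \<and> t \<in> T_init l}"
  let ?Km = "\<lambda>nu. {(l, s, t). l \<in> MPar2 n \<and> comp_of l = nu \<and> 0 \<le> card (pairs l) \<and> s \<in> T_init l \<and> t \<in> T_init l}"
  have Km: "?Km nu = comp_ctx.KK n nu 0" if "nu \<in> compositions n" for nu
    using comp_ctx.KK_def[OF comp_ctxI[OF that]] by simp
  have fin: "finite (T_init l)" if "l \<in> MPar2 n" for l using two_col.finite_T[of n l] two_col.intro that by blast
  have finK: "finite ?K"
  proof (rule finite_subset)
    show "?K \<subseteq> (SIGMA l : MPar2 n. T_init l \<times> T_init l)" by auto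
  qed (use finite_MPar2 fin in auto)
  have comp: "comp_of l \<in> compositions n" if "l \<in> MPar2 n" for l
    using two_col.mu_comp[of n l] two_col.intro that by blast
  have finc: "finite (compositions n)" using bij_betw_finite[OF bij_ncut, of n] by simp
  have split: "(\<Sum>k\<in>?K. h k) = (\<Sum>nu\<in>compositions n. \<Sum>k\<in>?Km nu. h k)" for h :: "_ \<Rightarrow> bfree"
  proof -
    have "(\<Sum>nu\<in>compositions n. sum h {k \<in> ?K. comp_of (fst k) = nu}) = sum h ?K"
      by (rule sum.group[OF finK finc]) (use comp in auto)
    moreover have "{k \<in> ?K. comp_of (fst k) = nu} = ?Km nu" for nu by auto
    ultimately show ?thesis by simp
  qed
  show "finite (MPar2 n)" by (rule finite_MPar2)
  show "finite (T_init l)" if "l \<in> MPar2 n" for l using fin that .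
  show "starF 1 - 1 \<in> J" by simp
  show "1 * (mk n k * 1) - mk n k \<in> J" for k by simp
  show "\<exists>r. 1 * (x * 1) - (\<Sum>k\<in>?K. C (r k) * mk n k) \<in> J" for x
  proof -
    have "\<forall>nu\<in>compositions n. \<exists>r. Eidem n (ncut nu) * x \<approx> (\<Sum>k\<in>?Km nu. C (r k) * mk n k)"
      using comp_ctx.mk_span[OF comp_ctxI] Km by simp
    from bchoice[OF this] obtain r where r: "\<forall>nu\<in>compositions n.
        Eidem n (ncut nu) * x \<approx> (\<Sum>k\<in>?Km nu. C (r nu k) * mk n k)" by blast
    \<comment> \<open>Every index belongs to exactly one corner, so the coefficient families of the
      corners can be glued.\<close>
    let ?r = "\<lambda>k. r (comp_of (fst k)) k"
    have "(\<Sum>nu\<in>compositions n. Eidem n (ncut nu)) = (\<Sum>N\<in>Pow {1..<n}. Eidem n N)"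
      by (rule sum.reindex_bij_betw[OF bij_ncut])
    then have "x = (\<Sum>nu\<in>compositions n. Eidem n (ncut nu) * x)"
      using Eidem_sum by (simp flip: sum_distrib_right)
    also have "\<dots> \<approx> (\<Sum>nu\<in>compositions n. \<Sum>k\<in>?Km nu. C (r nu k) * mk n k)"
      using r by (intro cg_sum) blast
    also have "\<dots> = (\<Sum>nu\<in>compositions n. \<Sum>k\<in>?Km nu. C (?r k) * mk n k)"
      by (intro sum.cong) auto
    also have "\<dots> = (\<Sum>k\<in>?K. C (?r k) * mk n k)" by (rule split[symmetric])
    finally show ?thesis by (intro exI[of _ ?r]) (simp add: cg_def)
  qed
  show "\<forall>k\<in>?K. r k = 0" if z: "(\<Sum>k\<in>?K. C (r k) * mk n k) \<in> J" for r
  proof -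
    have zero: "(\<Sum>k\<in>?Km nu. C (r k) * mk n k) \<in> J" if nu: "nu \<in> compositions n" for nu
    proof -
      let ?e = "Eidem n (ncut nu)"
      have e: "?e * mk n k \<approx> (if comp_of (fst k) = nu then mk n k else 0)" if k: "k \<in> ?K" for k
      proof -
        define m where "m = comp_of (fst k)"
        have m: "m \<in> compositions n" using comp k by (auto simp: m_def)
        interpret m: comp_ctx J n m by (rule comp_ctxI[OF m])
        have "k \<in> ?Km m" using k by (auto simp: m_def)
        then have "k \<in> m.KK 0" unfolding Km[OF m] .
        note mk = m.mk_mm[OF this]
        show ?thesis
        proof (cases "m = nu")
          case True
          then show ?thesis using m.eps_absorb(1)[OF mk] by (simp add: m_def)
        next
          case False
          then have "ncut nu \<noteq> ncut m" using ncut_inj[OF nu m] by blast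
          then have "?e * Eidem n (ncut m) * m.mmk k \<in> J" by (intro Imult_right Eidem_orth)
          then have "?e * mk n k \<in> J" using cg_mem[OF cg_left[OF mk, of ?e]] by (simp add: mult.assoc)
          then show ?thesis using False by (simp add: m_def cg_0)
        qed
      qed
      have "?e * (\<Sum>k\<in>?K. C (r k) * mk n k) \<approx> (\<Sum>k\<in>?K. C (r k) * (if comp_of (fst k) = nu then mk n k else 0))"
        unfolding sum_distrib_left C_left_commute[of ?e] using e by (intro cg_sum cg_left)
      also have "\<dots> = (\<Sum>k\<in>?K. if comp_of (fst k) = nu then C (r k) * mk n k else 0)"
        by (intro sum.cong) auto
      also have "\<dots> = (\<Sum>k | k \<in> ?K \<and> comp_of (fst k) = nu. C (r k) * mk n k)"
        by (rule sum.inter_filter[OF finK, symmetric])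
      also have "{k. k \<in> ?K \<and> comp_of (fst k) = nu} = ?Km nu" by auto
      finally show ?thesis using cg_mem[OF cg_sym Imult_left[OF z]] by blast
    qed
    show ?thesis
    proof
      fix k assume k: "k \<in> ?K"
      define m where "m = comp_of (fst k)"
      have m: "m \<in> compositions n" using comp k by (auto simp: m_def)
      have "k \<in> comp_ctx.KK n m 0" using Km[OF m] k by (auto simp: m_def)
      then show "r k = 0" using comp_ctx.mk_indep[OF comp_ctxI[OF m]] zero[OF m] Km[OF m] by simp
    qed
  qed
  show "starF (m_elt n l s t) - m_elt n l t s \<in> J" if "(l, s, t) \<in> ?K" for l s t
    using comp_ctx.m_elt_star[OF comp_ctxI[OF comp[of l]]] that by (auto simp: cg_def)
  show "\<exists>r. \<forall>t. \<exists>r'. 1 * (a * 1) * m_elt n l s t - (\<Sum>s'\<in>T_init l. C (r s') * m_elt n l s' t)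
      - (\<Sum>k | k \<in> ?K \<and> more_pairs (fst k) l. C (r' k) * mk n k) \<in> J"
    if l: "l \<in> MPar2 n" "s \<in> T_init l" for l a s
  proof -
    interpret m: comp_ctx J n "comp_of l" by (rule comp_ctxI[OF comp[OF l(1)]])
    have low: "{k. k \<in> ?K \<and> more_pairs (fst k) l} = m.KK (Suc (card (pairs l)))"
      by (auto simp: m.KK_def more_pairs_def)
    show ?thesis unfolding low using m.m_elt_C3[OF l(1) refl l(2), of a] by simp
  qed
qed (rule star_ideal)

end

theorem theorem6p2:
  fixes n :: nat
  shows "(\<forall>mu\<in>compositions n.
            cellular_wrt (bTL_ideal n) (EE n (lsp_of_comp mu)) starF
              {lam \<in> MPar2 n. comp_of lam = mu} T_init (m_elt n))
       \<and> cellular_wrt (bTL_ideal n) oneF starF (MPar2 n) T_init (m_elt n)"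
proof -
  interpret bTL "bTL_ideal n" n
    by unfold_locales (simp_all add: bTL_ideal_def ideal_gen_tsi)
  have "cellular_wrt (bTL_ideal n) (EE n (lsp_of_comp mu)) starF
      {lam \<in> MPar2 n. comp_of lam = mu} T_init (m_elt n)" if "mu \<in> compositions n" for mu
  proof -
    interpret comp_ctx "bTL_ideal n" n mu by (rule comp_ctxI[OF that])
    show ?thesis unfolding EE_nu by (rule cellular_corner)
  qed
  then show ?thesis using cellular_all by (simp add: oneF_eq)
qed

end
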